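(* Let $\alpha>0$ and let $\mathfrak f(z)=\sum_{n\ge0}f(n)z^n$ be an $\alpha$-admissible function on $\mathbb D$ such that $(1-z)\mathfrak f(z)\in A^\alpha(\mathbb D)$ and $D^\alpha f(j)\,j^\alpha\to0$ as $j\to\infty$. Let $T$ be a $(C,\alpha)$-bounded operator on a complex Banach space $X$ with $\overline{\operatorname{Ran}}(I-T)=X$. Then the following assertions are equivalent for a given $x\in X$: (i) $x\in\operatorname{Dom}\mathfrak f(T)$. (ii) The series $\sum_{j\ge0}D^\alpha f(j)\,\Delta^{-\alpha}\mathcal T(j)x$ converges in norm. (iii) The series $\sum_{j\ge0}D^\alpha f(j)\,\Delta^{-\alpha}\mathcal T(j)x$ converges weakly. Furthermore, if (i)–(iii) hold, then $$\mathfrak f(T)x=\sum_{j\ge0}D^\alpha f(j)\,\Delta^{-\alpha}\mathcal T(j)x.$$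
   Context: For $\alpha\in\mathbb R$: $k^\alpha(0)=1$, $k^\alpha(n)=\frac{\alpha(\alpha+1)\cdots(\alpha+n-1)}{n!}$ for $n\ge1$. For a sequence $f$ on $\mathbb N_0$ and $\alpha\ge0$, whenever the series converge: $D^\alpha f(n)=\sum_{j=n}^\infty k^{-\alpha}(j-n)f(j)$ and $W^{-\alpha}f(n)=\sum_{j=n}^\infty k^\alpha(j-n)f(j)$. Weyl difference: $W^0$ is the identity; $Wf(n)=f(n)-f(n+1)$; $W^\alpha$ is the $\alpha$-th iterate of $W$ if $\alpha\in\mathbb N$; $W^\alpha f=W^mW^{-(m-\alpha)}f$ with $m=[\alpha]+1$ for non-integer $\alpha>0$ ($W^\alpha=D^\alpha$ when both make sense). $\alpha$-admissible: $\mathfrak f(z)=\sum f(n)z^n$ holomorphic on $\mathbb D$ such that (a) $f$ is bounded, and for $\beta\in\{0,\alpha\}$: $D^\beta f(n)\ge0$ for all $n\in\mathbb N_0$ and $W^{-\beta}(D^\beta f)=f$; (b) $\mathfrak f$ has no zeros in $\mathbb D$ and, if $1/\mathfrak f(z)=\sum g(n)z^n$, then for $\beta\in\{0,\alpha\}$ the differences $W^\beta g$ exist, $W^\beta g(0)\ge0$ and $W^\beta g(n)\le0$ for $n\ge1$. $A^\alpha(\mathbb D)$ is the Banach algebra (pointwise multiplication) of functions $\mathfrak h(z)=\sum h(n)z^n$ for which $h\in\ell^1$ and $h=W^{-\alpha}u$ for some (unique) sequence $u=:W^\alpha h$ with $\|\mathfrak h\|_{A^\alpha(\mathbb D)}:=\sum_n|u(n)|k^{\alpha+1}(n)<\infty$.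 For $T\in\mathcal B(X)$: $\Delta^{-\alpha}\mathcal T(n)=\sum_{j=0}^nk^\alpha(n-j)T^j$, and $T$ is $(C,\alpha)$-bounded if $\sup_n\|\Delta^{-\alpha}\mathcal T(n)\|/k^{\alpha+1}(n)<\infty$. For such $T$ and $\mathfrak h\in A^\alpha(\mathbb D)$, $\mathfrak h(T):=\sum_{n\ge0}W^\alpha h(n)\Delta^{-\alpha}\mathcal T(n)\in\mathcal B(X)$; this is a bounded algebra homomorphism. If $I-T$ is injective (which is the case when $T$ is $(C,\alpha)$-bounded and $\overline{\operatorname{Ran}}(I-T)=X$) and $(1-z)\mathfrak f\in A^\alpha(\mathbb D)$, then $\mathfrak f(T)$ is the closed operator $\mathfrak f(T):=(I-T)^{-1}[(1-z)\mathfrak f](T)$ with domain $\operatorname{Dom}\mathfrak f(T)=\{x\in X:[(1-z)\mathfrak f](T)x\in\operatorname{Ran}(I-T)\}$. *)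

theory Defs
  imports "HOL-Complex_Analysis.Complex_Analysis"
begin

section \<open>Complex Banach spaces and bounded operators\<close>

class complex_normed_vector = real_normed_vector +
  fixes scaleC :: "complex \<Rightarrow> 'a \<Rightarrow> 'a"  (infixr \<open>*\<^sub>C\<close> 75)
  assumes scaleC_add_right: "c *\<^sub>C (x + y) = c *\<^sub>C x + c *\<^sub>C y"
    and scaleC_add_left: "(c + d) *\<^sub>C x = c *\<^sub>C x + d *\<^sub>C x"
    and scaleC_scaleC: "c *\<^sub>C (d *\<^sub>C x) = (c * d) *\<^sub>C x"
    and scaleC_one: "1 *\<^sub>C x = x"
    and scaleR_scaleC: "r *\<^sub>R x = complex_of_real r *\<^sub>C x"
    and norm_scaleC: "norm (c *\<^sub>C x) = cmod c * norm x"

class complex_banach = complex_normed_vector + banach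

instantiation complex :: complex_banach
begin

definition scaleC_complex :: "complex \<Rightarrow> complex \<Rightarrow> complex"
  where "scaleC_complex c z = c * z"

instance
  by standard
    (simp_all add: scaleC_complex_def algebra_simps norm_mult scaleR_conv_of_real)

end

definition bounded_clinear ::
    "('a::complex_normed_vector \<Rightarrow> 'b::complex_normed_vector) \<Rightarrow> bool"
  where "bounded_clinear A \<longleftrightarrow> bounded_linear A \<and> (\<forall>c x. A (c *\<^sub>C x) = c *\<^sub>C A x)"

definition weakly_sums :: "(nat \<Rightarrow> 'a::complex_normed_vector) \<Rightarrow> 'a \<Rightarrow> bool"
  where "weakly_sums s y \<longleftrightarrow>
    (\<forall>\<phi> :: 'a \<Rightarrow> complex. bounded_clinear \<phi> \<longrightarrow> (\<lambda>n. \<phi> (s n)) sums \<phi> y)"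

definition weakly_summable :: "(nat \<Rightarrow> 'a::complex_normed_vector) \<Rightarrow> bool"
  where "weakly_summable s \<longleftrightarrow> (\<exists>y. weakly_sums s y)"


section \<open>Fractional sums and differences of sequences\<close>

definition cesaro_k :: "real \<Rightarrow> nat \<Rightarrow> real"
  where "cesaro_k \<alpha> n = pochhammer \<alpha> n / fact n"

text \<open>The sums over \<open>j \<ge> n\<close> are written with \<open>j = n + i\<close>. Each operator comes with the
  predicate stating that all of its defining series converge.\<close>

definition frac_sum_exists :: "real \<Rightarrow> (nat \<Rightarrow> complex) \<Rightarrow> bool"
  where "frac_sum_exists \<alpha> f \<longleftrightarrow>
    (\<forall>n. summable (\<lambda>i. complex_of_real (cesaro_k \<alpha> i) * f (n + i)))"

text \<open>The operator \<open>W\<^bsup>-\<alpha>\<^esup>\<close>.\<close>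

definition frac_sum :: "real \<Rightarrow> (nat \<Rightarrow> complex) \<Rightarrow> nat \<Rightarrow> complex"
  where "frac_sum \<alpha> f n = (\<Sum>i. complex_of_real (cesaro_k \<alpha> i) * f (n + i))"

text \<open>The operator \<open>D\<^bsup>\<alpha>\<^esup>\<close>.\<close>

definition frac_diff_exists :: "real \<Rightarrow> (nat \<Rightarrow> complex) \<Rightarrow> bool"
  where "frac_diff_exists \<alpha> f \<longleftrightarrow>
    (\<forall>n. summable (\<lambda>i. complex_of_real (cesaro_k (- \<alpha>) i) * f (n + i)))"

definition frac_diff :: "real \<Rightarrow> (nat \<Rightarrow> complex) \<Rightarrow> nat \<Rightarrow> complex"
  where "frac_diff \<alpha> f n = (\<Sum>i. complex_of_real (cesaro_k (- \<alpha>) i) * f (n + i))"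

text \<open>The Weyl difference \<open>W\<^bsup>\<alpha>\<^esup>\<close> for \<open>\<alpha> \<ge> 0\<close>.\<close>

definition weyl_step :: "(nat \<Rightarrow> complex) \<Rightarrow> nat \<Rightarrow> complex"
  where "weyl_step f n = f n - f (Suc n)"

definition weyl_diff_exists :: "real \<Rightarrow> (nat \<Rightarrow> complex) \<Rightarrow> bool"
  where "weyl_diff_exists \<alpha> f \<longleftrightarrow>
    \<alpha> \<in> \<nat> \<or> frac_sum_exists (real (nat \<lfloor>\<alpha>\<rfloor> + 1) - \<alpha>) f"

definition weyl_diff :: "real \<Rightarrow> (nat \<Rightarrow> complex) \<Rightarrow> nat \<Rightarrow> complex"
  where "weyl_diff \<alpha> f =
    (if \<alpha> \<in> \<nat> then (weyl_step ^^ nat \<lfloor>\<alpha>\<rfloor>) f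
     else (weyl_step ^^ (nat \<lfloor>\<alpha>\<rfloor> + 1)) (frac_sum (real (nat \<lfloor>\<alpha>\<rfloor> + 1) - \<alpha>) f))"


section \<open>Admissible functions and the algebras on the disc\<close>

text \<open>Functions on the unit disc are total functions of which only the values on
  \<open>ball 0 1\<close> matter.\<close>

abbreviation taylor_coeff :: "(complex \<Rightarrow> complex) \<Rightarrow> nat \<Rightarrow> complex"
  where "taylor_coeff F \<equiv> fps_nth (fps_expansion F 0)"

definition admissible :: "real \<Rightarrow> (complex \<Rightarrow> complex) \<Rightarrow> bool"
  where "admissible \<alpha> F \<longleftrightarrow>
    F holomorphic_on ball 0 1 \<and>
    (let f = taylor_coeff F in
      bounded (range f) \<and>
      (\<forall>\<beta>\<in>{0, \<alpha>}.
        frac_diff_exists \<beta> f \<and>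
        (\<forall>n. frac_diff \<beta> f n \<in> \<real>\<^sub>\<ge>\<^sub>0) \<and>
        frac_sum_exists \<beta> (frac_diff \<beta> f) \<and>
        frac_sum \<beta> (frac_diff \<beta> f) = f)) \<and>
    (\<forall>z\<in>ball 0 1. F z \<noteq> 0) \<and>
    (let g = taylor_coeff (\<lambda>z. 1 / F z) in
      \<forall>\<beta>\<in>{0, \<alpha>}.
        weyl_diff_exists \<beta> g \<and>
        weyl_diff \<beta> g 0 \<in> \<real>\<^sub>\<ge>\<^sub>0 \<and>
        (\<forall>n\<ge>1. weyl_diff \<beta> g n \<in> \<real>\<^sub>\<le>\<^sub>0))"

text \<open>\<open>weyl_rep \<alpha> h u\<close>: the sequence \<open>u\<close> satisfies \<open>h = W\<^bsup>-\<alpha>\<^esup>u\<close> and has finite weighted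
  \<open>\<ell>\<^sup>1\<close> norm.\<close>

definition weyl_rep :: "real \<Rightarrow> (nat \<Rightarrow> complex) \<Rightarrow> (nat \<Rightarrow> complex) \<Rightarrow> bool"
  where "weyl_rep \<alpha> h u \<longleftrightarrow>
    frac_sum_exists \<alpha> u \<and> h = frac_sum \<alpha> u \<and>
    summable (\<lambda>n. cmod (u n) * cesaro_k (\<alpha> + 1) n)"

definition disc_algebra :: "real \<Rightarrow> (complex \<Rightarrow> complex) set"
  where "disc_algebra \<alpha> =
    {H. H holomorphic_on ball 0 1 \<and>
        summable (\<lambda>n. cmod (taylor_coeff H n)) \<and>
        (\<exists>u. weyl_rep \<alpha> (taylor_coeff H) u)}"

definition weyl_coeff :: "real \<Rightarrow> (complex \<Rightarrow> complex) \<Rightarrow> nat \<Rightarrow> complex"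
  where "weyl_coeff \<alpha> H = (THE u. weyl_rep \<alpha> (taylor_coeff H) u)"


section \<open>Cesaro sums and the functional calculus\<close>

definition cesaro_sum :: "real \<Rightarrow> ('a::real_vector \<Rightarrow> 'a) \<Rightarrow> nat \<Rightarrow> 'a \<Rightarrow> 'a"
  where "cesaro_sum \<alpha> T n x = (\<Sum>j\<le>n. cesaro_k \<alpha> (n - j) *\<^sub>R (T ^^ j) x)"

definition cesaro_bounded :: "real \<Rightarrow> ('a::complex_normed_vector \<Rightarrow> 'a) \<Rightarrow> bool"
  where "cesaro_bounded \<alpha> T \<longleftrightarrow>
    bounded_clinear T \<and>
    bdd_above (range (\<lambda>n. onorm (cesaro_sum \<alpha> T n) / cesaro_k (\<alpha> + 1) n))"

text \<open>\<open>H(T)\<close> for \<open>H \<in> disc_algebra \<alpha>\<close>. The series converges absolutely in operator norm when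
  \<open>T\<close> is \<open>cesaro_bounded \<alpha>\<close>, so its sum may be taken pointwise.\<close>

definition fun_calc ::
    "real \<Rightarrow> ('a::complex_banach \<Rightarrow> 'a) \<Rightarrow> (complex \<Rightarrow> complex) \<Rightarrow> 'a \<Rightarrow> 'a"
  where "fun_calc \<alpha> T H x = (\<Sum>n. weyl_coeff \<alpha> H n *\<^sub>C cesaro_sum \<alpha> T n x)"

text \<open>The operator \<open>(I - T)\<^bsup>-1\<^esup>[(1 - z)F](T)\<close>, for injective \<open>I - T\<close>; its values are only
  meaningful on its domain.\<close>

definition reg_calc_dom ::
    "real \<Rightarrow> ('a::complex_banach \<Rightarrow> 'a) \<Rightarrow> (complex \<Rightarrow> complex) \<Rightarrow> 'a set"
  where "reg_calc_dom \<alpha> T F =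
    {x. fun_calc \<alpha> T (\<lambda>z. (1 - z) * F z) x \<in> range (\<lambda>y. y - T y)}"

definition reg_calc ::
    "real \<Rightarrow> ('a::complex_banach \<Rightarrow> 'a) \<Rightarrow> (complex \<Rightarrow> complex) \<Rightarrow> 'a \<Rightarrow> 'a"
  where "reg_calc \<alpha> T F x = inv (\<lambda>y. y - T y) (fun_calc \<alpha> T (\<lambda>z. (1 - z) * F z) x)"

end

theory Submission
  imports Defs
begin

text \<open>
  Let \<open>K = k\<^bsup>\<alpha>+1\<^esup>\<close>, \<open>u = D\<^bsup>\<alpha>\<^esup>f\<close> and \<open>v = W\<^bsup>\<alpha>\<^esup>g\<close>, where \<open>g\<close> are the coefficients of \<open>1/F\<close>. The products of the Cesaro sums \<open>\<Delta>\<^bsup>-\<alpha>\<^esup>T(i)\<close> are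
  combinations of Cesaro sums, which turns the sequences summable with weight \<open>K\<close> into a Banach
  algebra acting on \<open>X\<close>; it is semisimple, since the characters \<open>T = r\<close> with \<open>\<bar>r\<bar> < 1\<close> separate
  its elements. The sign conditions on \<open>g\<close> and \<open>v\<close> force \<open>1/F\<close> into this algebra.

  Let \<open>F\<^sub>N\<close> be given by the truncation of \<open>u\<close> at \<open>N\<close>, so that \<open>F\<^sub>N(T)x\<close> is the \<open>N\<close>-th partial sum of the
  series. The decay of \<open>u\<close> gives \<open>(1 - z)F\<^sub>N \<rightarrow> (1 - z)F\<close> in the algebra. Hence a weak limit \<open>y\<close> of the
  partial sums satisfies \<open>(I - T)y = [(1 - z)F](T)x\<close>. Conversely, if \<open>y\<close> satisfies this equation, then
  \<open>F\<^sub>N(T)x = (F\<^sub>N/F)(T)y\<close>. All coefficients of \<open>F\<^sub>N/F\<close> other than the zeroth are nonpositive, the zeroth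
  one is at most \<open>1\<close>, and the value at \<open>z = 1\<close> is nonnegative; so \<open>F\<^sub>N/F\<close> has norm at most \<open>2\<close>. As
  \<open>(F\<^sub>N/F)(T)\<close> tends to \<open>I\<close> on the dense range of \<open>I - T\<close>, it does so everywhere.
\<close>

section \<open>Bounded functionals separate points\<close>

text \<open>F itself has no element in the weighted algebra, since \<open>u\<close> need not be
  summable against the weight. This is why F enters only through (1 - z)F and 1/F, and why I - T has
  to be cancelled at the end by injectivity. Multiplicativity bounds the norm of F_N/F only by a
  multiple of the norm of F_N, which may grow with N; the uniform bound has to come from signs. In
  the product of the i-th Cesaro sum with 1/F the coefficients below i are nonnegative and those
  above i nonpositive. Hence for N \<ge> n the n-th coefficient of F_N/F increases with N to its
  limit, the n-th coefficient of 1; that this is the limit follows from the convergence of (1 -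
  z)F_N/F to 1 - z. The sign conditions make all sequences real, so the algebra is built over the
  reals. Its identities are read off from values on (-1,1), where the product is ordinary
  multiplication of functions, instead of from its double series. The scalar operators providing
  these values are instances of the same calculus as T.\<close>

definition sublinear :: "('a::real_vector \<Rightarrow> real) \<Rightarrow> bool"
  where "sublinear p \<longleftrightarrow>
    p 0 = 0 \<and> (\<forall>x y. p (x + y) \<le> p x + p y) \<and> (\<forall>c x. c > 0 \<longrightarrow> p (c *\<^sub>R x) \<le> c * p x)"

text \<open>Homogeneity is demanded only as an inequality, the form that passes to infima; scaling
  back by 1/c yields the reverse one.\<close>

lemma sublinear_scale:
  assumes "sublinear p" "c \<ge> 0"
  shows "p (c *\<^sub>R x) = c * p x"
proof (cases "c = 0")
  case True
  then show ?thesis using assms by (simp add: sublinear_def)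
next
  case False
  then have c: "c > 0" using assms by simp
  have "p ((1/c) *\<^sub>R (c *\<^sub>R x)) \<le> (1/c) * p (c *\<^sub>R x)"
    using assms c unfolding sublinear_def by (metis zero_less_divide_1_iff)
  then have "c * p x \<le> p (c *\<^sub>R x)"
    using c by (simp add: field_simps)
  then show ?thesis using assms c unfolding sublinear_def by (meson order_antisym)
qed

lemma sublinear_uminus: "sublinear p \<Longrightarrow> - p (- x) \<le> p x"
  unfolding sublinear_def by (metis add.right_inverse add_0 diff_0 diff_le_eq add.commute)

text \<open>The classical perturbation for Hahn-Banach through minimal elements. Taking t = 0 shows
  that it lies below p, and t = 1 at -y that its value there is at most - p y, so a functional which
  no shift lowers is odd.\<close>

definition sublinear_shift :: "('a::real_vector \<Rightarrow> real) \<Rightarrow> 'a \<Rightarrow> 'a \<Rightarrow> real"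
  where "sublinear_shift p y x = (INF t\<in>{0..}. p (x + t *\<^sub>R y) - t * p y)"

lemma sublinear_shift_bdd:
  assumes "sublinear p"
  shows "bdd_below ((\<lambda>t. p (x + t *\<^sub>R y) - t * p y) ` {0..})"
proof (rule bdd_belowI2)
  fix t :: real assume "t \<in> {0..}"
  then have "t * p y = p ((x + t *\<^sub>R y) + (- x))"
    using sublinear_scale[OF assms] by simp
  also have "\<dots> \<le> p (x + t *\<^sub>R y) + p (- x)"
    using assms unfolding sublinear_def by blast
  finally show "- p (- x) \<le> p (x + t *\<^sub>R y) - t * p y" by simp
qed

lemma sublinear_shift_le:
  assumes "sublinear p" "t \<ge> 0"
  shows "sublinear_shift p y x \<le> p (x + t *\<^sub>R y) - t * p y"
  unfolding sublinear_shift_def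
  by (rule cINF_lower[OF sublinear_shift_bdd]) (use assms in auto)

lemma sublinear_sublinear_shift:
  assumes p: "sublinear p"
  shows "sublinear (sublinear_shift p y)"
  unfolding sublinear_def
proof (intro conjI allI impI)
  show "sublinear_shift p y 0 = 0"
    unfolding sublinear_shift_def using sublinear_scale[OF p] by simp
next
  fix x z
  have "sublinear_shift p y (x + z) - (p (z + t *\<^sub>R y) - t * p y) \<le> p (x + s *\<^sub>R y) - s * p y"
    if "s \<ge> 0" "t \<ge> 0" for s t
  proof -
    have "p ((x + s *\<^sub>R y) + (z + t *\<^sub>R y)) \<le> p (x + s *\<^sub>R y) + p (z + t *\<^sub>R y)"
      using p unfolding sublinear_def by blast
    moreover have "(x + s *\<^sub>R y) + (z + t *\<^sub>R y) = (x + z) + (s + t) *\<^sub>R y"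
      by (simp add: algebra_simps)
    ultimately show ?thesis
      using sublinear_shift_le[OF p, of "s + t" y "x + z"] that by (simp add: algebra_simps)
  qed
  then have "sublinear_shift p y (x + z) - (p (z + t *\<^sub>R y) - t * p y) \<le> sublinear_shift p y x"
    if "t \<ge> 0" for t
    unfolding sublinear_shift_def[of p y x] by (intro cINF_greatest) (use that in auto)
  then have "sublinear_shift p y (x + z) - sublinear_shift p y x \<le> sublinear_shift p y z"
    unfolding sublinear_shift_def[of p y z] by (intro cINF_greatest) (auto simp: algebra_simps)
  then show "sublinear_shift p y (x + z) \<le> sublinear_shift p y x + sublinear_shift p y z"
    by simp
next
  fix c :: real and x assume c: "c > 0"
  have "sublinear_shift p y (c *\<^sub>R x) / c \<le> p (x + t *\<^sub>R y) - t * p y" if "t \<ge> 0" for t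
  proof -
    have "p (c *\<^sub>R x + (c * t) *\<^sub>R y) = c * p (x + t *\<^sub>R y)"
      using sublinear_scale[OF p, of c "x + t *\<^sub>R y"] c by (simp add: algebra_simps)
    then show ?thesis
      using sublinear_shift_le[OF p, of "c * t" y "c *\<^sub>R x"] c that by (simp add: field_simps)
  qed
  then have "sublinear_shift p y (c *\<^sub>R x) / c \<le> sublinear_shift p y x"
    unfolding sublinear_shift_def[of p y x] by (intro cINF_greatest) auto
  then show "sublinear_shift p y (c *\<^sub>R x) \<le> c * sublinear_shift p y x"
    using c by (simp add: field_simps)
qed

text \<open>Zorn's lemma for the reversed pointwise order. The infimum over a chain is finite
  because q x \<ge> - q (- x) \<ge> - p (- x), and subadditive because the smaller r of two members
  q, q' gives r (x + z) \<le> q x + q' z.\<close>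

lemma exists_minimal_sublinear:
  fixes p :: "'a::real_vector \<Rightarrow> real"
  assumes p: "sublinear p"
  shows "\<exists>m. sublinear m \<and> m \<le> p \<and> (\<forall>q. sublinear q \<and> q \<le> m \<longrightarrow> q = m)"
proof -
  define A where "A = {q. sublinear q \<and> q \<le> p}"
  have "\<exists>m\<in>A. \<forall>q\<in>A. m \<ge> q \<longrightarrow> q = m"
  proof (rule predicate_Zorn)
    show "partial_order_on A (relation_of (\<ge>) A)"
      by (rule partial_order_on_relation_ofI) auto
  next
    fix C assume C: "C \<in> Chains (relation_of (\<ge>) A)"
    then have CA: "C \<subseteq> A" by (auto simp: Chains_def relation_of_def)
    have cmp: "q \<le> q' \<or> q' \<le> q" if "q \<in> C" "q' \<in> C" for q q'
      using C that by (auto simp: Chains_def relation_of_def)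
    show "\<exists>u\<in>A. \<forall>a\<in>C. a \<ge> u"
    proof (cases "C = {}")
      case True
      then show ?thesis using p by (auto simp: A_def)
    next
      case False
      define u where "u = (\<lambda>x. INF q\<in>C. q x)"
      have bdd: "bdd_below ((\<lambda>q. q x) ` C)" for x
      proof (rule bdd_belowI2)
        fix q assume "q \<in> C"
        then have "sublinear q" "q (- x) \<le> p (- x)" using CA by (auto simp: A_def le_fun_def)
        then show "- p (- x) \<le> q x" using sublinear_uminus[of q x] by simp
      qed
      have le: "u x \<le> q x" if "q \<in> C" for q x
        unfolding u_def by (rule cINF_lower[OF bdd that])
      have sl: "sublinear q" if "q \<in> C" for q using CA that by (auto simp: A_def)
      have "sublinear u"
        unfolding sublinear_def
      proof (intro conjI allI impI)
        have "(INF q\<in>C. q 0) = (INF q\<in>C. (0::real))"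
          by (rule INF_cong) (use sl in \<open>auto simp: sublinear_def\<close>)
        then show "u 0 = 0" using False by (simp add: u_def)
      next
        fix x z
        have "u (x + z) - q' z \<le> q x" if qq: "q \<in> C" "q' \<in> C" for q q'
        proof -
          obtain r where r: "r \<in> C" "r \<le> q" "r \<le> q'" using cmp[OF qq] qq by auto
          have "u (x + z) \<le> r (x + z)" using r le by blast
          also have "\<dots> \<le> r x + r z" using sl[OF r(1)] by (simp add: sublinear_def)
          also have "\<dots> \<le> q x + q' z" using r by (intro add_mono) (auto simp: le_fun_def)
          finally show ?thesis by simp
        qed
        then have "u (x + z) - q' z \<le> u x" if "q' \<in> C" for q'
          unfolding u_def[THEN fun_cong, of x] by (intro cINF_greatest) (use False that in auto)
        then have "u (x + z) - u x \<le> u z"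
          unfolding u_def[THEN fun_cong, of z]
          by (intro cINF_greatest) (use False in \<open>auto simp: algebra_simps\<close>)
        then show "u (x + z) \<le> u x + u z" by simp
      next
        fix c :: real and x assume c: "c > 0"
        have "u (c *\<^sub>R x) / c \<le> q x" if "q \<in> C" for q
          using le[OF that, of "c *\<^sub>R x"] sublinear_scale[OF sl[OF that], of c x] c
          by (simp add: field_simps)
        then have "u (c *\<^sub>R x) / c \<le> u x"
          unfolding u_def[THEN fun_cong, of x] by (intro cINF_greatest) (use False in auto)
        then show "u (c *\<^sub>R x) \<le> c * u x" using c by (simp add: field_simps)
      qed
      moreover have "u \<le> p"
      proof -
        obtain q where q: "q \<in> C" using False by blast
        then have "q \<le> p" using CA by (auto simp: A_def)
        then show ?thesis using le[OF q] by (auto simp: le_fun_def intro: order_trans)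
      qed
      ultimately show ?thesis using le by (auto simp: A_def le_fun_def)
    qed
  qed
  then obtain m where m: "m \<in> A" "\<And>q. q \<in> A \<Longrightarrow> q \<le> m \<Longrightarrow> q = m" by blast
  have "q = m" if "sublinear q" "q \<le> m" for q
    using m that order_trans[of q m p] by (simp add: A_def)
  then show ?thesis using m(1) by (auto simp: A_def)
qed

text \<open>A minimal sublinear functional is linear, because shifting it along any vector does not
  decrease it. Shifting the norm along \<open>z\<close> first forces a negative value at \<open>-z\<close>.\<close>

lemma exists_bounded_linear_nonzero:
  fixes z :: "'a::real_normed_vector"
  assumes "z \<noteq> 0"
  shows "\<exists>m :: 'a \<Rightarrow> real. bounded_linear m \<and> m z \<noteq> 0"
proof -
  have n: "sublinear (norm :: 'a \<Rightarrow> real)"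
    by (auto simp: sublinear_def norm_triangle_ineq)
  obtain m where m: "sublinear m" "m \<le> sublinear_shift norm z"
    and min: "\<And>q. sublinear q \<Longrightarrow> q \<le> m \<Longrightarrow> q = m"
    using exists_minimal_sublinear[OF sublinear_sublinear_shift[OF n]] by blast
  have odd: "m (- y) = - m y" for y
  proof -
    have "sublinear_shift m y \<le> m"
      using sublinear_shift_le[OF m(1), of 0 y] by (simp add: le_fun_def)
    then have "sublinear_shift m y = m"
      by (intro min sublinear_sublinear_shift m)
    then have "m (- y) \<le> - m y"
      using sublinear_shift_le[OF m(1), of 1 y "- y"] m(1) by (simp add: sublinear_def)
    then show ?thesis using sublinear_uminus[OF m(1), of y] by simp
  qed
  have add: "m (x + y) = m x + m y" for x y
  proof -
    have "m (x + y) \<le> m x + m y" "m (- x + - y) \<le> m (- x) + m (- y)"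
      using m(1) unfolding sublinear_def by blast+
    moreover have "m (- x + - y) = - m (x + y)" using odd[of "x + y"] by simp
    ultimately show ?thesis by (simp add: odd)
  qed
  have scale: "m (c *\<^sub>R x) = c * m x" for c x
  proof (cases "c \<ge> 0")
    case True
    then show ?thesis by (rule sublinear_scale[OF m(1)])
  next
    case False
    then show ?thesis using sublinear_scale[OF m(1), of "- c" x] odd[of "c *\<^sub>R x"] by simp
  qed
  have le: "m x \<le> norm x" for x
  proof -
    have "m x \<le> sublinear_shift norm z x" using m(2) by (simp add: le_fun_def)
    then show ?thesis using sublinear_shift_le[OF n, of 0 z x] by simp
  qed
  have "bounded_linear m"
  proof (rule bounded_linear_intro[where K = 1])
    show "norm (m x) \<le> norm x * 1" for x
      using le[of x] le[of "- x"] by (simp add: odd abs_le_iff)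
  qed (auto simp: add scale)
  moreover have "m (- z) \<le> - norm z"
    using m(2) sublinear_shift_le[OF n, of 1 z "- z"] by (auto simp: le_fun_def intro: order_trans)
  then have "m z \<noteq> 0" using assms odd[of z] by (metis neg_le_iff_le norm_le_zero_iff)
  ultimately show ?thesis by blast
qed

lemma scaleC_linear: "bounded_linear (\<lambda>x::'a::complex_normed_vector. c *\<^sub>C x)"
proof (rule bounded_linear_intro[where K = "cmod c"])
  show "c *\<^sub>C (r *\<^sub>R x) = r *\<^sub>R c *\<^sub>C x" for r :: real and x :: 'a
    by (simp add: scaleR_scaleC scaleC_scaleC mult.commute)
qed (auto simp: scaleC_add_right norm_scaleC)

text \<open>If m is to be the real part, complex homogeneity forces the imaginary part to be - m (i
  x).\<close>

lemma exists_bounded_clinear_nonzero: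
  fixes z :: "'a::complex_normed_vector"
  assumes "z \<noteq> 0"
  shows "\<exists>\<phi> :: 'a \<Rightarrow> complex. bounded_clinear \<phi> \<and> \<phi> z \<noteq> 0"
proof -
  obtain m :: "'a \<Rightarrow> real" where m: "bounded_linear m" "m z \<noteq> 0"
    using exists_bounded_linear_nonzero[OF assms] by blast
  interpret m: bounded_linear m by (rule m)
  define \<phi> where "\<phi> x = Complex (m x) (- m (\<i> *\<^sub>C x))" for x
  have "\<phi> = (\<lambda>x. of_real (m x) - \<i> * of_real (m (\<i> *\<^sub>C x)))"
    by (auto simp: \<phi>_def complex_eq_iff)
  moreover have "bounded_linear (\<lambda>x. of_real (m x) - \<i> * of_real (m (\<i> *\<^sub>C x)) :: complex)"
    by (intro bounded_linear_sub bounded_linear_const_mult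
        bounded_linear_compose[OF bounded_linear_of_real] m(1)
        bounded_linear_compose[OF m(1)] scaleC_linear)
  moreover have "\<phi> (c *\<^sub>C x) = c *\<^sub>C \<phi> x" for c x
  proof -
    have split: "d *\<^sub>C x = Re d *\<^sub>R x + Im d *\<^sub>R (\<i> *\<^sub>C x)" for d
      by (simp add: scaleR_scaleC scaleC_scaleC scaleC_add_left[symmetric] mult.commute[of _ \<i>]
          complex_eq[symmetric])
    have "m (d *\<^sub>C x) = Re d * m x + Im d * m (\<i> *\<^sub>C x)" for d
      using split[of d] by (simp add: m.add m.scaleR)
    from this[of c] this[of "\<i> * c"] show ?thesis
      by (simp add: \<phi>_def scaleC_complex_def scaleC_scaleC complex_eq_iff algebra_simps)
  qed
  ultimately have "bounded_clinear \<phi>" by (simp add: bounded_clinear_def)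
  moreover have "\<phi> z \<noteq> 0" using m(2) by (simp add: \<phi>_def complex_eq_iff)
  ultimately show ?thesis by blast
qed

section \<open>The Cesaro kernel\<close>

lemma cesaro_k_0 [simp]: "cesaro_k a 0 = 1"
  by (simp add: cesaro_k_def)

lemma cesaro_k_Suc: "cesaro_k a (Suc n) = cesaro_k a n * ((a + real n) / (real n + 1))"
  by (simp add: cesaro_k_def pochhammer_rec' field_simps)

text \<open>The kernel consists of the coefficients of (1 - z)^(-a): differencing multiplies by 1 -
  z, summing divides by it, and convolution adds exponents.\<close>

lemma cesaro_k_diff: "cesaro_k a (Suc n) - cesaro_k a n = cesaro_k (a - 1) (Suc n)"
proof -
  have "cesaro_k (a - 1) (Suc n) = cesaro_k a n * ((a - 1) / (real n + 1))"
    by (simp add: cesaro_k_def pochhammer_rec mult.commute add.commute)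
  then show ?thesis
    by (simp add: cesaro_k_Suc field_simps)
qed

lemma sum_cesaro_k: "(\<Sum>i\<le>n. cesaro_k a i) = cesaro_k (a + 1) n"
proof (induction n)
  case (Suc n)
  then show ?case using cesaro_k_diff[of "a + 1" n] by simp
qed simp

text \<open>With k^a(n) = (-1)^n times the generalised binomial coefficient of -a over n, this is
  the Vandermonde identity.\<close>

lemma cesaro_k_convolution:
  "(\<Sum>i\<le>n. cesaro_k a i * cesaro_k b (n - i)) = cesaro_k (a + b) n"
proof -
  have g: "cesaro_k c m = (- 1) ^ m * ((- c) gchoose m)" for c m
    by (simp add: cesaro_k_def gbinomial_pochhammer mult.assoc[symmetric] power_mult_distrib[symmetric])
  have "(\<Sum>i\<le>n. cesaro_k a i * cesaro_k b (n - i)) =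
        (\<Sum>i\<le>n. (- 1) ^ n * (((- a) gchoose i) * ((- b) gchoose (n - i))))"
  proof (rule sum.cong)
    fix i assume "i \<in> {..n}"
    then have "(- 1 :: real) ^ n = (- 1) ^ i * (- 1) ^ (n - i)"
      by (simp add: power_add[symmetric])
    then show "cesaro_k a i * cesaro_k b (n - i) =
        (- 1) ^ n * (((- a) gchoose i) * ((- b) gchoose (n - i)))"
      by (simp add: g)
  qed simp
  also have "\<dots> = (- 1) ^ n * ((- a + - b) gchoose n)"
    unfolding sum_distrib_left[symmetric] gbinomial_Vandermonde[symmetric] atLeast0AtMost ..
  also have "\<dots> = cesaro_k (a + b) n"
    by (simp add: g)
  finally show ?thesis .
qed

lemma cesaro_k_zero: "cesaro_k 0 n = (if n = 0 then 1 else 0)"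
  by (cases n) (simp_all add: cesaro_k_def pochhammer_rec)

lemma cesaro_k_one [simp]: "cesaro_k 1 n = 1"
  by (simp add: cesaro_k_def pochhammer_fact[symmetric])

lemma cesaro_k_nonneg: "a \<ge> 0 \<Longrightarrow> cesaro_k a n \<ge> 0"
  by (induction n) (simp_all add: cesaro_k_Suc)

lemma cesaro_k_pos: "a > 0 \<Longrightarrow> cesaro_k a n > 0"
  by (simp add: cesaro_k_def pochhammer_pos)

lemma cesaro_k_mono_param: "0 \<le> a \<Longrightarrow> a \<le> b \<Longrightarrow> cesaro_k a n \<le> cesaro_k b n"
proof (induction n)
  case (Suc n)
  then show ?case
    unfolding cesaro_k_Suc
    by (intro mult_mono divide_right_mono) (auto intro: cesaro_k_nonneg)
qed simp

lemma cesaro_k_le_Suc_param: "0 \<le> a \<Longrightarrow> cesaro_k a n \<le> cesaro_k (a + 1) n"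
  by (rule cesaro_k_mono_param) auto

lemma cesaro_k_mono:
  assumes "a \<ge> 0" "m \<le> n"
  shows "cesaro_k (a + 1) m \<le> cesaro_k (a + 1) n"
  unfolding sum_cesaro_k[symmetric]
  by (rule sum_mono2) (use assms in \<open>auto intro: cesaro_k_nonneg\<close>)

lemma one_le_cesaro_k: "a \<ge> 0 \<Longrightarrow> 1 \<le> cesaro_k (a + 1) n"
  using cesaro_k_mono[of a 0 n] by simp

lemma cesaro_k_le_one: "0 \<le> a \<Longrightarrow> a \<le> 1 \<Longrightarrow> cesaro_k a n \<le> 1"
  using cesaro_k_mono_param[of a 1 n] by simp

lemma cesaro_k_neg_nonpos:
  assumes "0 \<le> a" "a \<le> 1" "n > 0"
  shows "cesaro_k (- a) n \<le> 0"
proof -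
  obtain m where n: "n = Suc m" using assms by (cases n) auto
  have "cesaro_k (- a) n = (- a) * pochhammer (1 - a) m / fact n"
    by (simp add: n cesaro_k_def pochhammer_rec)
  moreover have "pochhammer (1 - a) m \<ge> 0"
    using cesaro_k_nonneg[of "1 - a" m] assms
    by (simp add: cesaro_k_def zero_le_divide_iff) (metis fact_gt_zero not_le)
  ultimately show ?thesis using assms by (simp add: divide_nonpos_pos mult_nonneg_nonneg)
qed

lemma cesaro_k_Suc_le:
  assumes "a \<ge> 0"
  shows "cesaro_k (a + 1) (Suc n) \<le> (a + 1) * cesaro_k (a + 1) n"
proof -
  have "cesaro_k (a + 1) n * ((a + 1 + real n) / (real n + 1)) \<le> cesaro_k (a + 1) n * (a + 1)"
    using assms by (intro mult_left_mono cesaro_k_nonneg) (auto simp: field_simps)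
  then show ?thesis by (simp add: cesaro_k_Suc mult.commute)
qed

text \<open>Going from j to i + j takes i factors, each at most 1 + a/(j + 1), whose product is at
  most exp (i a/(j + 1)) \<le> exp a. This is the origin of exp \<alpha> in the norm of a
  product.\<close>

lemma cesaro_k_doubling:
  assumes a: "a \<ge> 0" and ij: "i \<le> j"
  shows "cesaro_k (a + 1) (i + j) \<le> exp a * cesaro_k (a + 1) j"
proof -
  define q where "q = 1 + a / (real j + 1)"
  have q: "q \<ge> 0" using a by (simp add: q_def)
  have "cesaro_k (a + 1) (i + j) \<le> q ^ i * cesaro_k (a + 1) j"
  proof (induction i)
    case (Suc i)
    have "(a + 1 + real (i + j)) / (real (i + j) + 1) \<le> q"
      using a by (simp add: q_def field_simps)
    then have "cesaro_k (a + 1) (Suc i + j) \<le> cesaro_k (a + 1) (i + j) * q"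
      unfolding add_Suc cesaro_k_Suc using a by (intro mult_left_mono cesaro_k_nonneg) auto
    also have "\<dots> \<le> (q ^ i * cesaro_k (a + 1) j) * q"
      using Suc q by (rule mult_right_mono)
    finally show ?case by (simp add: mult_ac)
  qed simp
  also have "q ^ i \<le> exp (a / (real j + 1)) ^ i"
    using q exp_ge_add_one_self[of "a / (real j + 1)"] by (intro power_mono) (auto simp: q_def)
  also have "\<dots> = exp (real i * (a / (real j + 1)))"
    by (rule exp_of_nat_mult[symmetric])
  also have "\<dots> \<le> exp a"
  proof -
    have "real i * a \<le> (real j + 1) * a" using a ij by (intro mult_right_mono) auto
    then show ?thesis by (simp add: field_simps)
  qed
  finally show ?thesis using a by (simp add: mult_right_mono cesaro_k_nonneg)
qed

text \<open>Converts the decay hypothesis, stated with powers of j, into decay against the weight.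
  The step needs 1 + a/(t + 1) \<le> ((t + 1)/t)^a, from ln ((t + 1)/t) \<ge> 1/(t + 1). Index 0 is
  left out because \<open>0 powr a\<close> is 0 while the kernel is 1 there.\<close>

lemma cesaro_k_le_powr:
  assumes "a > 0"
  shows "cesaro_k (a + 1) (Suc n) \<le> (a + 1) * real (Suc n) powr a"
proof (induction n)
  case 0
  then show ?case by (simp add: cesaro_k_Suc)
next
  case (Suc n)
  define t where "t = real (Suc n)"
  have t: "t > 0" by (simp add: t_def)
  have "1 + a / (t + 1) \<le> exp (a * (1 / (t + 1)))"
    using exp_ge_add_one_self[of "a / (t + 1)"] by simp
  also have "\<dots> \<le> exp (a * ln ((t + 1) / t))"
  proof -
    have "ln (t / (t + 1)) \<le> t / (t + 1) - 1"
      using t by (intro ln_le_minus_one) auto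
    also have "\<dots> = - (1 / (t + 1))" using t by (simp add: field_simps)
    finally have "1 / (t + 1) \<le> ln ((t + 1) / t)"
      using t by (simp add: ln_div)
    then show ?thesis using assms by (simp only: exp_le_cancel_iff mult_le_cancel_left_pos)
  qed
  also have "\<dots> = ((t + 1) / t) powr a"
    using t by (simp add: powr_def)
  finally have q: "1 + a / (t + 1) \<le> ((t + 1) / t) powr a" .
  have "cesaro_k (a + 1) (Suc (Suc n)) = cesaro_k (a + 1) (Suc n) * (1 + a / (t + 1))"
    using t unfolding cesaro_k_Suc[of _ "Suc n"] t_def by (simp add: field_simps)
  also have "\<dots> \<le> ((a + 1) * t powr a) * ((t + 1) / t) powr a"
    using Suc q assms t by (intro mult_mono) (auto simp: t_def)
  also have "\<dots> = (a + 1) * (t + 1) powr a"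
    using t by (simp add: powr_mult[symmetric])
  finally show ?case by (simp add: t_def add.commute)
qed

text \<open>Once n \<ge> \<bar>a\<bar>, the factor (a + n)/(n + 1) lies in [0,1], so the absolute
  values no longer increase.\<close>

lemma cesaro_k_bounded:
  assumes "a \<le> 1"
  obtains C where "\<And>n. \<bar>cesaro_k a n\<bar> \<le> C"
proof -
  obtain m :: nat where m: "real m \<ge> \<bar>a\<bar>" using real_arch_simple by blast
  have "\<bar>cesaro_k a (m + n)\<bar> \<le> \<bar>cesaro_k a m\<bar>" for n
  proof (induction n)
    case (Suc n)
    have "\<bar>a + real (m + n)\<bar> / (real (m + n) + 1) \<le> 1"
      using m assms by (simp add: field_simps)
    then have "\<bar>cesaro_k a (m + Suc n)\<bar> \<le> \<bar>cesaro_k a (m + n)\<bar> * 1"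
      unfolding add_Suc_right cesaro_k_Suc abs_mult by (intro mult_left_mono) auto
    then show ?case using Suc by simp
  qed simp
  then have *: "\<bar>cesaro_k a n\<bar> \<le> \<bar>cesaro_k a m\<bar>" if "n \<ge> m" for n
    using that by (metis le_add_diff_inverse)
  have "\<bar>cesaro_k a n\<bar> \<le> (\<Sum>i\<le>m. \<bar>cesaro_k a i\<bar>)" for n
  proof -
    have "\<bar>cesaro_k a i\<bar> \<le> (\<Sum>i\<le>m. \<bar>cesaro_k a i\<bar>)" if "i \<le> m" for i
      using that by (intro member_le_sum) auto
    then show ?thesis using *[of n] by (cases "n \<le> m") (auto intro: order_trans)
  qed
  then show thesis by (rule that)
qed

text \<open>From an index m \<ge> a on the factors (n - a)/(n + 1) are nonnegative, so the kernel
  keeps its sign s. The absolute sums of the tail are therefore differences of partial sums, up to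
  sign, and partial sums are values of the bounded kernel k^(1-a).\<close>

lemma summable_cesaro_k_neg:
  assumes "a > 0"
  shows "summable (\<lambda>n. \<bar>cesaro_k (- a) n\<bar>)"
proof -
  obtain C where C: "\<And>n. \<bar>cesaro_k (1 - a) n\<bar> \<le> C"
    using cesaro_k_bounded[of "1 - a"] assms by auto
  obtain m :: nat where m: "real m \<ge> a" using real_arch_simple by blast
  define s where "s = sgn (cesaro_k (- a) m)"
  have sg: "s * cesaro_k (- a) (m + n) = \<bar>cesaro_k (- a) (m + n)\<bar>" for n
  proof (induction n)
    case 0
    then show ?case by (simp add: s_def sgn_mult_self_eq mult.commute linordered_idom_class.abs_sgn)
  next
    case (Suc n)
    have "s * cesaro_k (- a) (m + Suc n) =
        s * cesaro_k (- a) (m + n) * ((- a + real (m + n)) / (real (m + n) + 1))"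
      by (simp only: add_Suc_right cesaro_k_Suc mult_ac)
    also have "\<dots> = \<bar>cesaro_k (- a) (m + n) * ((- a + real (m + n)) / (real (m + n) + 1))\<bar>"
      using m unfolding Suc abs_mult by (subst (2) abs_of_nonneg) auto
    finally show ?case by (simp only: add_Suc_right cesaro_k_Suc)
  qed
  have "summable (\<lambda>n. \<bar>cesaro_k (- a) (n + m)\<bar>)"
  proof (rule summableI_nonneg_bounded)
    fix n
    have "(\<Sum>i<n. \<bar>cesaro_k (- a) (i + m)\<bar>) = s * (\<Sum>i<n. cesaro_k (- a) (i + m))"
      unfolding sum_distrib_left by (rule sum.cong) (use sg in \<open>auto simp: add.commute\<close>)
    also have "\<dots> = s * ((\<Sum>i<n + m. cesaro_k (- a) i) - (\<Sum>i<m. cesaro_k (- a) i))"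
      by (induction n) (auto simp: algebra_simps)
    also have "\<dots> \<le> \<bar>\<dots>\<bar>" by simp
    also have "\<dots> \<le> 1 * (C + (\<Sum>i<m. \<bar>cesaro_k (- a) i\<bar>))"
      unfolding abs_mult
    proof (rule mult_mono)
      \<comment> \<open>The sum below n + m is the sum up to n + m - 1; for n + m = 0 it is empty,
        and the bound at index 0 provides 0 \<le> C.\<close>
      have "\<bar>\<Sum>i<n + m. cesaro_k (- a) i\<bar> \<le> C"
        using C[of "n + m - 1"] sum_cesaro_k[of "- a" "n + m - 1"] C[of 0]
        by (cases "n + m") (auto simp: lessThan_Suc_atMost)
      then show "\<bar>(\<Sum>i<n + m. cesaro_k (- a) i) - (\<Sum>i<m. cesaro_k (- a) i)\<bar>
          \<le> C + (\<Sum>i<m. \<bar>cesaro_k (- a) i\<bar>)"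
        using sum_abs[of "cesaro_k (- a)" "{..<m}"] by linarith
    qed (auto simp: s_def sgn_if)
    finally show "(\<Sum>i<n. \<bar>cesaro_k (- a) (i + m)\<bar>) \<le> 1 * (C + (\<Sum>i<m. \<bar>cesaro_k (- a) i\<bar>))" .
  qed simp
  then show ?thesis using summable_iff_shift by blast
qed

section \<open>Rearrangement of double series\<close>

lemma infsum_eq_suminf:
  fixes f :: "nat \<Rightarrow> 'a::banach"
  assumes "summable (\<lambda>n. norm (f n))"
  shows "infsum f UNIV = suminf f"
  using norm_summable_imp_has_sum[OF assms] summable_norm_cancel[OF assms]
  by (auto intro: infsumI simp: summable_sums)

lemma double_series_abs_summable:
  fixes F :: "nat \<Rightarrow> nat \<Rightarrow> 'a::banach"
  assumes "\<And>i. summable (\<lambda>j. norm (F i j))" "summable (\<lambda>i. \<Sum>j. norm (F i j))"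
  shows "(\<lambda>x. norm (case x of (i, j) \<Rightarrow> F i j)) summable_on UNIV \<times> UNIV"
  unfolding Infinite_Sum.abs_summable_on_Sigma_iff
proof (intro conjI ballI)
  show "(\<lambda>y. norm (case (i, y) of (i, j) \<Rightarrow> F i j)) summable_on UNIV" for i
    using assms(1)[of i] by (simp add: summable_on_UNIV_nonneg_real_iff)
  have "(\<Sum>\<^sub>\<infinity>j. norm (F i j)) = (\<Sum>j. norm (F i j))" for i
    using assms(1)[of i] by (intro infsum_eq_suminf) simp
  then show "(\<lambda>i. norm (\<Sum>\<^sub>\<infinity>j. norm (case (i, j) of (i, j) \<Rightarrow> F i j))) summable_on UNIV"
    using assms by (simp add: summable_on_UNIV_nonneg_real_iff suminf_nonneg)
qed

text \<open>Absolute convergence makes the family summable over the set of all pairs; rows, columns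
  and antidiagonals are then three groupings of one sum.\<close>

lemma
  fixes F :: "nat \<Rightarrow> nat \<Rightarrow> 'a::banach"
  assumes s1: "\<And>i. summable (\<lambda>j. norm (F i j))" and s2: "summable (\<lambda>i. \<Sum>j. norm (F i j))"
  shows double_series_swap_summable1: "\<And>j. summable (\<lambda>i. norm (F i j))"
    and double_series_swap_summable2: "summable (\<lambda>j. \<Sum>i. norm (F i j))"
    and double_series_swap: "(\<Sum>j. \<Sum>i. F i j) = (\<Sum>i. \<Sum>j. F i j)"
    and double_series_diagonal: "(\<lambda>p. \<Sum>i\<le>p. F i (p - i)) sums (\<Sum>i. \<Sum>j. F i j)"
proof -
  have abs: "(\<lambda>x. norm (case x of (i, j) \<Rightarrow> F i j)) summable_on UNIV \<times> UNIV"
    using assms by (rule double_series_abs_summable)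
  have "(\<lambda>(j, i). norm (F i j)) summable_on UNIV \<times> UNIV"
    using abs by (subst (asm) summable_on_swap) (simp add: case_prod_unfold)
  then have abs': "(\<lambda>x. norm (case x of (j, i) \<Rightarrow> F i j)) summable_on UNIV \<times> UNIV"
    by (simp add: case_prod_unfold)
  have c1: "summable (\<lambda>i. norm (F i j))" for j
    using abs' unfolding Infinite_Sum.abs_summable_on_Sigma_iff by (simp add: summable_on_UNIV_nonneg_real_iff)
  then show "\<And>j. summable (\<lambda>i. norm (F i j))" .
  have "(\<Sum>\<^sub>\<infinity>i. norm (F i j)) = (\<Sum>i. norm (F i j))" for j
    using c1[of j] by (intro infsum_eq_suminf) simp
  then show c2: "summable (\<lambda>j. \<Sum>i. norm (F i j))"
    using abs' unfolding Infinite_Sum.abs_summable_on_Sigma_iff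
    by (simp add: summable_on_UNIV_nonneg_real_iff suminf_nonneg c1)
  have n1: "summable (\<lambda>i. norm (\<Sum>j. F i j))"
    by (rule summable_comparison_test'[OF s2, of 0]) (use s1 in \<open>simp add: summable_norm\<close>)
  have n2: "summable (\<lambda>j. norm (\<Sum>i. F i j))"
    by (rule summable_comparison_test'[OF c2, of 0]) (use c1 in \<open>simp add: summable_norm\<close>)
  have i1: "(\<Sum>\<^sub>\<infinity>i. \<Sum>\<^sub>\<infinity>j. F i j) = (\<Sum>i. \<Sum>j. F i j)"
    using s1 n1 by (simp add: infsum_eq_suminf)
  have i2: "(\<Sum>\<^sub>\<infinity>j. \<Sum>\<^sub>\<infinity>i. F i j) = (\<Sum>j. \<Sum>i. F i j)"
    using c1 n2 by (simp add: infsum_eq_suminf)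
  have sm: "(\<lambda>(i, j). F i j) summable_on UNIV \<times> UNIV"
    using abs by (rule abs_summable_summable)
  show "(\<Sum>j. \<Sum>i. F i j) = (\<Sum>i. \<Sum>j. F i j)"
    using infsum_swap_banach[OF sm] i1 i2 by simp
  have tot: "((\<lambda>(i, j). F i j) has_sum (\<Sum>i. \<Sum>j. F i j)) (UNIV \<times> UNIV)"
    using infsum_Sigma'_banach[OF sm] i1 sm by (metis has_sum_infsum)
  have bij: "bij_betw (\<lambda>(p, i). (i, p - i)) (SIGMA p:UNIV. {..p}) (UNIV \<times> (UNIV :: nat set))"
    by (rule bij_betwI[where g = "\<lambda>(i, j). (i + j, i)"]) auto
  have "((\<lambda>(p, i). F i (p - i)) has_sum (\<Sum>i. \<Sum>j. F i j)) (SIGMA p:UNIV. {..p})"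
    using has_sum_reindex_bij_betw[OF bij, of "\<lambda>(i, j). F i j"] tot
    by (simp add: case_prod_unfold)
  then have "((\<lambda>p. \<Sum>i\<le>p. F i (p - i)) has_sum (\<Sum>i. \<Sum>j. F i j)) UNIV"
    by (rule has_sum_SigmaD) (simp add: has_sum_finite)
  then show "(\<lambda>p. \<Sum>i\<le>p. F i (p - i)) sums (\<Sum>i. \<Sum>j. F i j)"
    by (rule has_sum_imp_sums)
qed

section \<open>The weighted sequence algebra and its functional calculus\<close>

text \<open>The weight is the growth allowed to the Cesaro sums of a (C,\<alpha>)-bounded operator,
  so these are the coefficient sequences whose series of Cesaro sums converge absolutely.\<close>

definition weighted_l1 :: "real \<Rightarrow> (nat \<Rightarrow> real) \<Rightarrow> bool"
  where "weighted_l1 \<alpha> a \<longleftrightarrow> summable (\<lambda>n. \<bar>a n\<bar> * cesaro_k (\<alpha> + 1) n)"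

definition weighted_norm :: "real \<Rightarrow> (nat \<Rightarrow> real) \<Rightarrow> real"
  where "weighted_norm \<alpha> a = (\<Sum>n. \<bar>a n\<bar> * cesaro_k (\<alpha> + 1) n)"

lemma weighted_norm_nonneg: "\<alpha> > 0 \<Longrightarrow> weighted_l1 \<alpha> a \<Longrightarrow> weighted_norm \<alpha> a \<ge> 0"
  unfolding weighted_norm_def weighted_l1_def
  by (intro suminf_nonneg) (simp_all add: cesaro_k_nonneg)

lemma weighted_l1_diff:
  assumes "\<alpha> > 0" "weighted_l1 \<alpha> a" "weighted_l1 \<alpha> b"
  shows "weighted_l1 \<alpha> (\<lambda>n. a n - b n)"
  unfolding weighted_l1_def
proof (rule summable_comparison_test')
  show "summable (\<lambda>n. \<bar>a n\<bar> * cesaro_k (\<alpha> + 1) n + \<bar>b n\<bar> * cesaro_k (\<alpha> + 1) n)"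
    using assms(2,3) unfolding weighted_l1_def by (rule summable_add)
  show "norm (\<bar>a n - b n\<bar> * cesaro_k (\<alpha> + 1) n)
      \<le> \<bar>a n\<bar> * cesaro_k (\<alpha> + 1) n + \<bar>b n\<bar> * cesaro_k (\<alpha> + 1) n" for n
    using assms(1) mult_right_mono[OF abs_triangle_ineq4[of "a n" "b n"], of "cesaro_k (\<alpha> + 1) n"]
    by (simp add: abs_mult cesaro_k_nonneg distrib_right)
qed

lemma weighted_l1_finite:
  assumes "\<And>n. n > N \<Longrightarrow> a n = 0"
  shows "weighted_l1 \<alpha> a"
  unfolding weighted_l1_def
  by (rule summable_finite[of "{..N}"]) (use assms in \<open>auto simp: not_le\<close>)

lemma weighted_norm_finite:
  assumes "\<And>n. n > N \<Longrightarrow> a n = 0"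
  shows "weighted_norm \<alpha> a = (\<Sum>n\<le>N. \<bar>a n\<bar> * cesaro_k (\<alpha> + 1) n)"
  unfolding weighted_norm_def
  by (rule suminf_finite) (use assms in \<open>auto simp: not_le\<close>)

lemma weighted_l1_summable:
  fixes D :: "nat \<Rightarrow> 'a::banach"
  assumes "weighted_l1 \<alpha> a" "\<And>n. norm (D n) \<le> K * cesaro_k (\<alpha> + 1) n"
  shows "summable (\<lambda>n. norm (a n *\<^sub>R D n))"
    and "norm (\<Sum>n. a n *\<^sub>R D n) \<le> K * weighted_norm \<alpha> a"
proof -
  have s: "summable (\<lambda>n. K * (\<bar>a n\<bar> * cesaro_k (\<alpha> + 1) n))"
    using assms(1) unfolding weighted_l1_def by (rule summable_mult)
  have le: "norm (a n *\<^sub>R D n) \<le> K * (\<bar>a n\<bar> * cesaro_k (\<alpha> + 1) n)" for n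
    using mult_left_mono[OF assms(2)[of n], of "\<bar>a n\<bar>"] by (simp add: mult_ac)
  show sn: "summable (\<lambda>n. norm (a n *\<^sub>R D n))"
    by (rule summable_comparison_test'[OF s, of 0]) (use le in simp)
  have "norm (\<Sum>n. a n *\<^sub>R D n) \<le> (\<Sum>n. norm (a n *\<^sub>R D n))"
    by (rule summable_norm[OF sn])
  also have "\<dots> \<le> (\<Sum>n. K * (\<bar>a n\<bar> * cesaro_k (\<alpha> + 1) n))"
    by (rule suminf_le[OF le sn s])
  also have "\<dots> = K * weighted_norm \<alpha> a"
    using assms(1) unfolding weighted_norm_def weighted_l1_def by (rule suminf_mult)
  finally show "norm (\<Sum>n. a n *\<^sub>R D n) \<le> K * weighted_norm \<alpha> a" .
qed

lemma weighted_l1_imp_summable_abs: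
  assumes "\<alpha> > 0" "weighted_l1 \<alpha> a"
  shows "summable (\<lambda>n. \<bar>a n\<bar>)" "(\<Sum>n. \<bar>a n\<bar>) \<le> weighted_norm \<alpha> a"
proof -
  have le: "\<bar>a n\<bar> \<le> \<bar>a n\<bar> * cesaro_k (\<alpha> + 1) n" for n
    using mult_left_mono[OF one_le_cesaro_k[of \<alpha> n], of "\<bar>a n\<bar>"] assms(1) by simp
  show s: "summable (\<lambda>n. \<bar>a n\<bar>)"
    by (rule summable_comparison_test'[OF assms(2)[unfolded weighted_l1_def], of 0]) (use le in simp)
  show "(\<Sum>n. \<bar>a n\<bar>) \<le> weighted_norm \<alpha> a"
    unfolding weighted_norm_def by (rule suminf_le[OF le s assms(2)[unfolded weighted_l1_def]])
qed

text \<open>A series that converges absolutely in the weighted space may be summed coefficientwise.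
  The product is built by using this twice: over j with \<open>prod_coeff \<alpha> i j\<close>, and
  over i with the resulting rows.\<close>

lemma
  assumes \<alpha>: "\<alpha> > 0" and M: "\<And>j. weighted_l1 \<alpha> (M j)"
    and s: "summable (\<lambda>j. \<bar>b j\<bar> * weighted_norm \<alpha> (M j))"
  shows superposition_summable: "summable (\<lambda>j. \<bar>b j * M j n\<bar>)"
    and superposition_weighted_l1: "weighted_l1 \<alpha> (\<lambda>n. \<Sum>j. b j * M j n)"
    and superposition_norm_le:
      "weighted_norm \<alpha> (\<lambda>n. \<Sum>j. b j * M j n) \<le> (\<Sum>j. \<bar>b j\<bar> * weighted_norm \<alpha> (M j))"
proof -
  \<comment> \<open>With the weight inside the double series, interchanging the sums gives the norm
    bound directly.\<close>
  let ?F = "\<lambda>j n. b j * M j n * cesaro_k (\<alpha> + 1) n"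
  have nn: "norm (?F j n) = \<bar>b j\<bar> * (\<bar>M j n\<bar> * cesaro_k (\<alpha> + 1) n)" for j n
    using \<alpha> by (simp add: abs_mult cesaro_k_nonneg)
  have s1: "summable (\<lambda>n. norm (?F j n))" for j
    unfolding nn using M[of j] unfolding weighted_l1_def by (rule summable_mult)
  have sn: "(\<Sum>n. norm (?F j n)) = \<bar>b j\<bar> * weighted_norm \<alpha> (M j)" for j
    unfolding nn weighted_norm_def using M[of j] unfolding weighted_l1_def by (rule suminf_mult)
  have s2: "summable (\<lambda>j. \<Sum>n. norm (?F j n))"
    unfolding sn by (rule s)
  have c1: "summable (\<lambda>j. norm (?F j n))" for n
    using double_series_swap_summable1[OF s1 s2] .
  have pos: "cesaro_k (\<alpha> + 1) n > 0" for n using \<alpha> by (simp add: cesaro_k_pos)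
  show c0: "summable (\<lambda>j. \<bar>b j * M j n\<bar>)" for n
    using summable_mult2[OF c1[of n], of "1 / cesaro_k (\<alpha> + 1) n"] pos[of n]
    by (simp add: abs_mult)
  have c2: "summable (\<lambda>n. \<Sum>j. norm (?F j n))"
    by (rule double_series_swap_summable2[OF s1 s2])
  have le: "\<bar>\<Sum>j. b j * M j n\<bar> * cesaro_k (\<alpha> + 1) n \<le> (\<Sum>j. norm (?F j n))" for n
  proof -
    have "\<bar>\<Sum>j. b j * M j n\<bar> * cesaro_k (\<alpha> + 1) n \<le> (\<Sum>j. \<bar>b j * M j n\<bar>) * cesaro_k (\<alpha> + 1) n"
      using summable_rabs[OF c0[of n]] pos[of n] by (intro mult_right_mono) auto
    also have "\<dots> = (\<Sum>j. norm (?F j n))"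
      using pos[of n] by (subst suminf_mult2[OF c0]) (simp add: abs_mult)
    finally show ?thesis .
  qed
  show w: "weighted_l1 \<alpha> (\<lambda>n. \<Sum>j. b j * M j n)"
    unfolding weighted_l1_def
    by (rule summable_comparison_test'[OF c2, of 0])
      (use le less_imp_le[OF pos] in \<open>simp add: abs_mult\<close>)
  have "weighted_norm \<alpha> (\<lambda>n. \<Sum>j. b j * M j n) \<le> (\<Sum>n. \<Sum>j. norm (?F j n))"
    unfolding weighted_norm_def using le w c2 unfolding weighted_l1_def by (intro suminf_le) auto
  also have "\<dots> = (\<Sum>j. \<Sum>n. norm (?F j n))"
    using double_series_swap[of "\<lambda>j n. norm (?F j n)"] s1 s2 by simp
  finally show "weighted_norm \<alpha> (\<lambda>n. \<Sum>j. b j * M j n) \<le> (\<Sum>j. \<bar>b j\<bar> * weighted_norm \<alpha> (M j))"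
    by (simp only: sn)
qed

text \<open>Pairing with D is continuous on the weighted space and so commutes with superposition;
  this is what makes the calculus multiplicative.\<close>

lemma superposition_sums:
  fixes D :: "nat \<Rightarrow> 'a::banach"
  assumes \<alpha>: "\<alpha> > 0" and M: "\<And>j. weighted_l1 \<alpha> (M j)"
    and s: "summable (\<lambda>j. \<bar>b j\<bar> * weighted_norm \<alpha> (M j))"
    and D: "\<And>n. norm (D n) \<le> K * cesaro_k (\<alpha> + 1) n"
  shows "(\<lambda>j. b j *\<^sub>R (\<Sum>n. M j n *\<^sub>R D n)) sums (\<Sum>n. (\<Sum>j. b j * M j n) *\<^sub>R D n)"
proof -
  let ?G = "\<lambda>j n. (b j * M j n) *\<^sub>R D n"
  have ns: "summable (\<lambda>n. norm (M j n *\<^sub>R D n))" for j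
    by (rule weighted_l1_summable(1)[OF M D])
  have eq: "norm (?G j n) = \<bar>b j\<bar> * norm (M j n *\<^sub>R D n)" for j n
    by (simp add: abs_mult)
  have s1: "summable (\<lambda>n. norm (?G j n))" for j
    unfolding eq by (rule summable_mult[OF ns])
  have sn: "(\<Sum>n. norm (?G j n)) = \<bar>b j\<bar> * (\<Sum>n. norm (M j n *\<^sub>R D n))" for j
    unfolding eq by (rule suminf_mult[OF ns])
  have le: "(\<Sum>n. norm (M j n *\<^sub>R D n)) \<le> K * weighted_norm \<alpha> (M j)" for j
  proof -
    have "(\<Sum>n. norm (M j n *\<^sub>R D n)) \<le> (\<Sum>n. K * (\<bar>M j n\<bar> * cesaro_k (\<alpha> + 1) n))"
    proof (rule suminf_le[OF _ ns])
      show "norm (M j n *\<^sub>R D n) \<le> K * (\<bar>M j n\<bar> * cesaro_k (\<alpha> + 1) n)" for n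
        using mult_left_mono[OF D[of n], of "\<bar>M j n\<bar>"] by (simp add: mult_ac)
      show "summable (\<lambda>n. K * (\<bar>M j n\<bar> * cesaro_k (\<alpha> + 1) n))"
        using M[of j] unfolding weighted_l1_def by (rule summable_mult)
    qed
    also have "\<dots> = K * weighted_norm \<alpha> (M j)"
      using M[of j] unfolding weighted_norm_def weighted_l1_def by (rule suminf_mult)
    finally show ?thesis .
  qed
  have s2: "summable (\<lambda>j. \<Sum>n. norm (?G j n))"
  proof (rule summable_comparison_test')
    show "summable (\<lambda>j. K * (\<bar>b j\<bar> * weighted_norm \<alpha> (M j)))" by (rule summable_mult[OF s])
    show "norm (\<Sum>n. norm (?G j n)) \<le> K * (\<bar>b j\<bar> * weighted_norm \<alpha> (M j))" for j
      using mult_left_mono[OF le[of j], of "\<bar>b j\<bar>"] suminf_nonneg[OF s1[of j]]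
      unfolding sn by (simp add: mult_ac)
  qed
  have in1: "(\<Sum>n. ?G j n) = b j *\<^sub>R (\<Sum>n. M j n *\<^sub>R D n)" for j
    using suminf_scaleR_right[OF summable_norm_cancel[OF ns[of j]], of "b j"] by simp
  have in2: "(\<Sum>j. ?G j n) = (\<Sum>j. b j * M j n) *\<^sub>R D n" for n
  proof -
    have "summable (\<lambda>j. b j * M j n)"
      by (rule summable_rabs_cancel[OF superposition_summable[OF \<alpha> M s]])
    then show ?thesis by (simp add: suminf_scaleR_left)
  qed
  have "summable (\<lambda>j. norm (\<Sum>n. ?G j n))"
    by (rule summable_comparison_test'[OF s2, of 0]) (use summable_norm[OF s1] in simp)
  then have "(\<lambda>j. \<Sum>n. ?G j n) sums (\<Sum>j. \<Sum>n. ?G j n)"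
    by (rule summable_sums[OF summable_norm_cancel])
  then show ?thesis
    using double_series_swap[OF s1 s2] by (simp only: in1 in2)
qed

section \<open>Cesaro sums of a linear map and their products\<close>

lemma cesaro_sum_0 [simp]: "cesaro_sum \<alpha> T 0 x = x"
  by (simp add: cesaro_sum_def)

context
  fixes T :: "'a::real_vector \<Rightarrow> 'a"
  assumes T: "linear T"
begin

interpretation T: linear T by (rule T)

lemma linear_funpow: "linear (T ^^ n)"
proof (induction n)
  case 0
  show ?case by (simp add: linear_id[unfolded id_def] id_def)
next
  case (Suc n)
  then show ?case using linear_compose[OF _ T] by (simp add: comp_def)
qed

lemma linear_cesaro_sum: "linear (cesaro_sum \<alpha> T n)"
  unfolding cesaro_sum_def[abs_def]
  by (intro linear_compose_sum ballI linear_compose_scale_right linear_funpow)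

lemma cesaro_sum_Suc: "cesaro_sum \<alpha> T (Suc n) x = cesaro_k \<alpha> (Suc n) *\<^sub>R x + T (cesaro_sum \<alpha> T n x)"
  unfolding cesaro_sum_def
  by (simp add: sum.atMost_Suc_shift T.sum T.scale del: sum.atMost_Suc)

lemma cesaro_sum_commute: "cesaro_sum \<alpha> T n (T x) = T (cesaro_sum \<alpha> T n x)"
  unfolding cesaro_sum_def by (simp add: T.sum T.scale funpow_swap1)

end

text \<open>With \<open>k(s) = (1 - s)\<^bsup>-\<alpha>\<^esup>\<close> and \<open>D(s) = k(s) / (1 - sz)\<close>, the generating function of the Cesaro
  sums, partial fractions give \<open>D(s) D(t) = (s k(t) D(s) - t k(s) D(t)) / (s - t)\<close>. Expanding the right
  hand side yields these coefficients.\<close>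

definition prod_coeff :: "real \<Rightarrow> nat \<Rightarrow> nat \<Rightarrow> nat \<Rightarrow> real"
  where "prod_coeff \<alpha> i j n =
    (if n \<le> i + j then cesaro_k \<alpha> (i + j - n) * (1 - of_bool (n < i) - of_bool (n < j)) else 0)"

lemma prod_coeff_commute: "prod_coeff \<alpha> i j n = prod_coeff \<alpha> j i n"
  by (simp add: prod_coeff_def add.commute)

lemma prod_coeff_0: "prod_coeff \<alpha> i 0 n = of_bool (n = i)"
  by (auto simp: prod_coeff_def)

text \<open>Induction on j moves one unit from j to i. Writing D_i for the Cesaro sums, D_i D_(j+1)
  = k(j+1) D_i + T D_i D_j and T D_i = D_(i+1) - k(i+1), so the coefficients for (i, j+1) and (i+1,
  j) differ only at n = i and n = j.\<close>

lemma cesaro_sum_mult: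
  fixes T :: "'a::real_vector \<Rightarrow> 'a"
  assumes T: "linear T"
  shows "cesaro_sum \<alpha> T i (cesaro_sum \<alpha> T j x) =
    (\<Sum>n\<le>i + j. prod_coeff \<alpha> i j n *\<^sub>R cesaro_sum \<alpha> T n x)"
proof (induction j arbitrary: i)
  case 0
  have "(\<Sum>n\<le>i. prod_coeff \<alpha> i 0 n *\<^sub>R cesaro_sum \<alpha> T n x) =
      (\<Sum>n\<le>i. if n = i then cesaro_sum \<alpha> T n x else 0)"
    by (intro sum.cong) (auto simp: prod_coeff_0)
  then show ?case by simp
next
  case (Suc j)
  let ?D = "cesaro_sum \<alpha> T"
  interpret L: linear "?D i" by (rule linear_cesaro_sum[OF T])
  have "?D i (?D (Suc j) x) = cesaro_k \<alpha> (Suc j) *\<^sub>R ?D i x + T (?D i (?D j x))"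
    by (simp add: cesaro_sum_Suc[OF T, of _ j] L.add L.scale cesaro_sum_commute[OF T])
  also have "T (?D i (?D j x)) = ?D (Suc i) (?D j x) - cesaro_k \<alpha> (Suc i) *\<^sub>R ?D j x"
    by (simp add: cesaro_sum_Suc[OF T])
  also have "?D (Suc i) (?D j x) = (\<Sum>n\<le>Suc i + j. prod_coeff \<alpha> (Suc i) j n *\<^sub>R ?D n x)"
    by (rule Suc)
  also have "cesaro_k \<alpha> (Suc j) *\<^sub>R ?D i x =
      (\<Sum>n\<le>Suc i + j. if n = i then cesaro_k \<alpha> (Suc j) *\<^sub>R ?D n x else 0)"
    by (subst sum.delta) auto
  also have "cesaro_k \<alpha> (Suc i) *\<^sub>R ?D j x =
      (\<Sum>n\<le>Suc i + j. if n = j then cesaro_k \<alpha> (Suc i) *\<^sub>R ?D n x else 0)"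
    by (subst sum.delta) auto
  also have "(\<Sum>n\<le>Suc i + j. if n = i then cesaro_k \<alpha> (Suc j) *\<^sub>R ?D n x else 0) +
      ((\<Sum>n\<le>Suc i + j. prod_coeff \<alpha> (Suc i) j n *\<^sub>R ?D n x) -
       (\<Sum>n\<le>Suc i + j. if n = j then cesaro_k \<alpha> (Suc i) *\<^sub>R ?D n x else 0)) =
      (\<Sum>n\<le>Suc i + j. prod_coeff \<alpha> i (Suc j) n *\<^sub>R ?D n x)"
    unfolding sum_subtractf[symmetric] sum.distrib[symmetric]
  proof (rule sum.cong)
    fix n assume "n \<in> {..Suc i + j}"
    then have n: "n \<le> Suc (i + j)" by simp
    have "prod_coeff \<alpha> i (Suc j) n = prod_coeff \<alpha> (Suc i) j n
        + cesaro_k \<alpha> (Suc (i + j) - n) * (of_bool (n = i) - of_bool (n = j))"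
      using n by (auto simp: prod_coeff_def less_Suc_eq algebra_simps)
    moreover have "Suc (i + j) - i = Suc j" "Suc (i + j) - j = Suc i" by auto
    ultimately have "prod_coeff \<alpha> i (Suc j) n = prod_coeff \<alpha> (Suc i) j n
        + (of_bool (n = i) * cesaro_k \<alpha> (Suc j) - of_bool (n = j) * cesaro_k \<alpha> (Suc i))"
      by (auto simp: algebra_simps)
    then show "(if n = i then cesaro_k \<alpha> (Suc j) *\<^sub>R ?D n x else 0) +
         (prod_coeff \<alpha> (Suc i) j n *\<^sub>R ?D n x -
          (if n = j then cesaro_k \<alpha> (Suc i) *\<^sub>R ?D n x else 0)) =
         prod_coeff \<alpha> i (Suc j) n *\<^sub>R ?D n x"
      by (simp add: scaleR_left_distrib scaleR_left_diff_distrib)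
  qed simp
  finally show ?case by simp
qed

section \<open>Norm estimates and the product of weighted sequences\<close>

lemma weighted_l1_prod_coeff: "weighted_l1 \<alpha> (prod_coeff \<alpha> i j)"
  by (rule weighted_l1_finite[of "i + j"]) (simp add: prod_coeff_def)

text \<open>For i \<le> j the bracket in \<open>prod_coeff\<close> is 1 for n \<ge> j, 0 for i \<le>
  n < j and -1 for n < i. The upper block is estimated by K(n) \<le> K(i + j), the lower one by K(n)
  \<le> K(i). Each contributes at most K(i) K(i + j), and doubling costs exp \<alpha>.\<close>

lemma weighted_norm_prod_coeff:
  assumes \<alpha>: "\<alpha> > 0"
  shows "weighted_norm \<alpha> (prod_coeff \<alpha> i j) \<le>
    2 * exp \<alpha> * cesaro_k (\<alpha> + 1) i * cesaro_k (\<alpha> + 1) j"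
proof -
  have *: "weighted_norm \<alpha> (prod_coeff \<alpha> i j) \<le>
    2 * exp \<alpha> * cesaro_k (\<alpha> + 1) i * cesaro_k (\<alpha> + 1) j" if ij: "i \<le> j" for i j
  proof -
    let ?k = "cesaro_k \<alpha>" and ?K = "cesaro_k (\<alpha> + 1)"
    have kn: "?k n \<ge> 0" "?K n \<ge> 0" for n using \<alpha> by (auto intro: cesaro_k_nonneg)
    have mono: "?K m \<le> ?K n" if "m \<le> n" for m n using \<alpha> that by (simp add: cesaro_k_mono)
    have rev: "(\<Sum>n\<le>m. ?k (m - n)) = ?K m" for m
      using sum.nat_diff_reindex[of ?k "Suc m"] sum_cesaro_k[of \<alpha> m]
      by (simp add: lessThan_Suc_atMost)
    have "weighted_norm \<alpha> (prod_coeff \<alpha> i j) = (\<Sum>n\<le>i + j. \<bar>prod_coeff \<alpha> i j n\<bar> * ?K n)"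
      by (rule weighted_norm_finite) (simp add: prod_coeff_def)
    also have "\<dots> = (\<Sum>n\<le>i + j. (if j \<le> n then ?k (i + j - n) * ?K n else 0) +
        (if n < i then ?k (i + j - n) * ?K n else 0))"
      using ij kn by (intro sum.cong) (auto simp: prod_coeff_def abs_mult)
    also have "\<dots> \<le> (\<Sum>n\<le>i + j. (if j \<le> n then ?k (i + j - n) * ?K (i + j) else 0) +
        ?k (i + j - n) * ?K i)"
      using kn mono by (intro sum_mono add_mono) (auto intro!: mult_left_mono mult_nonneg_nonneg)
    also have "\<dots> = (\<Sum>n\<in>{j..i + j}. ?k (i + j - n)) * ?K (i + j) + ?K (i + j) * ?K i"
    proof -
      have "(\<Sum>n\<le>i + j. if j \<le> n then ?k (i + j - n) * ?K (i + j) else 0)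
          = (\<Sum>n\<in>{j..i + j}. ?k (i + j - n) * ?K (i + j))"
        by (intro sum.mono_neutral_cong_right) auto
      then show ?thesis by (simp add: sum.distrib sum_distrib_right[symmetric] rev)
    qed
    also have "(\<Sum>n\<in>{j..i + j}. ?k (i + j - n)) = (\<Sum>n\<le>i. ?k (i - n))"
      by (rule sum.reindex_bij_witness[of _ "\<lambda>n. n + j" "\<lambda>n. n - j"]) auto
    also have "(\<Sum>n\<le>i. ?k (i - n)) = ?K i" by (rule rev)
    also have "?K i * ?K (i + j) + ?K (i + j) * ?K i = 2 * ?K i * ?K (i + j)" by simp
    also have "\<dots> \<le> 2 * ?K i * (exp \<alpha> * ?K j)"
      using \<alpha> kn ij by (intro mult_left_mono cesaro_k_doubling) auto
    finally show ?thesis by (simp add: mult_ac)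
  qed
  show ?thesis
  proof (cases "i \<le> j")
    case False
    have "prod_coeff \<alpha> i j = prod_coeff \<alpha> j i" by (rule ext) (rule prod_coeff_commute)
    then show ?thesis using *[of j i] False by (simp add: mult_ac)
  qed (rule *)
qed

text \<open>Coefficients of the product of the i-th Cesaro sum with the element given by b.
  Assembling \<open>star\<close> from rows reduces it to superpositions over a single index, and the
  signs in the rows of v later control F_N/F.\<close>

definition row :: "real \<Rightarrow> (nat \<Rightarrow> real) \<Rightarrow> nat \<Rightarrow> nat \<Rightarrow> real"
  where "row \<alpha> b i n = (\<Sum>j. b j * prod_coeff \<alpha> i j n)"

definition star :: "real \<Rightarrow> (nat \<Rightarrow> real) \<Rightarrow> (nat \<Rightarrow> real) \<Rightarrow> nat \<Rightarrow> real"
  where "star \<alpha> a b n = (\<Sum>i. a i * row \<alpha> b i n)"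

context
  fixes \<alpha> :: real and b :: "nat \<Rightarrow> real"
  assumes \<alpha>: "\<alpha> > 0" and b: "weighted_l1 \<alpha> b"
begin

lemma row_dominated: "\<bar>b j\<bar> * weighted_norm \<alpha> (prod_coeff \<alpha> i j) \<le>
    2 * exp \<alpha> * cesaro_k (\<alpha> + 1) i * (\<bar>b j\<bar> * cesaro_k (\<alpha> + 1) j)"
  using mult_left_mono[OF weighted_norm_prod_coeff[OF \<alpha>, of i j], of "\<bar>b j\<bar>"] by (simp add: mult_ac)

lemma row_dominated_summable: "summable (\<lambda>j. \<bar>b j\<bar> * weighted_norm \<alpha> (prod_coeff \<alpha> i j))"
proof (rule summable_comparison_test')
  show "summable (\<lambda>j. 2 * exp \<alpha> * cesaro_k (\<alpha> + 1) i * (\<bar>b j\<bar> * cesaro_k (\<alpha> + 1) j))"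
    using b unfolding weighted_l1_def by (rule summable_mult)
  show "norm (\<bar>b j\<bar> * weighted_norm \<alpha> (prod_coeff \<alpha> i j))
      \<le> 2 * exp \<alpha> * cesaro_k (\<alpha> + 1) i * (\<bar>b j\<bar> * cesaro_k (\<alpha> + 1) j)" for j
    using row_dominated[of j i] weighted_norm_nonneg[OF \<alpha> weighted_l1_prod_coeff, of i j]
    by (simp only: real_norm_def abs_mult abs_abs abs_of_nonneg)
qed

lemma summable_row: "summable (\<lambda>j. b j * prod_coeff \<alpha> i j n)"
  by (rule summable_rabs_cancel)
    (rule superposition_summable[OF \<alpha> weighted_l1_prod_coeff row_dominated_summable])

lemma weighted_l1_row: "weighted_l1 \<alpha> (row \<alpha> b i)"
  unfolding row_def[abs_def]
  by (rule superposition_weighted_l1[OF \<alpha> weighted_l1_prod_coeff row_dominated_summable])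

lemma weighted_norm_row:
  "weighted_norm \<alpha> (row \<alpha> b i) \<le> 2 * exp \<alpha> * cesaro_k (\<alpha> + 1) i * weighted_norm \<alpha> b"
proof -
  have "weighted_norm \<alpha> (row \<alpha> b i) \<le> (\<Sum>j. \<bar>b j\<bar> * weighted_norm \<alpha> (prod_coeff \<alpha> i j))"
    unfolding row_def[abs_def]
    by (rule superposition_norm_le[OF \<alpha> weighted_l1_prod_coeff row_dominated_summable])
  also have "\<dots> \<le> (\<Sum>j. 2 * exp \<alpha> * cesaro_k (\<alpha> + 1) i * (\<bar>b j\<bar> * cesaro_k (\<alpha> + 1) j))"
    by (intro suminf_le row_dominated row_dominated_summable summable_mult b[unfolded weighted_l1_def])
  also have "\<dots> = 2 * exp \<alpha> * cesaro_k (\<alpha> + 1) i * weighted_norm \<alpha> b"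
    unfolding weighted_norm_def by (intro suminf_mult b[unfolded weighted_l1_def])
  finally show ?thesis .
qed

context
  fixes a :: "nat \<Rightarrow> real"
  assumes a: "weighted_l1 \<alpha> a"
begin

lemma star_dominated: "\<bar>a i\<bar> * weighted_norm \<alpha> (row \<alpha> b i) \<le>
    2 * exp \<alpha> * weighted_norm \<alpha> b * (\<bar>a i\<bar> * cesaro_k (\<alpha> + 1) i)"
  using mult_left_mono[OF weighted_norm_row[of i], of "\<bar>a i\<bar>"] by (simp add: mult_ac)

lemma star_dominated_summable: "summable (\<lambda>i. \<bar>a i\<bar> * weighted_norm \<alpha> (row \<alpha> b i))"
proof (rule summable_comparison_test')
  show "summable (\<lambda>i. 2 * exp \<alpha> * weighted_norm \<alpha> b * (\<bar>a i\<bar> * cesaro_k (\<alpha> + 1) i))"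
    using a unfolding weighted_l1_def by (rule summable_mult)
  show "norm (\<bar>a i\<bar> * weighted_norm \<alpha> (row \<alpha> b i))
      \<le> 2 * exp \<alpha> * weighted_norm \<alpha> b * (\<bar>a i\<bar> * cesaro_k (\<alpha> + 1) i)" for i
    using star_dominated[of i] weighted_norm_nonneg[OF \<alpha> weighted_l1_row, of i]
    by (simp only: real_norm_def abs_mult abs_abs abs_of_nonneg)
qed

lemma summable_star: "summable (\<lambda>i. a i * row \<alpha> b i n)"
  by (rule summable_rabs_cancel)
    (rule superposition_summable[OF \<alpha> weighted_l1_row star_dominated_summable])

lemma weighted_l1_star: "weighted_l1 \<alpha> (star \<alpha> a b)"
  unfolding star_def[abs_def]
  by (rule superposition_weighted_l1[OF \<alpha> weighted_l1_row star_dominated_summable])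

lemma weighted_norm_star:
  "weighted_norm \<alpha> (star \<alpha> a b) \<le> 2 * exp \<alpha> * weighted_norm \<alpha> b * weighted_norm \<alpha> a"
proof -
  have "weighted_norm \<alpha> (star \<alpha> a b) \<le> (\<Sum>i. \<bar>a i\<bar> * weighted_norm \<alpha> (row \<alpha> b i))"
    unfolding star_def[abs_def]
    by (rule superposition_norm_le[OF \<alpha> weighted_l1_row star_dominated_summable])
  also have "\<dots> \<le> (\<Sum>i. 2 * exp \<alpha> * weighted_norm \<alpha> b * (\<bar>a i\<bar> * cesaro_k (\<alpha> + 1) i))"
    by (intro suminf_le star_dominated star_dominated_summable summable_mult
        a[unfolded weighted_l1_def])
  also have "\<dots> = 2 * exp \<alpha> * weighted_norm \<alpha> b * weighted_norm \<alpha> a"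
    unfolding weighted_norm_def[of _ a] by (intro suminf_mult a[unfolded weighted_l1_def])
  finally show ?thesis .
qed

end

end

section \<open>The functional calculus on weighted sequences\<close>

definition calc :: "real \<Rightarrow> ('a::real_normed_vector \<Rightarrow> 'a) \<Rightarrow> (nat \<Rightarrow> real) \<Rightarrow> 'a \<Rightarrow> 'a"
  where "calc \<alpha> T a x = (\<Sum>n. a n *\<^sub>R cesaro_sum \<alpha> T n x)"

text \<open>Real Banach spaces are taken so that one development serves both the given operator and
  multiplication by a real scalar r, which supplies the characters.\<close>

locale cesaro_operator =
  fixes \<alpha> :: real and T :: "'a::banach \<Rightarrow> 'a" and M :: real
  assumes \<alpha>: "\<alpha> > 0" and T: "bounded_linear T"
    and bound: "\<And>n x. norm (cesaro_sum \<alpha> T n x) \<le> M * cesaro_k (\<alpha> + 1) n * norm x"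
begin

sublocale T: bounded_linear T by (rule T)

lemma bounded_linear_cesaro_sum: "bounded_linear (cesaro_sum \<alpha> T n)"
proof -
  interpret L: linear "cesaro_sum \<alpha> T n" by (rule linear_cesaro_sum[OF T.linear])
  show ?thesis
    by (rule bounded_linear_intro[where K = "M * cesaro_k (\<alpha> + 1) n"])
      (simp_all add: L.add L.scale bound mult.commute[of "norm _"])
qed

lemma bound': "norm (cesaro_sum \<alpha> T n x) \<le> M * norm x * cesaro_k (\<alpha> + 1) n"
  using bound[of n x] by (simp only: mult_ac)

lemma norm_summable_calc: "weighted_l1 \<alpha> a \<Longrightarrow> summable (\<lambda>n. norm (a n *\<^sub>R cesaro_sum \<alpha> T n x))"
  using weighted_l1_summable(1)[OF _ bound'] .

lemma summable_calc: "weighted_l1 \<alpha> a \<Longrightarrow> summable (\<lambda>n. a n *\<^sub>R cesaro_sum \<alpha> T n x)"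
  by (rule summable_norm_cancel[OF norm_summable_calc])

lemma norm_calc: "weighted_l1 \<alpha> a \<Longrightarrow> norm (calc \<alpha> T a x) \<le> M * weighted_norm \<alpha> a * norm x"
  using weighted_l1_summable(2)[OF _ bound', of a x] unfolding calc_def by (simp only: mult_ac)

lemma bounded_linear_calc:
  assumes "weighted_l1 \<alpha> a"
  shows "bounded_linear (calc \<alpha> T a)"
proof (rule bounded_linear_intro[where K = "M * weighted_norm \<alpha> a"])
  fix x y and r :: real
  have D: "cesaro_sum \<alpha> T n (x + y) = cesaro_sum \<alpha> T n x + cesaro_sum \<alpha> T n y"
     "cesaro_sum \<alpha> T n (r *\<^sub>R x) = r *\<^sub>R cesaro_sum \<alpha> T n x" for n
    using linear_cesaro_sum[OF T.linear] by (auto simp: linear_iff)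
  show "calc \<alpha> T a (x + y) = calc \<alpha> T a x + calc \<alpha> T a y"
    unfolding calc_def D scaleR_add_right
    by (rule suminf_add[symmetric]) (intro summable_calc assms)+
  have "(\<Sum>n. a n *\<^sub>R r *\<^sub>R cesaro_sum \<alpha> T n x) = (\<Sum>n. r *\<^sub>R a n *\<^sub>R cesaro_sum \<alpha> T n x)"
    by (simp add: mult.commute)
  then show "calc \<alpha> T a (r *\<^sub>R x) = r *\<^sub>R calc \<alpha> T a x"
    unfolding calc_def D
    using suminf_scaleR_right[OF summable_calc[OF assms], of r x] by simp
  show "norm (calc \<alpha> T a x) \<le> norm x * (M * weighted_norm \<alpha> a)"
    using norm_calc[OF assms, of x] by (simp add: mult_ac)
qed

lemma calc_diff:
  assumes "weighted_l1 \<alpha> a" "weighted_l1 \<alpha> b"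
  shows "calc \<alpha> T (\<lambda>n. a n - b n) x = calc \<alpha> T a x - calc \<alpha> T b x"
  unfolding calc_def scaleR_diff_left
  by (rule suminf_diff[symmetric]) (intro summable_calc assms)+

text \<open>The same series over j is evaluated twice: by superposing the product formula
  \<open>cesaro_sum_mult\<close>, and by continuity of the i-th Cesaro sum.\<close>

lemma calc_row:
  assumes b: "weighted_l1 \<alpha> b"
  shows "calc \<alpha> T (row \<alpha> b i) x = cesaro_sum \<alpha> T i (calc \<alpha> T b x)"
proof -
  have fin: "(\<Sum>n. prod_coeff \<alpha> i j n *\<^sub>R cesaro_sum \<alpha> T n x) =
      cesaro_sum \<alpha> T i (cesaro_sum \<alpha> T j x)" for j
    unfolding cesaro_sum_mult[OF T.linear]
    by (rule suminf_finite) (auto simp: prod_coeff_def)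
  interpret L: bounded_linear "cesaro_sum \<alpha> T i" by (rule bounded_linear_cesaro_sum)
  have "(\<lambda>j. b j *\<^sub>R cesaro_sum \<alpha> T i (cesaro_sum \<alpha> T j x)) sums calc \<alpha> T (row \<alpha> b i) x"
    using superposition_sums[OF \<alpha> weighted_l1_prod_coeff row_dominated_summable[OF \<alpha> b] bound', of i x]
    unfolding fin calc_def row_def .
  moreover have "(\<lambda>j. b j *\<^sub>R cesaro_sum \<alpha> T i (cesaro_sum \<alpha> T j x)) sums
      cesaro_sum \<alpha> T i (calc \<alpha> T b x)"
    using L.sums[OF summable_sums[OF summable_calc[OF b]]]
    unfolding L.scaleR calc_def .
  ultimately show ?thesis by (rule sums_unique2)
qed

lemma calc_star:
  assumes a: "weighted_l1 \<alpha> a" and b: "weighted_l1 \<alpha> b"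
  shows "calc \<alpha> T (star \<alpha> a b) x = calc \<alpha> T a (calc \<alpha> T b x)"
proof -
  have "(\<lambda>i. a i *\<^sub>R (\<Sum>n. row \<alpha> b i n *\<^sub>R cesaro_sum \<alpha> T n x)) sums
      (\<Sum>n. (\<Sum>i. a i * row \<alpha> b i n) *\<^sub>R cesaro_sum \<alpha> T n x)"
    by (rule superposition_sums[where M = "row \<alpha> b", OF \<alpha> weighted_l1_row[OF \<alpha> b]
          star_dominated_summable[OF \<alpha> b a] bound'])
  then have "(\<lambda>i. a i *\<^sub>R calc \<alpha> T (row \<alpha> b i) x) sums calc \<alpha> T (star \<alpha> a b) x"
    by (simp only: calc_def star_def)
  then show ?thesis
    unfolding calc_row[OF b] calc_def[of \<alpha> T a] by (rule sums_unique)
qed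

end

section \<open>Fractional sums of Banach-space valued sequences\<close>

text \<open>One operator for both directions: \<beta> = \<alpha> is the fractional sum, \<beta> =
  -\<alpha> the fractional difference. Banach space values cover real and complex sequences at
  once.\<close>

definition frac_series :: "real \<Rightarrow> (nat \<Rightarrow> 'a::banach) \<Rightarrow> nat \<Rightarrow> 'a"
  where "frac_series \<beta> a n = (\<Sum>i. cesaro_k \<beta> i *\<^sub>R a (n + i))"

context
  fixes \<alpha> :: real and a :: "nat \<Rightarrow> 'a::banach"
  assumes \<alpha>: "\<alpha> > 0" and a: "summable (\<lambda>n. norm (a n) * cesaro_k (\<alpha> + 1) n)"
begin

lemma frac_series_dominated:
  "norm (cesaro_k \<alpha> i *\<^sub>R a (n + i)) \<le> norm (a (i + n)) * cesaro_k (\<alpha> + 1) (i + n)"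
proof -
  have "cesaro_k \<alpha> i \<le> cesaro_k (\<alpha> + 1) i"
    using \<alpha> by (simp add: cesaro_k_le_Suc_param)
  also have "\<dots> \<le> cesaro_k (\<alpha> + 1) (i + n)"
    using \<alpha> by (intro cesaro_k_mono) auto
  finally have "cesaro_k \<alpha> i * norm (a (i + n)) \<le> cesaro_k (\<alpha> + 1) (i + n) * norm (a (i + n))"
    by (rule mult_right_mono) simp
  then show ?thesis using \<alpha> by (simp add: cesaro_k_nonneg add.commute mult.commute)
qed

lemma norm_summable_frac_series: "summable (\<lambda>i. norm (cesaro_k \<alpha> i *\<^sub>R a (n + i)))"
proof (rule summable_comparison_test')
  show "summable (\<lambda>i. norm (a (i + n)) * cesaro_k (\<alpha> + 1) (i + n))"
    using summable_ignore_initial_segment[OF a, of n] .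
  show "norm (norm (cesaro_k \<alpha> i *\<^sub>R a (n + i))) \<le> norm (a (i + n)) * cesaro_k (\<alpha> + 1) (i + n)" for i
    using frac_series_dominated[of i n] by simp
qed

lemma suminf_norm_frac_series_le:
  "(\<Sum>i. norm (cesaro_k \<alpha> i *\<^sub>R a (n + i))) \<le> (\<Sum>i. norm (a i) * cesaro_k (\<alpha> + 1) i)"
proof -
  have s: "summable (\<lambda>i. norm (a (i + n)) * cesaro_k (\<alpha> + 1) (i + n))"
    using summable_ignore_initial_segment[OF a, of n] .
  have "(\<Sum>i. norm (cesaro_k \<alpha> i *\<^sub>R a (n + i))) \<le>
      (\<Sum>i. norm (a (i + n)) * cesaro_k (\<alpha> + 1) (i + n))"
    by (rule suminf_le[OF frac_series_dominated norm_summable_frac_series s])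
  also have "\<dots> \<le> (\<Sum>i. norm (a i) * cesaro_k (\<alpha> + 1) i)"
    using suminf_split_initial_segment[OF a, of n] \<alpha>
      sum_nonneg[of "{..<n}" "\<lambda>i. norm (a i) * cesaro_k (\<alpha> + 1) i"]
    by (simp add: cesaro_k_nonneg)
  finally show ?thesis .
qed

text \<open>The kernels k^(-\<alpha>) and k^\<alpha> convolve to the unit. The rearrangement is
  legitimate because k^(-\<alpha>) is absolutely summable and the inner sums are bounded by the
  weighted norm of a, uniformly in the starting index.\<close>

lemma frac_series_inverse:
  "(\<lambda>j. cesaro_k (- \<alpha>) j *\<^sub>R frac_series \<alpha> a (n + j)) sums a n"
proof -
  let ?N = "\<Sum>i. norm (a i) * cesaro_k (\<alpha> + 1) i"
  let ?F = "\<lambda>j i. cesaro_k (- \<alpha>) j *\<^sub>R cesaro_k \<alpha> i *\<^sub>R a (n + j + i)"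
  have nn: "norm (?F j i) = \<bar>cesaro_k (- \<alpha>) j\<bar> * norm (cesaro_k \<alpha> i *\<^sub>R a (n + j + i))" for j i
    by (simp add: abs_mult)
  have s1: "summable (\<lambda>i. norm (?F j i))" for j
    unfolding nn by (rule summable_mult[OF norm_summable_frac_series])
  have sn: "(\<Sum>i. norm (?F j i)) =
      \<bar>cesaro_k (- \<alpha>) j\<bar> * (\<Sum>i. norm (cesaro_k \<alpha> i *\<^sub>R a (n + j + i)))" for j
    unfolding nn by (rule suminf_mult[OF norm_summable_frac_series])
  have s2: "summable (\<lambda>j. \<Sum>i. norm (?F j i))"
  proof (rule summable_comparison_test')
    show "summable (\<lambda>j. \<bar>cesaro_k (- \<alpha>) j\<bar> * ?N)"
      by (rule summable_mult2[OF summable_cesaro_k_neg[OF \<alpha>]])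
    show "norm (\<Sum>i. norm (?F j i)) \<le> \<bar>cesaro_k (- \<alpha>) j\<bar> * ?N" for j
    proof -
      have "(\<Sum>i. norm (?F j i)) \<ge> 0" by (rule suminf_nonneg[OF s1]) simp
      then have "norm (\<Sum>i. norm (?F j i)) = (\<Sum>i. norm (?F j i))" by simp
      also have "\<dots> \<le> \<bar>cesaro_k (- \<alpha>) j\<bar> * ?N"
        unfolding sn by (rule mult_left_mono[OF suminf_norm_frac_series_le]) simp
      finally show ?thesis .
    qed
  qed
  have in1: "(\<Sum>i. ?F j i) = cesaro_k (- \<alpha>) j *\<^sub>R frac_series \<alpha> a (n + j)" for j
    unfolding frac_series_def
    by (rule suminf_scaleR_right[OF summable_norm_cancel[OF norm_summable_frac_series], symmetric])
  have "(\<Sum>j\<le>p. ?F j (p - j)) = (if p = 0 then a n else 0)" for p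
  proof -
    have "(\<Sum>j\<le>p. ?F j (p - j)) =
        (\<Sum>j\<le>p. cesaro_k (- \<alpha>) j * cesaro_k \<alpha> (p - j)) *\<^sub>R a (n + p)"
      unfolding scaleR_sum_left by (rule sum.cong) auto
    then show ?thesis by (simp add: cesaro_k_convolution cesaro_k_zero)
  qed
  then have "(\<lambda>p. if p = 0 then a n else 0) sums (\<Sum>j. \<Sum>i. ?F j i)"
    using double_series_diagonal[OF s1 s2] by simp
  then have eq: "(\<Sum>j. \<Sum>i. ?F j i) = a n"
    using sums_single[of 0 "\<lambda>_. a n"] sums_unique2 by fastforce
  have "summable (\<lambda>j. norm (\<Sum>i. ?F j i))"
    by (rule summable_comparison_test'[OF s2, of 0]) (use summable_norm[OF s1] in simp)
  then show ?thesis
    using summable_sums[OF summable_norm_cancel] eq unfolding in1 by metis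
qed

end

section \<open>Characters given by real scalars\<close>

lemma cesaro_sum_scalar:
  "cesaro_sum \<alpha> ((*) r) n (y::real) = (\<Sum>j\<le>n. cesaro_k \<alpha> (n - j) * r ^ j) * y"
proof -
  have "((*) r ^^ j) y = r ^ j * y" for j by (induction j) auto
  then show ?thesis by (simp add: cesaro_sum_def sum_distrib_right mult.assoc)
qed

text \<open>At r = 1 the weight itself appears, so this character is the total mass with respect to
  the weight.\<close>

lemma cesaro_sum_scalar_one: "cesaro_sum \<alpha> ((*) 1) n (1::real) = cesaro_k (\<alpha> + 1) n"
  using sum.nat_diff_reindex[of "cesaro_k \<alpha>" "Suc n"] sum_cesaro_k[of \<alpha> n]
  by (simp add: cesaro_sum_scalar lessThan_Suc_atMost)

lemma cesaro_operator_scalar: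
  assumes "\<alpha> > 0" "\<bar>r\<bar> \<le> 1"
  shows "cesaro_operator \<alpha> ((*) (r::real)) 1"
proof (rule cesaro_operator.intro)
  show "bounded_linear ((*) r)" by (rule bounded_linear_mult_right)
  fix n :: nat and x :: real
  have "\<bar>\<Sum>j\<le>n. cesaro_k \<alpha> (n - j) * r ^ j\<bar> \<le> (\<Sum>j\<le>n. \<bar>cesaro_k \<alpha> (n - j) * r ^ j\<bar>)"
    by (rule sum_abs)
  also have "\<dots> \<le> (\<Sum>j\<le>n. cesaro_k \<alpha> (n - j) * 1 ^ j)"
    using assms
    by (intro sum_mono) (auto simp: abs_mult cesaro_k_nonneg power_abs intro!: mult_left_le power_le_one)
  also have "\<dots> = cesaro_k (\<alpha> + 1) n"
    using cesaro_sum_scalar_one[of \<alpha> n] by (simp add: cesaro_sum_scalar)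
  finally show "norm (cesaro_sum \<alpha> ((*) r) n x) \<le> 1 * cesaro_k (\<alpha> + 1) n * norm x"
    by (simp add: cesaro_sum_scalar abs_mult mult_right_mono)
qed (use assms in auto)

text \<open>Summation along antidiagonals identifies the character at r with evaluation at r of the
  function whose Taylor coefficients are \<open>frac_series \<alpha> a\<close>.\<close>

lemma calc_scalar_sums:
  assumes \<alpha>: "\<alpha> > 0" and a: "weighted_l1 \<alpha> a" and r: "\<bar>r\<bar> < 1"
  shows "(\<lambda>p. frac_series \<alpha> a p * r ^ p) sums calc \<alpha> ((*) r) a 1"
proof -
  have a': "summable (\<lambda>n. norm (a n) * cesaro_k (\<alpha> + 1) n)"
    using a by (simp add: weighted_l1_def)
  let ?N = "\<Sum>i. norm (a i) * cesaro_k (\<alpha> + 1) i"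
  let ?F = "\<lambda>p i. r ^ p *\<^sub>R cesaro_k \<alpha> i *\<^sub>R a (p + i)"
  note ns = norm_summable_frac_series[OF \<alpha> a']
  have nn: "norm (?F p i) = \<bar>r\<bar> ^ p * norm (cesaro_k \<alpha> i *\<^sub>R a (p + i))" for p i
    by (simp add: abs_mult power_abs)
  have s1: "summable (\<lambda>i. norm (?F p i))" for p
    unfolding nn by (rule summable_mult[OF ns])
  have sn: "(\<Sum>i. norm (?F p i)) = \<bar>r\<bar> ^ p * (\<Sum>i. norm (cesaro_k \<alpha> i *\<^sub>R a (p + i)))" for p
    unfolding nn by (rule suminf_mult[OF ns])
  have s2: "summable (\<lambda>p. \<Sum>i. norm (?F p i))"
  proof (rule summable_comparison_test')
    show "summable (\<lambda>p. \<bar>r\<bar> ^ p * ?N)"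
      by (rule summable_mult2[OF summable_geometric]) (use r in simp)
    show "norm (\<Sum>i. norm (?F p i)) \<le> \<bar>r\<bar> ^ p * ?N" for p
    proof -
      have "(\<Sum>i. norm (?F p i)) \<ge> 0" by (rule suminf_nonneg[OF s1]) simp
      then have "norm (\<Sum>i. norm (?F p i)) = (\<Sum>i. norm (?F p i))" by simp
      also have "\<dots> \<le> \<bar>r\<bar> ^ p * ?N"
        unfolding sn by (rule mult_left_mono[OF suminf_norm_frac_series_le[OF \<alpha> a']]) simp
      finally show ?thesis .
    qed
  qed
  have in1: "(\<Sum>i. ?F p i) = frac_series \<alpha> a p * r ^ p" for p
    using suminf_scaleR_right[OF summable_norm_cancel[OF ns[of p]], of "r ^ p"]
    by (simp add: frac_series_def mult.commute)
  have diag: "(\<Sum>p\<le>n. ?F p (n - p)) = a n *\<^sub>R cesaro_sum \<alpha> ((*) r) n 1" for n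
    by (simp add: cesaro_sum_scalar sum_distrib_left mult_ac)
  have eq: "(\<Sum>p. \<Sum>i. ?F p i) = calc \<alpha> ((*) r) a 1"
    using double_series_diagonal[OF s1 s2] unfolding diag calc_def by (rule sums_unique)
  have "summable (\<lambda>p. norm (\<Sum>i. ?F p i))"
    by (rule summable_comparison_test'[OF s2, of 0]) (use summable_norm[OF s1] in simp)
  then show ?thesis
    using summable_sums[OF summable_norm_cancel] eq unfolding in1 by metis
qed

text \<open>Stated for a general field because it serves the characters over the reals and Taylor
  coefficients over the complex numbers.\<close>

lemma power_series_unique:
  fixes a b :: "nat \<Rightarrow> 'a::{real_normed_field, banach}"
  assumes a: "\<And>z. norm z < 1 \<Longrightarrow> (\<lambda>n. a n * z ^ n) sums f z"
    and b: "\<And>z. norm z < 1 \<Longrightarrow> (\<lambda>n. b n * z ^ n) sums f z"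
  shows "a = b"
proof -
  define c where "c n = a n - b n" for n
  have c: "(\<lambda>n. c n * z ^ n) sums 0" if "norm z < 1" for z
    using sums_diff[OF a[OF that] b[OF that]] by (simp add: c_def left_diff_distrib)
  have "c n = 0" for n
  proof (induction n rule: less_induct)
    case (less m)
    have "(\<lambda>n. c (n + m) * z ^ n) sums 0" if z: "z \<noteq> 0" "norm z < 1" for z
    proof -
      have "(\<lambda>n. c (n + m) * z ^ (n + m)) sums (0 - (\<Sum>i<m. c i * z ^ i))"
        using c[OF z(2)] by (rule sums_split_initial_segment)
      then have "(\<lambda>n. (c (n + m) * z ^ (n + m)) / z ^ m) sums (0 / z ^ m)"
        using less by (intro sums_divide) simp
      then show ?thesis using z(1) by (simp add: power_add)
    qed
    then have "((\<lambda>_. 0) \<longlongrightarrow> c (0 + m)) (at (0::'a))"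
      by (intro powser_limit_0_strong[where s = 1]) auto
    then show ?case using LIM_unique[OF _ tendsto_const[of "0::'a"]] by simp
  qed
  then show ?thesis by (auto simp: c_def)
qed

text \<open>The function on (-1,1) determines its Taylor coefficients, and
  \<open>frac_series_inverse\<close> recovers the sequence from them. Identities between products
  can thus be checked for scalar operators.\<close>

lemma calc_scalar_inject:
  assumes \<alpha>: "\<alpha> > 0" and a: "weighted_l1 \<alpha> a" and b: "weighted_l1 \<alpha> b"
    and eq: "\<And>r. \<bar>r\<bar> < 1 \<Longrightarrow> calc \<alpha> ((*) r) a 1 = calc \<alpha> ((*) r) b (1::real)"
  shows "a = b"
proof -
  have fs: "frac_series \<alpha> a = frac_series \<alpha> b"
    by (rule power_series_unique[where f = "\<lambda>r. calc \<alpha> ((*) r) a 1"])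
      (use calc_scalar_sums[OF \<alpha> a] calc_scalar_sums[OF \<alpha> b] eq in auto)
  have sa: "summable (\<lambda>n. norm (a n) * cesaro_k (\<alpha> + 1) n)"
    and sb: "summable (\<lambda>n. norm (b n) * cesaro_k (\<alpha> + 1) n)"
    using a b by (simp_all add: weighted_l1_def)
  show ?thesis
  proof
    fix n
    show "a n = b n"
      using frac_series_inverse[OF \<alpha> sa, of n] frac_series_inverse[OF \<alpha> sb, of n]
      unfolding fs by (rule sums_unique2)
  qed
qed

text \<open>Multiplication by \<open>1 - z\<close>, read on the coefficients with respect to the Cesaro sums.\<close>

definition mult_one_minus :: "real \<Rightarrow> (nat \<Rightarrow> real) \<Rightarrow> nat \<Rightarrow> real"
  where "mult_one_minus \<alpha> w n =
    (case n of 0 \<Rightarrow> w 0 + (\<Sum>i. cesaro_k \<alpha> (Suc i) * w i) | Suc m \<Rightarrow> w (Suc m) - w m)"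

lemma mult_one_minus_Suc [simp]: "mult_one_minus \<alpha> w (Suc m) = w (Suc m) - w m"
  by (simp add: mult_one_minus_def)

context
  fixes \<alpha> :: real and w :: "nat \<Rightarrow> real"
  assumes \<alpha>: "\<alpha> > 0" and w: "weighted_l1 \<alpha> w"
begin

lemma cesaro_k_Suc_dominated:
  "\<bar>w m\<bar> * cesaro_k (\<alpha> + 1) (Suc m) \<le> (\<alpha> + 1) * (\<bar>w m\<bar> * cesaro_k (\<alpha> + 1) m)"
  using mult_left_mono[OF cesaro_k_Suc_le[of \<alpha> m], of "\<bar>w m\<bar>"] \<alpha> by (simp add: mult_ac)

lemma weighted_l1_Suc: "summable (\<lambda>m. \<bar>w m\<bar> * cesaro_k (\<alpha> + 1) (Suc m))"
proof (rule summable_comparison_test')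
  show "summable (\<lambda>m. (\<alpha> + 1) * (\<bar>w m\<bar> * cesaro_k (\<alpha> + 1) m))"
    using w unfolding weighted_l1_def by (rule summable_mult)
  show "norm (\<bar>w m\<bar> * cesaro_k (\<alpha> + 1) (Suc m)) \<le> (\<alpha> + 1) * (\<bar>w m\<bar> * cesaro_k (\<alpha> + 1) m)" for m
    using cesaro_k_Suc_dominated[of m] \<alpha> by (simp add: abs_mult cesaro_k_nonneg)
qed

lemma summable_cesaro_k_Suc: "summable (\<lambda>i. cesaro_k \<alpha> (Suc i) * w i)"
proof (rule summable_comparison_test'[OF weighted_l1_Suc])
  show "norm (cesaro_k \<alpha> (Suc i) * w i) \<le> \<bar>w i\<bar> * cesaro_k (\<alpha> + 1) (Suc i)" for i
    using mult_right_mono[OF cesaro_k_le_Suc_param[of \<alpha> "Suc i"], of "\<bar>w i\<bar>"] \<alpha>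
    by (simp add: abs_mult cesaro_k_nonneg mult.commute)
qed

lemma weighted_l1_mult_one_minus: "weighted_l1 \<alpha> (mult_one_minus \<alpha> w)"
proof -
  have "summable (\<lambda>m. \<bar>mult_one_minus \<alpha> w (Suc m)\<bar> * cesaro_k (\<alpha> + 1) (Suc m))"
  proof (rule summable_comparison_test')
    show "summable (\<lambda>m. \<bar>w (Suc m)\<bar> * cesaro_k (\<alpha> + 1) (Suc m) + \<bar>w m\<bar> * cesaro_k (\<alpha> + 1) (Suc m))"
      using w weighted_l1_Suc unfolding weighted_l1_def
      by (intro summable_add) (simp_all add: summable_Suc_iff[of "\<lambda>n. \<bar>w n\<bar> * cesaro_k (\<alpha> + 1) n"])
    show "norm (\<bar>mult_one_minus \<alpha> w (Suc m)\<bar> * cesaro_k (\<alpha> + 1) (Suc m))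
      \<le> \<bar>w (Suc m)\<bar> * cesaro_k (\<alpha> + 1) (Suc m) + \<bar>w m\<bar> * cesaro_k (\<alpha> + 1) (Suc m)" for m
      using mult_right_mono[OF abs_triangle_ineq4[of "w (Suc m)" "w m"], of "cesaro_k (\<alpha> + 1) (Suc m)"] \<alpha>
      by (simp add: abs_mult cesaro_k_nonneg distrib_right)
  qed
  then show ?thesis
    unfolding weighted_l1_def
    by (subst (asm) summable_Suc_iff[of "\<lambda>n. \<bar>mult_one_minus \<alpha> w n\<bar> * cesaro_k (\<alpha> + 1) n"])
qed

end

section \<open>Multiplication by 1 - z under the calculus, and injectivity of I - T\<close>

context cesaro_operator
begin

text \<open>By T D_n = D_(n+1) - k(n+1) for the Cesaro sums D_n, the shift produces the differences
  of w, and the identity terms accumulate in the zeroth coefficient.\<close>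

lemma calc_mult_one_minus:
  assumes w: "weighted_l1 \<alpha> w"
  shows "calc \<alpha> T (mult_one_minus \<alpha> w) x = calc \<alpha> T w x - T (calc \<alpha> T w x)"
proof -
  let ?D = "\<lambda>n. cesaro_sum \<alpha> T n x"
  let ?E = "mult_one_minus \<alpha> w"
  have s: "summable (\<lambda>n. w n *\<^sub>R ?D n)" by (rule summable_calc[OF w])
  have sk: "summable (\<lambda>n. (cesaro_k \<alpha> (Suc n) * w n) *\<^sub>R x)"
    by (rule summable_scaleR_left[OF summable_cesaro_k_Suc[OF \<alpha> w]])
  have sT: "summable (\<lambda>n. w n *\<^sub>R T (?D n))"
    using T.summable[OF s] by (simp add: T.scaleR)
  have TD: "w n *\<^sub>R ?D (Suc n) = (cesaro_k \<alpha> (Suc n) * w n) *\<^sub>R x + w n *\<^sub>R T (?D n)" for n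
    by (simp add: cesaro_sum_Suc[OF T.linear] scaleR_add_right mult.commute)
  have "calc \<alpha> T ?E x = ?E 0 *\<^sub>R x + (\<Sum>n. ?E (Suc n) *\<^sub>R ?D (Suc n))"
    using suminf_split_head[OF summable_calc[OF weighted_l1_mult_one_minus[OF \<alpha> w], of x]]
    by (simp add: calc_def)
  also have "(\<Sum>n. ?E (Suc n) *\<^sub>R ?D (Suc n)) =
      (\<Sum>n. w (Suc n) *\<^sub>R ?D (Suc n)) - (\<Sum>n. w n *\<^sub>R ?D (Suc n))"
    unfolding mult_one_minus_Suc scaleR_diff_left
  proof (rule suminf_diff[symmetric])
    show "summable (\<lambda>n. w (Suc n) *\<^sub>R ?D (Suc n))" using s by (simp add: summable_Suc_iff[of "\<lambda>n. w n *\<^sub>R ?D n"])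
    show "summable (\<lambda>n. w n *\<^sub>R ?D (Suc n))" unfolding TD by (rule summable_add[OF sk sT])
  qed
  also have "(\<Sum>n. w (Suc n) *\<^sub>R ?D (Suc n)) = calc \<alpha> T w x - w 0 *\<^sub>R x"
    using suminf_split_head[OF s] by (simp add: calc_def)
  also have "(\<Sum>n. w n *\<^sub>R ?D (Suc n)) =
      (\<Sum>n. (cesaro_k \<alpha> (Suc n) * w n) *\<^sub>R x) + (\<Sum>n. w n *\<^sub>R T (?D n))"
    unfolding TD by (rule suminf_add[OF sk sT, symmetric])
  also have "(\<Sum>n. (cesaro_k \<alpha> (Suc n) * w n) *\<^sub>R x) = (?E 0 - w 0) *\<^sub>R x"
    by (subst suminf_scaleR_left[symmetric])
      (simp_all add: summable_cesaro_k_Suc[OF \<alpha> w] mult_one_minus_def)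
  also have "(\<Sum>n. w n *\<^sub>R T (?D n)) = T (calc \<alpha> T w x)"
    using T.suminf[OF s] by (simp add: calc_def T.scaleR)
  finally show ?thesis by (simp add: algebra_simps)
qed

lemma calc_commute: 
  assumes "weighted_l1 \<alpha> a"
  shows "calc \<alpha> T a (T x) = T (calc \<alpha> T a x)"
  using T.suminf[OF summable_calc[OF assms, of x]]
  by (simp add: calc_def cesaro_sum_commute[OF T.linear] T.scaleR)

text \<open>The Cesaro means of order \<alpha> + 1 are bounded by M and tend to 0 on the range of I
  - T, hence by density everywhere; but they fix every x with T x = x.\<close>

lemma inj_one_minus:
  assumes dense: "closure (range (\<lambda>y. y - T y)) = UNIV"
  shows "inj (\<lambda>y. y - T y)"
proof -
  define B where "B n x = (\<Sum>m\<le>n. cesaro_sum \<alpha> T m x) /\<^sub>R cesaro_k (\<alpha> + 2) n" for n x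
  let ?C = "\<lambda>n. cesaro_k (\<alpha> + 2) n"
  have Cpos: "?C n > 0" for n using \<alpha> by (intro cesaro_k_pos) auto
  have lin: "linear (B n)" for n
    unfolding B_def
    by (intro linear_compose_scale_right linear_compose_sum ballI linear_cesaro_sum T.linear)
  have Bb: "norm (B n x) \<le> M * norm x" for n x
  proof -
    have "norm (\<Sum>m\<le>n. cesaro_sum \<alpha> T m x) \<le> (\<Sum>m\<le>n. M * norm x * cesaro_k (\<alpha> + 1) m)"
      by (rule sum_norm_le) (rule bound')
    also have "\<dots> = M * norm x * ?C n"
      using sum_cesaro_k[of "\<alpha> + 1" n] by (simp add: sum_distrib_left[symmetric] add.commute)
    finally show ?thesis using Cpos[of n] by (simp add: B_def field_simps)
  qed
  have ratio: "(\<lambda>n. cesaro_k (\<alpha> + 1) (Suc n) / ?C n) \<longlonglongrightarrow> 0"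
  proof -
    have eq: "cesaro_k (\<alpha> + 1) (Suc n) / ?C n = (\<alpha> + 1) / (real n + 1)" for n
    proof (induction n)
      case 0
      then show ?case by (simp add: cesaro_k_Suc)
    next
      case (Suc n)
      have "cesaro_k (\<alpha> + 1) (Suc (Suc n)) / ?C (Suc n) = cesaro_k (\<alpha> + 1) (Suc n) / ?C n *
          (((\<alpha> + 1 + real (Suc n)) / (real (Suc n) + 1)) / ((\<alpha> + 2 + real n) / (real n + 1)))"
        unfolding cesaro_k_Suc[of "\<alpha> + 1" "Suc n"] cesaro_k_Suc[of "\<alpha> + 2" n]
        by (simp add: mult_ac)
      also have "\<dots> = (\<alpha> + 1) / (real (Suc n) + 1)"
        unfolding Suc using \<alpha> by (simp add: divide_simps)
      finally show ?case .
    qed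
    have "(\<lambda>n. (\<alpha> + 1) * inverse (real (Suc n))) \<longlonglongrightarrow> (\<alpha> + 1) * 0"
      by (intro tendsto_mult tendsto_const LIMSEQ_inverse_real_of_nat)
    then show ?thesis unfolding eq by (simp add: divide_inverse add.commute)
  qed
  have Br: "(\<lambda>n. B n (y - T y)) \<longlonglongrightarrow> 0" for y
  proof -
    \<comment> \<open>Applied to y, I - T turns D_m into D_m - D_(m+1) + k(m+1); the sum telescopes
      and the kernel terms add up to K(n+1).\<close>
    have tel: "(\<Sum>m\<le>n. cesaro_sum \<alpha> T m (y - T y)) =
        cesaro_k (\<alpha> + 1) (Suc n) *\<^sub>R y - cesaro_sum \<alpha> T (Suc n) y" for n
    proof (induction n)
      case 0
      then show ?case by (simp add: cesaro_sum_Suc[OF T.linear] cesaro_k_Suc algebra_simps)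
    next
      case (Suc n)
      have D1: "cesaro_sum \<alpha> T (Suc n) (y - T y) =
          cesaro_sum \<alpha> T (Suc n) y - T (cesaro_sum \<alpha> T (Suc n) y)"
        using linear_diff[OF linear_cesaro_sum[OF T.linear]] cesaro_sum_commute[OF T.linear] by metis
      have D2: "T (cesaro_sum \<alpha> T (Suc n) y) =
          cesaro_sum \<alpha> T (Suc (Suc n)) y - cesaro_k \<alpha> (Suc (Suc n)) *\<^sub>R y"
        by (simp add: cesaro_sum_Suc[OF T.linear, of \<alpha> "Suc n"])
      have K: "cesaro_k (\<alpha> + 1) (Suc (Suc n)) = cesaro_k (\<alpha> + 1) (Suc n) + cesaro_k \<alpha> (Suc (Suc n))"
        using cesaro_k_diff[of "\<alpha> + 1" "Suc n"] by simp
      show ?case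
        unfolding sum.atMost_Suc Suc D1 D2 K scaleR_left_distrib by simp
    qed
    have le: "norm (B n (y - T y)) \<le> (norm y + M * norm y) * (cesaro_k (\<alpha> + 1) (Suc n) / ?C n)" for n
    proof -
      have "norm (cesaro_k (\<alpha> + 1) (Suc n) *\<^sub>R y - cesaro_sum \<alpha> T (Suc n) y) \<le>
          norm (cesaro_k (\<alpha> + 1) (Suc n) *\<^sub>R y) + M * norm y * cesaro_k (\<alpha> + 1) (Suc n)"
        using norm_triangle_ineq4 bound' by (rule order_trans[OF _ add_left_mono])
      also have "norm (cesaro_k (\<alpha> + 1) (Suc n) *\<^sub>R y) = cesaro_k (\<alpha> + 1) (Suc n) * norm y"
        using \<alpha> by (simp add: cesaro_k_nonneg)
      finally have "norm (\<Sum>m\<le>n. cesaro_sum \<alpha> T m (y - T y)) / ?C n \<le>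
          (cesaro_k (\<alpha> + 1) (Suc n) * norm y + M * norm y * cesaro_k (\<alpha> + 1) (Suc n)) / ?C n"
        unfolding tel using Cpos[of n] by (intro divide_right_mono) auto
      also have "\<dots> = (norm y + M * norm y) * (cesaro_k (\<alpha> + 1) (Suc n) / ?C n)"
        by (simp add: algebra_simps)
      finally show ?thesis
        using Cpos[of n] by (simp add: B_def divide_inverse mult.commute)
    qed
    have "(\<lambda>n. (norm y + M * norm y) * (cesaro_k (\<alpha> + 1) (Suc n) / ?C n)) \<longlonglongrightarrow> 0"
      using tendsto_mult_right_zero[OF ratio] .
    then show ?thesis
      by (rule Lim_null_comparison[rotated]) (use le in simp)
  qed
  have "x = 0" if x: "T x = x" for x
  proof (rule ccontr)
    assume "x \<noteq> 0"
    have Bx: "B n x = x" for n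
    proof -
      have "(T ^^ j) x = x" for j using x by (induction j) auto
      then have "cesaro_sum \<alpha> T m x = cesaro_k (\<alpha> + 1) m *\<^sub>R x" for m
        using cesaro_sum_scalar_one[of \<alpha> m]
        by (simp add: cesaro_sum_def[of \<alpha> T] cesaro_sum_scalar scaleR_sum_left[symmetric])
      then show ?thesis
        using sum_cesaro_k[of "\<alpha> + 1" n] Cpos[of n]
        by (simp add: B_def scaleR_sum_left[symmetric] add.commute)
    qed
    have M: "M \<ge> 0" using Bb[of 0 x] \<open>x \<noteq> 0\<close> Bx[of 0] by simp
    \<comment> \<open>The tolerance is chosen so that M times it stays strictly below norm
      x.\<close>
    obtain y where y: "dist (y - T y) x < norm x / (2 * (M + 1))"
    proof -
      have "x \<in> closure (range (\<lambda>y. y - T y))" using dense by simp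
      moreover have "norm x / (2 * (M + 1)) > 0" using M \<open>x \<noteq> 0\<close> by simp
      ultimately show ?thesis using that unfolding closure_approachable by blast
    qed
    have "norm x \<le> M * (norm x / (2 * (M + 1))) + norm (B n (y - T y))" for n
    proof -
      have "x = B n (x - (y - T y)) + B n (y - T y)"
        using linear_diff[OF lin, of n x "y - T y"] Bx[of n] by simp
      then have "norm x \<le> norm (B n (x - (y - T y))) + norm (B n (y - T y))"
        by (metis norm_triangle_ineq)
      also have "norm (B n (x - (y - T y))) \<le> M * norm (x - (y - T y))" by (rule Bb)
      also have "\<dots> \<le> M * (norm x / (2 * (M + 1)))"
        using y M by (intro mult_left_mono) (auto simp: dist_norm norm_minus_commute)
      finally show ?thesis by simp
    qed
    moreover have "(\<lambda>n. M * (norm x / (2 * (M + 1))) + norm (B n (y - T y))) \<longlonglongrightarrow>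
        M * (norm x / (2 * (M + 1))) + norm (0::'a)"
      by (intro tendsto_intros Br)
    ultimately have "norm x \<le> M * (norm x / (2 * (M + 1))) + norm (0::'a)"
      by (intro LIMSEQ_le_const) auto
    also have "\<dots> < norm x"
    proof -
      have "M * norm x < 2 * (M + 1) * norm x"
        using M \<open>x \<noteq> 0\<close> by (intro mult_strict_right_mono) auto
      then show ?thesis using M by (simp add: field_simps)
    qed
    finally show False by simp
  qed
  then have "x = y" if "x - T x = y - T y" for x y
    using that[unfolded diff_eq_eq] by (metis T.diff add_diff_cancel_left' diff_add_eq diff_diff_eq2 eq_iff_diff_eq_0 that)
  then show ?thesis by (auto intro: injI)
qed

end

section \<open>Weyl differences of the reciprocal coefficients\<close>

text \<open>For \<beta> \<le> 1 the kernel is bounded, so plain summability is enough. Nothing more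
  is known about the coefficients of 1/F at the start.\<close>

lemma norm_summable_frac_series_l1:
  fixes a :: "nat \<Rightarrow> 'a::banach"
  assumes "\<beta> \<le> 1" and a: "summable (\<lambda>n. norm (a n))"
  shows "summable (\<lambda>i. norm (cesaro_k \<beta> i *\<^sub>R a (n + i)))"
proof -
  obtain C where C: "\<And>n. \<bar>cesaro_k \<beta> n\<bar> \<le> C" using cesaro_k_bounded[OF assms(1)] by blast
  show ?thesis
  proof (rule summable_comparison_test')
    show "summable (\<lambda>i. C * norm (a (i + n)))"
      by (intro summable_mult summable_ignore_initial_segment a)
    show "norm (norm (cesaro_k \<beta> i *\<^sub>R a (n + i))) \<le> C * norm (a (i + n))" for i
      using mult_right_mono[OF C[of i], of "norm (a (i + n))"] by (simp add: add.commute)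
  qed
qed

lemma frac_series_step:
  fixes a :: "nat \<Rightarrow> 'a::banach"
  assumes "\<beta> \<le> 1" and a: "summable (\<lambda>n. norm (a n))"
  shows "frac_series \<beta> a n - frac_series \<beta> a (Suc n) = frac_series (\<beta> - 1) a n"
proof -
  note s = summable_norm_cancel[OF norm_summable_frac_series_l1[OF assms]]
  have s': "summable (\<lambda>i. cesaro_k (\<beta> - 1) i *\<^sub>R a (n + i))"
    by (rule summable_norm_cancel[OF norm_summable_frac_series_l1[OF _ a]]) (use assms(1) in simp)
  have sS: "summable (\<lambda>i. cesaro_k \<beta> (Suc i) *\<^sub>R a (Suc n + i))"
    using s[of n] by (subst (asm) summable_Suc_iff[symmetric]) simp
  have "frac_series \<beta> a n = a n + (\<Sum>i. cesaro_k \<beta> (Suc i) *\<^sub>R a (Suc n + i))"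
    using suminf_split_head[OF s[of n]] by (simp add: frac_series_def)
  moreover have "frac_series (\<beta> - 1) a n = a n + (\<Sum>i. cesaro_k (\<beta> - 1) (Suc i) *\<^sub>R a (Suc n + i))"
    using suminf_split_head[OF s'] by (simp add: frac_series_def)
  moreover have "(\<Sum>i. cesaro_k (\<beta> - 1) (Suc i) *\<^sub>R a (Suc n + i)) =
      (\<Sum>i. cesaro_k \<beta> (Suc i) *\<^sub>R a (Suc n + i)) - frac_series \<beta> a (Suc n)"
    unfolding frac_series_def suminf_diff[OF sS s[of "Suc n"]]
    by (simp only: cesaro_k_diff[symmetric] scaleR_diff_left)
  ultimately show ?thesis by simp
qed

lemma frac_series_0: "frac_series 0 a = a"
proof
  fix n
  have "(\<Sum>i. cesaro_k 0 i *\<^sub>R a (n + i)) = (\<Sum>i\<in>{0}. cesaro_k 0 i *\<^sub>R a (n + i))"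
    by (rule suminf_finite) (auto simp: cesaro_k_zero)
  then show "frac_series 0 a n = a n" by (simp add: frac_series_def)
qed

lemma weyl_steps_frac_series:
  assumes "\<beta> \<le> 1" and a: "summable (\<lambda>n. cmod (a n))"
  shows "(weyl_step ^^ m) (frac_series \<beta> a) = frac_series (\<beta> - real m) a"
proof (induction m)
  case (Suc m)
  show ?case
  proof
    fix n
    have "(weyl_step ^^ Suc m) (frac_series \<beta> a) n =
        frac_series (\<beta> - real m) a n - frac_series (\<beta> - real m) a (Suc n)"
      by (simp add: Suc weyl_step_def[of "frac_series _ _"])
    also have "\<dots> = frac_series (\<beta> - real m - 1) a n"
      using assms by (intro frac_series_step) auto
    finally show "(weyl_step ^^ Suc m) (frac_series \<beta> a) n = frac_series (\<beta> - real (Suc m)) a n"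
      by (simp add: algebra_simps)
  qed
qed simp

lemma frac_sum_eq_frac_series: "frac_sum \<beta> a = frac_series \<beta> a"
  by (rule ext) (simp add: frac_sum_def frac_series_def scaleR_conv_of_real)

lemma frac_diff_eq_frac_series: "frac_diff \<beta> a = frac_series (- \<beta>) a"
  by (rule ext) (simp add: frac_diff_def frac_series_def scaleR_conv_of_real)

text \<open>The inner fractional sum has order m - \<alpha> \<le> 1, where the kernel is bounded;
  each of the m difference steps lowers the order by one, ending at -\<alpha>.\<close>

lemma weyl_diff_eq_frac_series:
  assumes "\<alpha> \<ge> 0" and a: "summable (\<lambda>n. cmod (a n))"
  shows "weyl_diff \<alpha> a = frac_series (- \<alpha>) a"
proof (cases "\<alpha> \<in> \<nat>")
  case True
  then obtain m where "\<alpha> = real m" by (auto elim: Nats_cases)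
  then show ?thesis
    using weyl_steps_frac_series[of 0 a m] a by (simp add: weyl_diff_def frac_series_0)
next
  case False
  define m where "m = nat \<lfloor>\<alpha>\<rfloor> + 1"
  have "real m - \<alpha> \<le> 1"
    using assms(1) by (simp add: m_def)
  then show ?thesis
    using False weyl_steps_frac_series[of "real m - \<alpha>" a m] a
    unfolding weyl_diff_def m_def[symmetric] frac_sum_eq_frac_series by simp
qed

lemma frac_series_of_real:
  assumes "summable (\<lambda>i. cesaro_k \<beta> i * g (n + i))"
  shows "frac_series \<beta> (\<lambda>n. complex_of_real (g n)) n = of_real (frac_series \<beta> g n)"
proof -
  have "(\<lambda>i. complex_of_real (cesaro_k \<beta> i * g (n + i))) sums of_real (frac_series \<beta> g n)"
    unfolding frac_series_def using sums_of_real[OF summable_sums[OF assms]] by simp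
  then show ?thesis
    by (simp add: frac_series_def scaleR_conv_of_real sums_iff)
qed

context
  fixes g :: "nat \<Rightarrow> real"
  assumes g: "summable (\<lambda>n. \<bar>g n\<bar>)" and g_nonpos: "\<And>n. n \<ge> 1 \<Longrightarrow> g n \<le> 0"
begin

lemma norm_summable_coeffs: "summable (\<lambda>n. norm (g n))"
  using g by simp

text \<open>In the sum of K(n) v(n) over n \<le> R, the coefficient of g(p) is a convolution of
  k^(\<alpha>+1) with k^(-\<alpha>). For p \<le> R it is complete and equals k^1(p) = 1; for p > R
  it is nonpositive and meets g(p) \<le> 0. So the sum is bounded below, which bounds the norm since
  v(n) \<le> 0 for n \<ge> 1.\<close>

lemma weyl_difference_weighted_l1_base:
  assumes \<alpha>: "0 < \<alpha>" "\<alpha> \<le> 1" and v: "\<And>n. n \<ge> 1 \<Longrightarrow> frac_series (- \<alpha>) g n \<le> 0"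
  shows "weighted_l1 \<alpha> (frac_series (- \<alpha>) g)"
proof -
  define v where "v = frac_series (- \<alpha>) g"
  let ?K = "cesaro_k (\<alpha> + 1)" and ?k = "cesaro_k (- \<alpha>)"
  have Kn: "?K n \<ge> 0" for n using \<alpha> by (simp add: cesaro_k_nonneg)
  have low: "- (\<Sum>p. \<bar>g p\<bar>) \<le> (\<Sum>n\<le>R. ?K n * v n)" for R
  proof -
    \<comment> \<open>Padding with zeros below n writes every v n as a series over the common index
      p, so that finitely many can be added termwise.\<close>
    let ?t = "\<lambda>n p. if n \<le> p then ?k (p - n) * g p else 0"
    have t: "?t n sums v n" for n
    proof -
      have "summable (\<lambda>i. ?k i *\<^sub>R g (n + i))"
        by (rule summable_norm_cancel[OF norm_summable_frac_series_l1[OF _ norm_summable_coeffs]]) (use \<alpha> in simp)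
      then have "(\<lambda>i. ?t n (i + n)) sums v n"
        by (simp add: v_def frac_series_def summable_sums add.commute)
      then show ?thesis
        by (subst (asm) sums_iff_shift) (simp add: sum.neutral)
    qed
    have T: "(\<lambda>p. \<Sum>n\<le>R. ?K n * ?t n p) sums (\<Sum>n\<le>R. ?K n * v n)"
      by (intro sums_sum sums_mult t)
    have "- \<bar>g p\<bar> \<le> (\<Sum>n\<le>R. ?K n * ?t n p)" for p
    proof (cases "p \<le> R")
      case True
      have "(\<Sum>n\<le>R. ?K n * ?t n p) = (\<Sum>n\<le>p. ?K n * ?k (p - n)) * g p"
        unfolding sum_distrib_right
        by (rule sum.mono_neutral_cong_right) (use True in auto)
      also have "\<dots> = g p" by (simp add: cesaro_k_convolution)
      finally show ?thesis by simp
    next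
      case False
      have "?K n * ?t n p \<ge> 0" if "n \<le> R" for n
        using that False Kn[of n] cesaro_k_neg_nonpos[of \<alpha> "p - n"] g_nonpos[of p] \<alpha>
          mult_nonpos_nonpos[of "?k (p - n)" "g p"] by simp
      then have "(\<Sum>n\<le>R. ?K n * ?t n p) \<ge> 0" by (intro sum_nonneg) auto
      then show ?thesis by linarith
    qed
    then have "(\<Sum>p. - \<bar>g p\<bar>) \<le> (\<Sum>p. \<Sum>n\<le>R. ?K n * ?t n p)"
      using T g by (intro suminf_le) (auto simp: sums_iff summable_minus)
    then show ?thesis using T g by (simp add: sums_iff suminf_minus)
  qed
  have "(\<Sum>n<R. \<bar>v n\<bar> * ?K n) \<le> 2 * \<bar>v 0\<bar> + (\<Sum>p. \<bar>g p\<bar>)" for R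
  proof -
    have "(\<Sum>n<R. \<bar>v n\<bar> * ?K n) \<le> (\<Sum>n\<le>R. \<bar>v n\<bar> * ?K n)"
      using Kn by (intro sum_mono2) auto
    also have "\<dots> = (\<Sum>n\<le>R. (if n = 0 then \<bar>v 0\<bar> + v 0 else 0) - ?K n * v n)"
      using v by (intro sum.cong) (auto simp: v_def abs_of_nonpos)
    also have "\<dots> = \<bar>v 0\<bar> + v 0 - (\<Sum>n\<le>R. ?K n * v n)"
      by (simp add: sum_subtractf)
    also have "\<dots> \<le> 2 * \<bar>v 0\<bar> + (\<Sum>p. \<bar>g p\<bar>)" using low[of R] by linarith
    finally show ?thesis .
  qed
  then show ?thesis
    unfolding weighted_l1_def v_def[symmetric] using Kn by (intro summableI_nonneg_bounded) auto
qed

text \<open>Here k^\<alpha> is bounded by 1 and k^(-\<alpha>) is summable, so summability of g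
  dominates the double series. For larger \<alpha> the kernel k^\<alpha> is unbounded and this
  domination breaks down.\<close>

lemma weyl_difference_inverse_base:
  assumes \<alpha>: "0 < \<alpha>" "\<alpha> \<le> 1"
  shows "frac_series \<alpha> (frac_series (- \<alpha>) g) = g"
proof
  fix n
  let ?F = "\<lambda>j i. cesaro_k (- \<alpha>) j * (cesaro_k \<alpha> i * g (n + j + i))"
  let ?N = "\<Sum>p. \<bar>g p\<bar>"
  have nn: "norm (?F j i) = \<bar>cesaro_k (- \<alpha>) j\<bar> * norm (cesaro_k \<alpha> i *\<^sub>R g (n + j + i))" for j i
    by (simp add: abs_mult)
  have ns: "summable (\<lambda>i. norm (cesaro_k \<alpha> i *\<^sub>R g (m + i)))" for m
    using \<alpha>(2) norm_summable_coeffs by (rule norm_summable_frac_series_l1)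
  have s1: "summable (\<lambda>i. norm (?F j i))" for j
    unfolding nn by (rule summable_mult[OF ns])
  have sn: "(\<Sum>i. norm (?F j i)) =
      \<bar>cesaro_k (- \<alpha>) j\<bar> * (\<Sum>i. norm (cesaro_k \<alpha> i *\<^sub>R g (n + j + i)))" for j
    unfolding nn by (rule suminf_mult[OF ns])
  have N: "(\<Sum>i. norm (cesaro_k \<alpha> i *\<^sub>R g (m + i))) \<le> ?N" for m
  proof -
    have sh: "summable (\<lambda>i. \<bar>g (i + m)\<bar>)" by (rule summable_ignore_initial_segment[OF g])
    have "norm (cesaro_k \<alpha> i *\<^sub>R g (m + i)) \<le> \<bar>g (i + m)\<bar>" for i
      using \<alpha> cesaro_k_le_one[of \<alpha> i] cesaro_k_nonneg[of \<alpha> i]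
      by (simp add: abs_mult add.commute mult_left_le_one_le)
    then have "(\<Sum>i. norm (cesaro_k \<alpha> i *\<^sub>R g (m + i))) \<le> (\<Sum>i. \<bar>g (i + m)\<bar>)"
      by (intro suminf_le ns sh)
    also have "\<dots> \<le> ?N"
      using suminf_split_initial_segment[OF g, of m] sum_nonneg[of "{..<m}" "\<lambda>i. \<bar>g i\<bar>"] by simp
    finally show ?thesis .
  qed
  have s2: "summable (\<lambda>j. \<Sum>i. norm (?F j i))"
  proof (rule summable_comparison_test')
    show "summable (\<lambda>j. \<bar>cesaro_k (- \<alpha>) j\<bar> * ?N)"
      by (rule summable_mult2[OF summable_cesaro_k_neg[OF \<alpha>(1)]])
    show "norm (\<Sum>i. norm (?F j i)) \<le> \<bar>cesaro_k (- \<alpha>) j\<bar> * ?N" for j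
    proof -
      have "(\<Sum>i. norm (?F j i)) \<ge> 0" by (rule suminf_nonneg[OF s1]) simp
      then have "norm (\<Sum>i. norm (?F j i)) = (\<Sum>i. norm (?F j i))" by simp
      also have "\<dots> \<le> \<bar>cesaro_k (- \<alpha>) j\<bar> * ?N"
        unfolding sn by (rule mult_left_mono[OF N]) simp
      finally show ?thesis .
    qed
  qed
  have "(\<Sum>j\<le>p. ?F j (p - j)) = (if p = 0 then g n else 0)" for p
  proof -
    have "(\<Sum>j\<le>p. ?F j (p - j)) = (\<Sum>j\<le>p. cesaro_k (- \<alpha>) j * cesaro_k \<alpha> (p - j)) * g (n + p)"
      unfolding sum_distrib_right by (rule sum.cong) auto
    then show ?thesis by (simp add: cesaro_k_convolution cesaro_k_zero)
  qed
  then have "(\<lambda>p. if p = 0 then g n else 0) sums (\<Sum>j. \<Sum>i. ?F j i)"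
    using double_series_diagonal[OF s1 s2] by simp
  then have "(\<Sum>j. \<Sum>i. ?F j i) = g n"
    using sums_single[of 0 "\<lambda>_. g n"] sums_unique2 by fastforce
  then have "(\<Sum>i. \<Sum>j. ?F j i) = g n"
    using double_series_swap[OF s1 s2] by simp
  moreover have "(\<Sum>j. ?F j i) = cesaro_k \<alpha> i *\<^sub>R frac_series (- \<alpha>) g (n + i)" for i
  proof -
    have "summable (\<lambda>j. cesaro_k (- \<alpha>) j *\<^sub>R g (n + i + j))"
      by (rule summable_norm_cancel[OF norm_summable_frac_series_l1[OF _ norm_summable_coeffs]]) (use \<alpha> in simp)
    from suminf_mult[OF this, of "cesaro_k \<alpha> i"] show ?thesis
      by (simp add: frac_series_def mult_ac add_ac)
  qed
  ultimately show "frac_series \<alpha> (frac_series (- \<alpha>) g) n = g n"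
    by (simp add: frac_series_def[of \<alpha>])
qed

lemma frac_series_tendsto_0:
  assumes "\<beta> \<le> 1"
  shows "frac_series \<beta> g \<longlonglongrightarrow> 0"
proof -
  obtain C where C: "\<And>n. \<bar>cesaro_k \<beta> n\<bar> \<le> C" using cesaro_k_bounded[OF assms] by blast
  have le: "norm (frac_series \<beta> g n) \<le> C * (\<Sum>i. \<bar>g (i + n)\<bar>)" for n
  proof -
    have sh: "summable (\<lambda>i. \<bar>g (i + n)\<bar>)" by (rule summable_ignore_initial_segment[OF g])
    note ns = norm_summable_frac_series_l1[OF assms norm_summable_coeffs, of n]
    have "norm (frac_series \<beta> g n) \<le> (\<Sum>i. norm (cesaro_k \<beta> i *\<^sub>R g (n + i)))"
      unfolding frac_series_def by (rule summable_norm[OF ns])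
    also have "\<dots> \<le> (\<Sum>i. C * \<bar>g (i + n)\<bar>)"
    proof (rule suminf_le[OF _ ns summable_mult[OF sh]])
      show "norm (cesaro_k \<beta> i *\<^sub>R g (n + i)) \<le> C * \<bar>g (i + n)\<bar>" for i
        using mult_right_mono[OF C[of i], of "\<bar>g (i + n)\<bar>"] by (simp add: abs_mult add.commute)
    qed
    also have "\<dots> = C * (\<Sum>i. \<bar>g (i + n)\<bar>)" by (rule suminf_mult[OF sh])
    finally show ?thesis .
  qed
  have "(\<lambda>n. C * (\<Sum>i. \<bar>g (i + n)\<bar>)) \<longlonglongrightarrow> 0"
    using tendsto_mult_right_zero[OF suminf_exist_split2[OF norm_summable_coeffs]] by simp
  then show ?thesis
    by (rule Lim_null_comparison[rotated]) (use le in simp)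
qed

text \<open>Summation by parts lowers \<open>\<alpha>\<close> by one, and the boundary terms have the right sign since the
  difference of order \<open>\<alpha> - 1\<close> increases to \<open>0\<close>. For \<open>\<alpha> \<le> 1\<close> the double series converges
  absolutely and \<open>k\<^bsup>-\<alpha>\<^esup>(n) \<le> 0\<close> for \<open>n \<ge> 1\<close>.\<close>

lemma weyl_difference_inverse_aux:
  assumes "0 < \<alpha>" "\<alpha> \<le> real (Suc m)" "\<And>n. n \<ge> 1 \<Longrightarrow> frac_series (- \<alpha>) g n \<le> 0"
  shows "weighted_l1 \<alpha> (frac_series (- \<alpha>) g) \<and> frac_series \<alpha> (frac_series (- \<alpha>) g) = g"
  using assms
proof (induction m arbitrary: \<alpha>)
  case 0
  then show ?case using weyl_difference_weighted_l1_base weyl_difference_inverse_base by simp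
next
  case (Suc m \<alpha>)
  show ?case
  proof (cases "\<alpha> \<le> 1")
    case True
    then show ?thesis
      using Suc.prems weyl_difference_weighted_l1_base weyl_difference_inverse_base by simp
  next
    case False
    define \<beta> where "\<beta> = \<alpha> - 1"
    define b where "b = frac_series (- \<beta>) g"
    define v where "v = frac_series (- \<alpha>) g"
    have \<beta>: "\<beta> > 0" "\<beta> + 1 = \<alpha>" using False by (simp_all add: \<beta>_def)
    have vb: "v n = b n - b (Suc n)" for n
      using frac_series_step[of "- \<beta>" g n] norm_summable_coeffs \<beta> by (simp add: v_def b_def \<beta>_def)
    have b_nonpos: "b n \<le> 0" if "n \<ge> 1" for n
    proof -
      have "incseq (\<lambda>i. b (i + n))"
        using vb Suc.prems(3) that by (intro incseq_SucI) (simp add: v_def[symmetric])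
      moreover have "(\<lambda>i. b (i + n)) \<longlonglongrightarrow> 0"
        using frac_series_tendsto_0[of "- \<beta>"] \<beta> unfolding b_def by (intro LIMSEQ_ignore_initial_segment) simp
      ultimately show ?thesis using incseq_le[of "\<lambda>i. b (i + n)" 0 0] by simp
    qed
    have IH: "weighted_l1 \<beta> b" "frac_series \<beta> b = g"
      using Suc.IH[of \<beta>] \<beta> Suc.prems(2) b_nonpos unfolding b_def by auto
    let ?K = "cesaro_k (\<alpha> + 1)" and ?k = "cesaro_k \<alpha>"
    have Kn: "?K n \<ge> 0" "?k n \<ge> 0" for n using Suc.prems(1) by (simp_all add: cesaro_k_nonneg)
    have sb: "summable (\<lambda>n. \<bar>b n\<bar> * ?k n)" using IH(1) by (simp add: weighted_l1_def \<beta>(2))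
    \<comment> \<open>With \<gamma> = \<alpha> this controls the weighted norm of v; with \<gamma> =
      \<beta> it transfers the inversion formula, where the boundary term vanishes because b is
      summable against k^\<alpha>.\<close>
    have parts: "(\<Sum>i\<le>R. cesaro_k (\<gamma> + 1) i * (b (n + i) - b (Suc (n + i)))) =
        (\<Sum>i\<le>R. cesaro_k \<gamma> i * b (n + i)) - cesaro_k (\<gamma> + 1) R * b (Suc (n + R))" for \<gamma> n R
    proof (induction R)
      case (Suc R)
      have "cesaro_k (\<gamma> + 1) (Suc R) = cesaro_k (\<gamma> + 1) R + cesaro_k \<gamma> (Suc R)"
        using cesaro_k_diff[of "\<gamma> + 1" R] by simp
      then show ?case using Suc by (simp add: algebra_simps)
    qed (simp add: algebra_simps)
    have w: "weighted_l1 \<alpha> v"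
    proof -
      have "(\<Sum>n<R. \<bar>v n\<bar> * ?K n) \<le> 2 * \<bar>v 0\<bar> + (\<Sum>n. \<bar>b n\<bar> * ?k n)" for R
      proof -
        have "(\<Sum>n<R. \<bar>v n\<bar> * ?K n) \<le> (\<Sum>n\<le>R. \<bar>v n\<bar> * ?K n)"
          using Kn by (intro sum_mono2) auto
        also have "\<dots> = (\<Sum>n\<le>R. (if n = 0 then \<bar>v 0\<bar> + v 0 else 0) - ?K n * v n)"
          using Suc.prems(3) by (intro sum.cong) (auto simp: v_def abs_of_nonpos)
        also have "\<dots> = \<bar>v 0\<bar> + v 0 - (\<Sum>n\<le>R. ?K n * v n)"
          by (simp add: sum_subtractf)
        also have "(\<Sum>n\<le>R. ?K n * v n) = (\<Sum>n\<le>R. ?k n * b n) - ?K R * b (Suc R)"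
          using parts[of \<alpha> 0 R] by (simp add: vb)
        also have "\<bar>v 0\<bar> + v 0 - \<dots> \<le> 2 * \<bar>v 0\<bar> + (\<Sum>n\<le>R. \<bar>b n\<bar> * ?k n)"
        proof -
          have "- (\<Sum>n\<le>R. ?k n * b n) \<le> (\<Sum>n\<le>R. \<bar>b n\<bar> * ?k n)"
            unfolding sum_negf[symmetric]
          proof (rule sum_mono)
            fix n
            show "- (?k n * b n) \<le> \<bar>b n\<bar> * ?k n"
              using mult_right_mono[of "- b n" "\<bar>b n\<bar>" "?k n"] Kn(2)[of n] by (simp add: mult.commute)
          qed
          moreover have "?K R * b (Suc R) \<le> 0"
            using Kn b_nonpos[of "Suc R"] by (simp add: mult_nonneg_nonpos)
          ultimately show ?thesis by linarith
        qed
        also have "(\<Sum>n\<le>R. \<bar>b n\<bar> * ?k n) \<le> (\<Sum>n. \<bar>b n\<bar> * ?k n)"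
          using sb Kn by (intro sum_le_suminf) auto
        finally show ?thesis by simp
      qed
      then show ?thesis
        unfolding weighted_l1_def using Kn by (intro summableI_nonneg_bounded) auto
    qed
    have "frac_series \<alpha> v n = g n" for n
    proof -
      have s\<alpha>: "summable (\<lambda>i. ?k i *\<^sub>R v (n + i))"
        using summable_norm_cancel[OF norm_summable_frac_series[OF Suc.prems(1)], of v n] w
        by (simp add: weighted_l1_def)
      have s\<beta>: "summable (\<lambda>i. cesaro_k \<beta> i *\<^sub>R b (n + i))"
        using summable_norm_cancel[OF norm_summable_frac_series[OF \<beta>(1)], of b n] IH(1)
        by (simp add: weighted_l1_def)
      have L1: "(\<lambda>R. \<Sum>i\<le>R. ?k i * v (n + i)) \<longlonglongrightarrow> frac_series \<alpha> v n"
        using summable_LIMSEQ'[OF s\<alpha>] by (simp add: frac_series_def)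
      have L2: "(\<lambda>R. (\<Sum>i\<le>R. cesaro_k \<beta> i * b (n + i)) - ?k R * b (Suc (n + R))) \<longlonglongrightarrow> g n - 0"
      proof (rule tendsto_diff)
        show "(\<lambda>R. \<Sum>i\<le>R. cesaro_k \<beta> i * b (n + i)) \<longlonglongrightarrow> g n"
          using summable_LIMSEQ'[OF s\<beta>] IH(2) by (simp add: frac_series_def fun_eq_iff)
        have lim: "(\<lambda>R. \<bar>b (R + Suc n)\<bar> * ?k (R + Suc n)) \<longlonglongrightarrow> 0"
          using LIMSEQ_ignore_initial_segment[OF summable_LIMSEQ_zero[OF sb], of "Suc n"] .
        have "norm (?k R * b (Suc (n + R))) \<le> \<bar>b (R + Suc n)\<bar> * ?k (R + Suc n)" for R
          using mult_left_mono[OF cesaro_k_mono[of \<beta> R "R + Suc n"], of "\<bar>b (R + Suc n)\<bar>"] \<beta> Kn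
          by (simp add: abs_mult mult.commute add.commute)
        then show "(\<lambda>R. ?k R * b (Suc (n + R))) \<longlonglongrightarrow> 0"
          by (intro Lim_null_comparison[OF _ lim] always_eventually allI)
      qed
      have P: "(\<Sum>i\<le>R. ?k i * v (n + i)) =
          (\<Sum>i\<le>R. cesaro_k \<beta> i * b (n + i)) - ?k R * b (Suc (n + R))" for R
        using parts[of \<beta> n R] unfolding vb \<beta>(2) .
      show ?thesis using LIMSEQ_unique[OF L1[unfolded P] L2] by simp
    qed
    then show ?thesis using w by (auto simp: v_def)
  qed
qed

lemma weyl_difference_inverse:
  assumes "0 < \<alpha>" "\<And>n. n \<ge> 1 \<Longrightarrow> frac_series (- \<alpha>) g n \<le> 0"
  shows "weighted_l1 \<alpha> (frac_series (- \<alpha>) g)" "frac_series \<alpha> (frac_series (- \<alpha>) g) = g"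
proof -
  obtain m where "\<alpha> \<le> real m" using real_arch_simple by blast
  then have "\<alpha> \<le> real (Suc m)" by simp
  then show "weighted_l1 \<alpha> (frac_series (- \<alpha>) g)" "frac_series \<alpha> (frac_series (- \<alpha>) g) = g"
    using weyl_difference_inverse_aux[of \<alpha> m] assms by auto
qed

end

section \<open>Admissible pairs of coefficient sequences\<close>

definition unit_seq :: "nat \<Rightarrow> real"
  where "unit_seq n = of_bool (n = 0)"

lemma weighted_l1_unit_seq: "weighted_l1 \<alpha> unit_seq"
  by (rule weighted_l1_finite[of 0]) (simp add: unit_seq_def)

lemma calc_finite:
  assumes "\<And>n. n > N \<Longrightarrow> a n = 0"
  shows "calc \<alpha> T a x = (\<Sum>n\<le>N. a n *\<^sub>R cesaro_sum \<alpha> T n x)"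
  unfolding calc_def by (rule suminf_finite) (use assms in \<open>auto simp: not_le\<close>)

lemma calc_unit_seq: "calc \<alpha> T unit_seq x = x"
  using calc_finite[of 0 unit_seq \<alpha> T x] by (simp add: unit_seq_def)

lemma calc_scalar:
  assumes "\<alpha> > 0" "\<bar>r\<bar> \<le> 1" "weighted_l1 \<alpha> a"
  shows "calc \<alpha> ((*) r) a (y::real) = calc \<alpha> ((*) r) a 1 * y"
proof -
  interpret cesaro_operator \<alpha> "(*) r" 1 using assms by (intro cesaro_operator_scalar)
  interpret L: bounded_linear "calc \<alpha> ((*) r) a" by (rule bounded_linear_calc[OF assms(3)])
  show ?thesis using L.scaleR[of y 1] by (simp add: mult.commute)
qed

text \<open>A null sequence is bounded by its total variation. This undoes multiplication by 1 - z
  at the level of single coefficients.\<close>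

lemma le_suminf_abs_diff:
  fixes z d :: "nat \<Rightarrow> real"
  assumes z: "z \<longlonglongrightarrow> 0" and d: "summable (\<lambda>n. \<bar>d n\<bar>)" and zd: "\<And>m. d (Suc m) = z (Suc m) - z m"
  shows "\<bar>z n\<bar> \<le> (\<Sum>n. \<bar>d n\<bar>)"
proof -
  have "(\<lambda>k. z (k + n)) \<longlonglongrightarrow> 0"
    using z by (rule LIMSEQ_ignore_initial_segment)
  then have "(\<lambda>k. \<bar>z (k + n) - z n\<bar>) \<longlonglongrightarrow> \<bar>0 - z n\<bar>"
    by (intro tendsto_intros)
  moreover have "\<bar>z (k + n) - z n\<bar> \<le> (\<Sum>n. \<bar>d n\<bar>)" for k
  proof -
    have "z (k + n) - z n = (\<Sum>m\<in>{Suc n..<Suc (k + n)}. d m)"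
    proof (induction k)
      case (Suc k)
      then show ?case using zd[of "k + n"] by simp
    qed simp
    also have "\<bar>\<dots>\<bar> \<le> (\<Sum>m\<in>{Suc n..<Suc (k + n)}. \<bar>d m\<bar>)" by (rule sum_abs)
    also have "\<dots> \<le> (\<Sum>n. \<bar>d n\<bar>)" by (rule sum_le_suminf[OF d]) auto
    finally show ?thesis .
  qed
  ultimately show ?thesis
    by (intro LIMSEQ_le_const2[where X = "\<lambda>k. \<bar>z (k + n) - z n\<bar>"]) auto
qed

text \<open>The sequence \<rho> represents (1 - z)F and c is f(0). The two series with sum c express
  that F and (1 - z)F agree at 0, \<open>v_char\<close> that 1/F is nonnegative on [0,1), and the
  last assumption that (1 - z)F times 1/F is 1 - z.\<close>

locale admissible_pair =
  fixes \<alpha> :: real and u v \<rho> :: "nat \<Rightarrow> real" and c :: real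
  assumes \<alpha>: "\<alpha> > 0"
    and u_nonneg: "\<And>n. u n \<ge> 0"
    and u_tendsto: "(\<lambda>n. u n * cesaro_k (\<alpha> + 1) n) \<longlonglongrightarrow> 0"
    and v: "weighted_l1 \<alpha> v"
    and v_nonpos: "\<And>n. n \<ge> 1 \<Longrightarrow> v n \<le> 0"
    and v_char: "\<And>r. 0 \<le> r \<Longrightarrow> r < 1 \<Longrightarrow> calc \<alpha> ((*) r) v 1 \<ge> (0::real)"
    and \<rho>: "weighted_l1 \<alpha> \<rho>"
    and \<rho>_Suc: "\<And>n. \<rho> (Suc n) = u (Suc n) - u n"
    and u_sums: "(\<lambda>n. u n * cesaro_k \<alpha> n) sums c"
    and \<rho>_sums: "(\<lambda>n. \<rho> n * cesaro_k \<alpha> n) sums c"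
    and \<rho>_v_char: "\<And>r. \<bar>r\<bar> < 1 \<Longrightarrow> calc \<alpha> ((*) r) \<rho> 1 * calc \<alpha> ((*) r) v 1 = 1 - (r::real)"
begin

definition u_trunc :: "nat \<Rightarrow> nat \<Rightarrow> real"
  where "u_trunc N n = (if n \<le> N then u n else 0)"

text \<open>This is F_N/F in the algebra.\<close>

definition w :: "nat \<Rightarrow> nat \<Rightarrow> real"
  where "w N = star \<alpha> (u_trunc N) v"

abbreviation K :: "nat \<Rightarrow> real"
  where "K \<equiv> cesaro_k (\<alpha> + 1)"

lemma K_nonneg: "K n \<ge> 0"
  using \<alpha> by (simp add: cesaro_k_nonneg)

lemma weighted_l1_u_trunc: "weighted_l1 \<alpha> (u_trunc N)"
  by (rule weighted_l1_finite[of N]) (simp add: u_trunc_def)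

lemma weighted_l1_w: "weighted_l1 \<alpha> (w N)"
  unfolding w_def by (rule weighted_l1_star[OF \<alpha> v weighted_l1_u_trunc])

text \<open>Both orders are obtained from the characters, whose values commute. The first enters the
  error estimate for F_N/F, the second the cancellation of 1/F against (1 - z)F under the calculus
  of T.\<close>

lemma
  shows star_\<rho>_v: "star \<alpha> \<rho> v = mult_one_minus \<alpha> unit_seq"
    and star_v_\<rho>: "star \<alpha> v \<rho> = mult_one_minus \<alpha> unit_seq"
proof -
  have "calc \<alpha> ((*) r) (star \<alpha> \<rho> v) 1 = calc \<alpha> ((*) r) (mult_one_minus \<alpha> unit_seq) 1 \<and>
      calc \<alpha> ((*) r) (star \<alpha> v \<rho>) 1 = calc \<alpha> ((*) r) (mult_one_minus \<alpha> unit_seq) (1::real)"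
    if r: "\<bar>r\<bar> < 1" for r
  proof -
    interpret S: cesaro_operator \<alpha> "(*) r" 1 using \<alpha> r by (intro cesaro_operator_scalar) auto
    have "calc \<alpha> ((*) r) (star \<alpha> \<rho> v) 1 = 1 - r"
      unfolding S.calc_star[OF \<rho> v] using calc_scalar[OF \<alpha> _ \<rho>, of r "calc \<alpha> ((*) r) v 1"] r \<rho>_v_char[OF r]
      by simp
    moreover have "calc \<alpha> ((*) r) (star \<alpha> v \<rho>) 1 = 1 - r"
      unfolding S.calc_star[OF v \<rho>]
      using calc_scalar[OF \<alpha> _ v, of r "calc \<alpha> ((*) r) \<rho> 1"] r \<rho>_v_char[OF r]
      by (simp add: mult.commute)
    ultimately show ?thesis
      by (simp add: S.calc_mult_one_minus[OF weighted_l1_unit_seq] calc_unit_seq)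
  qed
  then show "star \<alpha> \<rho> v = mult_one_minus \<alpha> unit_seq" "star \<alpha> v \<rho> = mult_one_minus \<alpha> unit_seq"
    by (auto intro!: calc_scalar_inject[OF \<alpha>] weighted_l1_star weighted_l1_mult_one_minus
        weighted_l1_unit_seq \<alpha> v \<rho>)
qed

lemma star_mult_one_minus: "star \<alpha> (mult_one_minus \<alpha> (u_trunc N)) v = mult_one_minus \<alpha> (w N)"
proof (rule calc_scalar_inject[OF \<alpha>])
  show m: "weighted_l1 \<alpha> (star \<alpha> (mult_one_minus \<alpha> (u_trunc N)) v)"
    "weighted_l1 \<alpha> (mult_one_minus \<alpha> (w N))"
    by (intro weighted_l1_star weighted_l1_mult_one_minus weighted_l1_u_trunc weighted_l1_w \<alpha> v)+
  fix r :: real assume r: "\<bar>r\<bar> < 1"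
  interpret S: cesaro_operator \<alpha> "(*) r" 1 using \<alpha> r by (intro cesaro_operator_scalar) auto
  show "calc \<alpha> ((*) r) (star \<alpha> (mult_one_minus \<alpha> (u_trunc N)) v) 1 =
      calc \<alpha> ((*) r) (mult_one_minus \<alpha> (w N)) 1"
    unfolding S.calc_star[OF weighted_l1_mult_one_minus[OF \<alpha> weighted_l1_u_trunc] v]
      S.calc_mult_one_minus[OF weighted_l1_u_trunc] S.calc_mult_one_minus[OF weighted_l1_w]
    by (simp add: w_def S.calc_star[OF weighted_l1_u_trunc v])
qed

text \<open>The element (1 - z)F_N - (1 - z)F.\<close>

definition err :: "nat \<Rightarrow> nat \<Rightarrow> real"
  where "err N n = mult_one_minus \<alpha> (u_trunc N) n - \<rho> n"

lemma weighted_l1_err: "weighted_l1 \<alpha> (err N)"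
  unfolding err_def[abs_def]
  by (intro weighted_l1_diff weighted_l1_mult_one_minus weighted_l1_u_trunc \<rho> \<alpha>)

text \<open>Up to index N the truncation is invisible and the error is 0; at the cut, index N + 1,
  it is - u (N + 1), and beyond it - \<rho>. The cut is where the decay of u against the weight is
  used.\<close>

lemma err_Suc_dominated:
  "\<bar>err N (Suc m)\<bar> * K (Suc m) \<le>
    (if m = N then u (Suc N) * K (Suc N) else 0) + (if N \<le> m then \<bar>\<rho> (Suc m)\<bar> * K (Suc m) else 0)"
proof (cases m N rule: linorder_cases)
  case less
  then show ?thesis by (simp add: err_def u_trunc_def \<rho>_Suc)
next
  case equal
  then show ?thesis
    using K_nonneg[of "Suc N"] u_nonneg[of "Suc N"] by (simp add: err_def u_trunc_def \<rho>_Suc)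
next
  case greater
  then show ?thesis by (simp add: err_def u_trunc_def)
qed

lemma err_tail_tendsto: "(\<lambda>N. \<Sum>m. \<bar>err N (Suc m)\<bar> * K (Suc m)) \<longlonglongrightarrow> 0"
proof -
  let ?h = "\<lambda>m. \<bar>\<rho> (Suc m)\<bar> * K (Suc m)"
  have h: "summable ?h"
    using \<rho> unfolding weighted_l1_def by (subst (asm) summable_Suc_iff[symmetric])
  have le: "norm (\<Sum>m. \<bar>err N (Suc m)\<bar> * K (Suc m)) \<le> u (Suc N) * K (Suc N) + (\<Sum>m. ?h (m + N))" for N
  proof -
    have s: "summable (\<lambda>m. \<bar>err N (Suc m)\<bar> * K (Suc m))"
      using weighted_l1_err[of N] unfolding weighted_l1_def by (subst (asm) summable_Suc_iff[symmetric])
    have "(\<lambda>m. if N \<le> m + N then ?h (m + N) else 0) sums (\<Sum>m. ?h (m + N))"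
      using summable_ignore_initial_segment[OF h, of N] by (simp add: summable_sums)
    then have t: "(\<lambda>m. if N \<le> m then ?h m else 0) sums (\<Sum>m. ?h (m + N))"
      by (subst (asm) sums_iff_shift) simp
    have "(\<lambda>m. (if m = N then u (Suc N) * K (Suc N) else 0) + (if N \<le> m then ?h m else 0)) sums
        (u (Suc N) * K (Suc N) + (\<Sum>m. ?h (m + N)))"
      by (rule sums_add[OF sums_single t])
    then have "(\<Sum>m. \<bar>err N (Suc m)\<bar> * K (Suc m)) \<le> u (Suc N) * K (Suc N) + (\<Sum>m. ?h (m + N))"
      using suminf_le[OF err_Suc_dominated s] by (simp add: sums_iff)
    moreover have "(\<Sum>m. \<bar>err N (Suc m)\<bar> * K (Suc m)) \<ge> 0"
      using K_nonneg by (intro suminf_nonneg[OF s]) simp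
    ultimately show ?thesis by simp
  qed
  have "(\<lambda>N. u (Suc N) * K (Suc N) + (\<Sum>m. ?h (m + N))) \<longlonglongrightarrow> 0 + 0"
  proof (rule tendsto_add)
    show "(\<lambda>N. u (Suc N) * K (Suc N)) \<longlonglongrightarrow> 0"
      using u_tendsto by (rule LIMSEQ_Suc)
    show "(\<lambda>N. \<Sum>m. ?h (m + N)) \<longlonglongrightarrow> 0"
      by (rule suminf_exist_split2[OF h])
  qed
  then show ?thesis
    unfolding add_0 by (rule Lim_null_comparison[rotated]) (use le in simp)
qed

text \<open>The zeroth coefficient contains an infinite series and is not estimated directly.
  Evaluation at r = 0, where the n-th Cesaro sum is k^\<alpha>(n), expresses it by the tail and the
  difference between a partial sum of \<open>u_sums\<close> and c. Hence the tail occurs twice in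
  the bound.\<close>

lemma err_tendsto: "(\<lambda>N. weighted_norm \<alpha> (err N)) \<longlonglongrightarrow> 0"
proof -
  let ?t = "\<lambda>N. \<Sum>m. \<bar>err N (Suc m)\<bar> * K (Suc m)"
  let ?p = "\<lambda>N. (\<Sum>n\<le>N. u n * cesaro_k \<alpha> n) - c"
  have kK: "cesaro_k \<alpha> n \<le> K n" "cesaro_k \<alpha> n \<ge> 0" for n
    using \<alpha> by (simp_all add: cesaro_k_le_Suc_param cesaro_k_nonneg)
  have le: "norm (weighted_norm \<alpha> (err N)) \<le> \<bar>?p N\<bar> + 2 * ?t N" for N
  proof -
    interpret S: cesaro_operator \<alpha> "(*) (0::real)" 1 using \<alpha> by (intro cesaro_operator_scalar) auto
    have D0: "cesaro_sum \<alpha> ((*) 0) n (1::real) = cesaro_k \<alpha> n" for n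
    proof -
      have "(\<Sum>j\<le>n. cesaro_k \<alpha> (n - j) * 0 ^ j) = (\<Sum>j\<le>n. if j = 0 then cesaro_k \<alpha> n else 0)"
        by (rule sum.cong) auto
      then show ?thesis by (simp add: cesaro_sum_scalar)
    qed
    have s: "summable (\<lambda>m. \<bar>err N (Suc m)\<bar> * K (Suc m))"
      using weighted_l1_err[of N] unfolding weighted_l1_def by (subst (asm) summable_Suc_iff[symmetric])
    have "calc \<alpha> ((*) 0) (err N) 1 =
        calc \<alpha> ((*) 0) (mult_one_minus \<alpha> (u_trunc N)) 1 - calc \<alpha> ((*) 0) \<rho> (1::real)"
      unfolding err_def[abs_def]
      by (intro S.calc_diff weighted_l1_mult_one_minus weighted_l1_u_trunc \<rho> \<alpha>)
    also have "calc \<alpha> ((*) 0) (mult_one_minus \<alpha> (u_trunc N)) (1::real) = (\<Sum>n\<le>N. u n * cesaro_k \<alpha> n)"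
      using S.calc_mult_one_minus[OF weighted_l1_u_trunc, of N 1]
        calc_finite[of N "u_trunc N" \<alpha> "(*) 0" "1::real"]
      by (simp add: u_trunc_def D0)
    also have "calc \<alpha> ((*) 0) \<rho> (1::real) = c"
      using \<rho>_sums by (simp add: calc_def D0 sums_iff)
    finally have "?p N = (\<Sum>n. err N n * cesaro_k \<alpha> n)"
      by (simp only: calc_def D0 real_scaleR_def)
    also have "\<dots> = err N 0 + (\<Sum>m. err N (Suc m) * cesaro_k \<alpha> (Suc m))"
      using suminf_split_head[OF S.summable_calc[OF weighted_l1_err, of N 1]] unfolding D0 by simp
    finally have e0: "err N 0 = ?p N - (\<Sum>m. err N (Suc m) * cesaro_k \<alpha> (Suc m))" by simp
    have dom: "norm (err N (Suc m) * cesaro_k \<alpha> (Suc m)) \<le> \<bar>err N (Suc m)\<bar> * K (Suc m)" for m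
      using mult_left_mono[OF kK(1)[of "Suc m"], of "\<bar>err N (Suc m)\<bar>"] kK(2)[of "Suc m"]
      by (simp add: abs_mult)
    have ns: "summable (\<lambda>m. norm (err N (Suc m) * cesaro_k \<alpha> (Suc m)))"
      by (rule summable_comparison_test'[OF s, of 0]) (use dom in simp)
    have "\<bar>\<Sum>m. err N (Suc m) * cesaro_k \<alpha> (Suc m)\<bar> \<le> ?t N"
      using summable_norm[OF ns] suminf_le[OF dom ns s] by simp
    then have "\<bar>err N 0\<bar> \<le> \<bar>?p N\<bar> + ?t N" using e0 by linarith
    moreover have "weighted_norm \<alpha> (err N) = \<bar>err N 0\<bar> + ?t N"
      using suminf_split_head[OF weighted_l1_err[of N, unfolded weighted_l1_def]]
      by (simp add: weighted_norm_def)
    ultimately show ?thesis using weighted_norm_nonneg[OF \<alpha> weighted_l1_err, of N] by simp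
  qed
  have "(\<lambda>N. \<bar>?p N\<bar> + 2 * ?t N) \<longlonglongrightarrow> \<bar>c - c\<bar> + 2 * 0"
    using u_sums by (intro tendsto_intros err_tail_tendsto) (simp add: sums_def_le)
  then have "(\<lambda>N. \<bar>?p N\<bar> + 2 * ?t N) \<longlonglongrightarrow> 0" by simp
  then show ?thesis
    by (rule Lim_null_comparison[rotated]) (use le in simp)
qed

text \<open>Since \<rho> times v is 1 - z, this difference is the product of the error with
  v.\<close>

lemma mult_one_minus_w_tendsto:
  "(\<lambda>N. weighted_norm \<alpha> (\<lambda>n. mult_one_minus \<alpha> (w N) n - mult_one_minus \<alpha> unit_seq n)) \<longlonglongrightarrow> 0"
proof -
  have eq: "(\<lambda>n. mult_one_minus \<alpha> (w N) n - mult_one_minus \<alpha> unit_seq n) = star \<alpha> (err N) v" for N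
  proof
    fix n
    have "mult_one_minus \<alpha> (w N) n - mult_one_minus \<alpha> unit_seq n =
        star \<alpha> (mult_one_minus \<alpha> (u_trunc N)) v n - star \<alpha> \<rho> v n"
      by (simp add: star_mult_one_minus star_\<rho>_v)
    also have "\<dots> = star \<alpha> (err N) v n"
      unfolding star_def
      by (subst suminf_diff[OF summable_star summable_star])
        (simp_all add: \<alpha> v \<rho> weighted_l1_mult_one_minus weighted_l1_u_trunc err_def left_diff_distrib)
    finally show "mult_one_minus \<alpha> (w N) n - mult_one_minus \<alpha> unit_seq n = star \<alpha> (err N) v n" .
  qed
  have "(\<lambda>N. 2 * exp \<alpha> * weighted_norm \<alpha> v * weighted_norm \<alpha> (err N)) \<longlonglongrightarrow> 0"
    by (rule tendsto_mult_right_zero[OF err_tendsto])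
  then show ?thesis
    unfolding eq
  proof (rule Lim_null_comparison[rotated])
    show "\<forall>\<^sub>F N in sequentially. norm (weighted_norm \<alpha> (star \<alpha> (err N) v))
        \<le> 2 * exp \<alpha> * weighted_norm \<alpha> v * weighted_norm \<alpha> (err N)"
      using weighted_norm_star[OF \<alpha> v weighted_l1_err]
        weighted_norm_nonneg[OF \<alpha> weighted_l1_star[OF \<alpha> v weighted_l1_err]] by simp
  qed
qed

text \<open>Norm convergence is lost on dividing by 1 - z. However, the coefficients of F_N/F - 1
  form a null sequence in n, and their variation is controlled by the norm of (1 - z)(F_N/F -
  1).\<close>

lemma w_tendsto: "(\<lambda>N. w N n) \<longlonglongrightarrow> unit_seq n"
proof -
  let ?d = "\<lambda>N n. mult_one_minus \<alpha> (w N) n - mult_one_minus \<alpha> unit_seq n"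
  have "norm (w N n - unit_seq n) \<le> weighted_norm \<alpha> (?d N)" for N
  proof -
    have z: "weighted_l1 \<alpha> (\<lambda>n. w N n - unit_seq n)"
      by (intro weighted_l1_diff \<alpha> weighted_l1_w weighted_l1_unit_seq)
    have d: "weighted_l1 \<alpha> (?d N)"
      by (intro weighted_l1_diff weighted_l1_mult_one_minus \<alpha> weighted_l1_w weighted_l1_unit_seq)
    have "(\<lambda>n. w N n - unit_seq n) \<longlonglongrightarrow> 0"
      using summable_LIMSEQ_zero[OF weighted_l1_imp_summable_abs(1)[OF \<alpha> z]]
      by (rule tendsto_rabs_zero_cancel)
    then have "\<bar>w N n - unit_seq n\<bar> \<le> (\<Sum>n. \<bar>?d N n\<bar>)"
      by (rule le_suminf_abs_diff[OF _ weighted_l1_imp_summable_abs(1)[OF \<alpha> d]]) simp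
    also have "\<dots> \<le> weighted_norm \<alpha> (?d N)"
      by (rule weighted_l1_imp_summable_abs(2)[OF \<alpha> d])
    finally show ?thesis by simp
  qed
  then have "(\<lambda>N. w N n - unit_seq n) \<longlonglongrightarrow> 0"
    by (rule Lim_null_comparison[OF always_eventually[OF allI] mult_one_minus_w_tendsto])
  then show ?thesis by (rule LIM_zero_cancel)
qed

section \<open>Signs of the coefficients and the uniform bound for F_N/F\<close>

lemma w_eq: "w N n = (\<Sum>i\<le>N. u i * row \<alpha> v i n)"
proof -
  have "w N n = (\<Sum>i\<le>N. u_trunc N i * row \<alpha> v i n)"
    unfolding w_def star_def by (rule suminf_finite) (auto simp: u_trunc_def)
  then show ?thesis by (simp add: u_trunc_def)
qed

text \<open>Above i the bracket in \<open>prod_coeff\<close> is 0 or 1, and the term j = 0 vanishes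
  because n > i + 0; so v 0, the only value without a sign condition, does not enter.\<close>

lemma row_nonpos:
  assumes "i < n"
  shows "row \<alpha> v i n \<le> 0"
  unfolding row_def
proof (rule suminf_le_const[OF summable_row[OF \<alpha> v]])
  fix N
  show "(\<Sum>j<N. v j * prod_coeff \<alpha> i j n) \<le> 0"
  proof (rule sum_nonpos)
    fix j
    show "v j * prod_coeff \<alpha> i j n \<le> 0"
    proof (cases "j = 0 \<or> n < j")
      case True
      then show ?thesis using assms by (auto simp: prod_coeff_def)
    next
      case False
      have "prod_coeff \<alpha> i j n \<ge> 0"
        using assms False \<alpha> by (simp add: prod_coeff_def cesaro_k_nonneg)
      then show ?thesis using v_nonpos[of j] False by (simp add: mult_nonpos_nonneg)
    qed
  qed
qed

text \<open>Below i the bracket is 0 for j \<le> n, which removes v 0 again, and -1 for j > n, where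
  it meets v j \<le> 0.\<close>

lemma row_nonneg:
  assumes "n < i"
  shows "row \<alpha> v i n \<ge> 0"
  unfolding row_def
proof (rule suminf_nonneg[OF summable_row[OF \<alpha> v]])
  fix j
  show "v j * prod_coeff \<alpha> i j n \<ge> 0"
  proof (cases "n < j")
    case True
    have "prod_coeff \<alpha> i j n \<le> 0"
      using assms True \<alpha> by (simp add: prod_coeff_def cesaro_k_nonneg)
    then show ?thesis using v_nonpos[of j] True by (simp add: mult_nonpos_nonpos)
  next
    case False
    then show ?thesis using assms by (simp add: prod_coeff_def)
  qed
qed

lemma w_nonpos: "N < n \<Longrightarrow> w N n \<le> 0"
  unfolding w_eq
  by (intro sum_nonpos mult_nonneg_nonpos u_nonneg row_nonpos) auto

text \<open>For N \<ge> n every further row i > n adds a nonnegative amount to the n-th coefficient,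
  so it increases to its limit \<open>unit_seq n\<close>. For N < n all rows contribute nonpositive
  amounts.\<close>

lemma w_le_unit_seq: "w N n \<le> unit_seq n"
proof (cases "N < n")
  case True
  then show ?thesis using w_nonpos[OF True] by (simp add: unit_seq_def)
next
  case False
  have "incseq (\<lambda>m. w (m + N) n)"
  proof (rule incseq_SucI)
    fix m
    have "u (Suc (m + N)) * row \<alpha> v (Suc (m + N)) n \<ge> 0"
      using False by (intro mult_nonneg_nonneg u_nonneg row_nonneg) auto
    then show "w (m + N) n \<le> w (Suc m + N) n" by (simp add: w_eq)
  qed
  moreover have "(\<lambda>m. w (m + N) n) \<longlonglongrightarrow> unit_seq n"
    using w_tendsto by (rule LIMSEQ_ignore_initial_segment)
  ultimately show ?thesis using incseq_le[of "\<lambda>m. w (m + N) n" "unit_seq n" 0] by simp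
qed

text \<open>An Abel argument: for r < 1 the terms beyond a partial sum are nonpositive, so the
  partial sum is at least the value at r, hence nonnegative. It is a polynomial in r, so r may tend
  to 1 before its length grows.\<close>

lemma calc_one_v_nonneg: "calc \<alpha> ((*) 1) v (1::real) \<ge> 0"
proof -
  interpret S1: cesaro_operator \<alpha> "(*) (1::real)" 1 using \<alpha> by (intro cesaro_operator_scalar) auto
  let ?D = "\<lambda>r n. cesaro_sum \<alpha> ((*) r) n (1::real)"
  \<comment> \<open>The length \<open>Suc R\<close> keeps the term n = 0 inside, so that the
    remainder consists of nonpositive terms.\<close>
  have "(\<Sum>n<Suc R. v n * ?D 1 n) \<ge> 0" for R
  proof -
    let ?p = "\<lambda>r. \<Sum>n<Suc R. v n * ?D r n"
    have pos: "?p r \<ge> 0" if r: "0 \<le> r" "r < 1" for r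
    proof -
      interpret S: cesaro_operator \<alpha> "(*) r" 1 using \<alpha> r by (intro cesaro_operator_scalar) auto
      note s = S.summable_calc[OF v, of 1]
      have "0 \<le> calc \<alpha> ((*) r) v 1" using v_char r by simp
      also have "\<dots> = (\<Sum>n. v (n + Suc R) *\<^sub>R ?D r (n + Suc R)) + ?p r"
        using suminf_split_initial_segment[OF s, of "Suc R"] by (simp add: calc_def)
      also have "(\<Sum>n. v (n + Suc R) *\<^sub>R ?D r (n + Suc R)) \<le> 0"
      proof (rule suminf_le_const[OF summable_ignore_initial_segment[OF s]])
        have "?D r m \<ge> 0" for m
          using r \<alpha> by (auto simp: cesaro_sum_scalar cesaro_k_nonneg intro!: sum_nonneg)
        then show "(\<Sum>n<m. v (n + Suc R) *\<^sub>R ?D r (n + Suc R)) \<le> 0" for m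
          using v_nonpos by (intro sum_nonpos) (simp add: mult_nonpos_nonneg)
      qed
      finally show ?thesis by simp
    qed
    have "continuous_on UNIV ?p"
      unfolding cesaro_sum_scalar by (intro continuous_intros)
    then have "(?p \<longlongrightarrow> ?p 1) (at_left 1)"
      by (simp add: continuous_on_def filterlim_at_split)
    moreover have "eventually (\<lambda>r. ?p r \<ge> 0) (at_left 1)"
      unfolding eventually_at_left_field by (rule exI[of _ 0]) (use pos in auto)
    ultimately show ?thesis
      by (intro tendsto_lowerbound[of ?p _ "at_left 1"]) auto
  qed
  moreover have "(\<lambda>R. \<Sum>n<Suc R. v n * ?D 1 n) \<longlonglongrightarrow> calc \<alpha> ((*) 1) v 1"
    using LIMSEQ_Suc[OF summable_LIMSEQ[OF S1.summable_calc[OF v, of 1]]] by (simp add: calc_def)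
  ultimately show ?thesis by (intro LIMSEQ_le_const) auto
qed

text \<open>All coefficients of \<open>w N\<close> but the zeroth are nonpositive and its total mass, being the value
  of the character at \<open>1\<close>, is nonnegative.\<close>

lemma weighted_norm_w: "weighted_norm \<alpha> (w N) \<le> 2"
proof -
  interpret S: cesaro_operator \<alpha> "(*) (1::real)" 1 using \<alpha> by (intro cesaro_operator_scalar) auto
  have "calc \<alpha> ((*) 1) (u_trunc N) (1::real) \<ge> 0"
    using calc_finite[of N "u_trunc N" \<alpha> "(*) 1" "1::real"] u_nonneg K_nonneg
    by (auto simp: u_trunc_def cesaro_sum_scalar_one intro!: sum_nonneg)
  then have "calc \<alpha> ((*) 1) (w N) (1::real) \<ge> 0"
    using calc_one_v_nonneg
      calc_scalar[OF \<alpha> _ weighted_l1_u_trunc, of 1 N "calc \<alpha> ((*) 1) v 1"]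
    unfolding w_def S.calc_star[OF weighted_l1_u_trunc v] by simp
  then have mass: "(\<Sum>n. w N n * K n) \<ge> 0" by (simp add: calc_def cesaro_sum_scalar_one)
  have s: "summable (\<lambda>n. w N n * K n)"
    using S.summable_calc[OF weighted_l1_w, of N 1] by (simp add: cesaro_sum_scalar_one)
  have "(\<lambda>n. if n = 0 then \<bar>w N 0\<bar> + w N 0 else 0) sums (\<bar>w N 0\<bar> + w N 0)"
    using sums_single[of 0 "\<lambda>_. \<bar>w N 0\<bar> + w N 0"] by simp
  then have "(\<lambda>n. (if n = 0 then \<bar>w N 0\<bar> + w N 0 else 0) - w N n * K n) sums
      (\<bar>w N 0\<bar> + w N 0 - (\<Sum>n. w N n * K n))"
    using s by (intro sums_diff summable_sums)
  moreover have "(if n = 0 then \<bar>w N 0\<bar> + w N 0 else 0) - w N n * K n = \<bar>w N n\<bar> * K n" for n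
    using w_le_unit_seq[of N n] by (auto simp: unit_seq_def abs_of_nonpos)
  ultimately have "weighted_norm \<alpha> (w N) = \<bar>w N 0\<bar> + w N 0 - (\<Sum>n. w N n * K n)"
    by (simp add: weighted_norm_def sums_iff)
  \<comment> \<open>The sum of a number and its absolute value is 0 or twice the number; with w N 0
    \<le> 1 this is where the bound 2 comes from.\<close>
  then show ?thesis using mass w_le_unit_seq[of N 0] by (simp add: unit_seq_def abs_if split: if_splits)
qed

end

section \<open>Convergence of the partial sums for the operator\<close>

locale admissible_pair_operator = admissible_pair \<alpha> u v \<rho> c + cesaro_operator \<alpha> T M
  for \<alpha> u v \<rho> c and T :: "'a::banach \<Rightarrow> 'a" and M +
  assumes dense: "closure (range (\<lambda>y. y - T y)) = UNIV"
begin

lemma regularised_partial_sums_tendsto: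
  "(\<lambda>N. calc \<alpha> T (u_trunc N) x - T (calc \<alpha> T (u_trunc N) x)) \<longlonglongrightarrow> calc \<alpha> T \<rho> x"
proof -
  have "norm (calc \<alpha> T (u_trunc N) x - T (calc \<alpha> T (u_trunc N) x) - calc \<alpha> T \<rho> x)
      \<le> M * norm x * weighted_norm \<alpha> (err N)" for N
  proof -
    have "calc \<alpha> T (err N) x =
        calc \<alpha> T (u_trunc N) x - T (calc \<alpha> T (u_trunc N) x) - calc \<alpha> T \<rho> x"
      unfolding err_def[abs_def]
      by (subst calc_diff) (simp_all add: weighted_l1_mult_one_minus \<alpha> weighted_l1_u_trunc \<rho>
          calc_mult_one_minus)
    then show ?thesis using norm_calc[OF weighted_l1_err, of N x] by (simp add: mult_ac)
  qed
  then have "(\<lambda>N. calc \<alpha> T (u_trunc N) x - T (calc \<alpha> T (u_trunc N) x) - calc \<alpha> T \<rho> x) \<longlonglongrightarrow> 0"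
    by (rule Lim_null_comparison[OF always_eventually[OF allI] tendsto_mult_right_zero[OF err_tendsto, of "M * norm x"]])
  then show ?thesis by (rule LIM_zero_cancel)
qed

lemma calc_w_tendsto: "(\<lambda>N. calc \<alpha> T (w N) y) \<longlonglongrightarrow> y"
proof -
  \<comment> \<open>The absolute value covers the zero space, where the Cesaro bound does not force
    M \<ge> 0.\<close>
  have bnd: "norm (calc \<alpha> T (w N) z) \<le> 2 * \<bar>M\<bar> * norm z" for N z
  proof -
    have "norm (calc \<alpha> T (w N) z) \<le> M * weighted_norm \<alpha> (w N) * norm z"
      by (rule norm_calc[OF weighted_l1_w])
    also have "\<dots> \<le> \<bar>M\<bar> * 2 * norm z"
      using weighted_norm_w[of N] weighted_norm_nonneg[OF \<alpha> weighted_l1_w, of N]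
      by (intro mult_right_mono mult_mono) auto
    finally show ?thesis by simp
  qed
  have range: "(\<lambda>N. calc \<alpha> T (w N) (s - T s)) \<longlonglongrightarrow> s - T s" for s
  proof -
    let ?d = "\<lambda>N n. mult_one_minus \<alpha> (w N) n - mult_one_minus \<alpha> unit_seq n"
    have "norm (calc \<alpha> T (w N) (s - T s) - (s - T s)) \<le> M * norm s * weighted_norm \<alpha> (?d N)" for N
    proof -
      interpret L: bounded_linear "calc \<alpha> T (w N)" by (rule bounded_linear_calc[OF weighted_l1_w])
      have d: "weighted_l1 \<alpha> (?d N)"
        by (intro weighted_l1_diff weighted_l1_mult_one_minus \<alpha> weighted_l1_w weighted_l1_unit_seq)
      have "calc \<alpha> T (?d N) s = calc \<alpha> T (w N) s - T (calc \<alpha> T (w N) s) - (s - T s)"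
        by (subst calc_diff) (simp_all add: weighted_l1_mult_one_minus \<alpha> weighted_l1_w
            weighted_l1_unit_seq calc_mult_one_minus calc_unit_seq)
      moreover have "calc \<alpha> T (w N) (s - T s) = calc \<alpha> T (w N) s - T (calc \<alpha> T (w N) s)"
        by (simp add: L.diff calc_commute[OF weighted_l1_w])
      ultimately show ?thesis using norm_calc[OF d, of s] by (simp add: mult_ac)
    qed
    then have "(\<lambda>N. calc \<alpha> T (w N) (s - T s) - (s - T s)) \<longlonglongrightarrow> 0"
      by (rule Lim_null_comparison[OF always_eventually[OF allI] tendsto_mult_right_zero[OF mult_one_minus_w_tendsto,
            of "M * norm s"]])
    then show ?thesis by (rule LIM_zero_cancel)
  qed
  show ?thesis
  proof (rule LIMSEQ_I)
    fix e :: real assume e: "e > 0"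
    \<comment> \<open>The share 2 \<bar>M\<bar> comes from applying F_N/F to y - ?z, the share 1
      from the remaining ?z - y.\<close>
    define C where "C = 2 * \<bar>M\<bar> + 1"
    have C: "C > 0" by (simp add: C_def)
    have "y \<in> closure (range (\<lambda>y. y - T y))" using dense by simp
    then obtain s where s: "dist (s - T s) y < e / (2 * C)"
      unfolding closure_approachable using e C by (metis (no_types, lifting) divide_pos_pos image_iff mult_pos_pos zero_less_numeral)
    let ?z = "s - T s"
    obtain N0 where N0: "\<And>N. N \<ge> N0 \<Longrightarrow> norm (calc \<alpha> T (w N) ?z - ?z) < e / 2"
      using LIMSEQ_D[OF range[of s], of "e / 2"] e by auto
    have "norm (calc \<alpha> T (w N) y - y) < e" if "N \<ge> N0" for N
    proof -
      interpret L: bounded_linear "calc \<alpha> T (w N)" by (rule bounded_linear_calc[OF weighted_l1_w])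
      have "calc \<alpha> T (w N) y - y = calc \<alpha> T (w N) (y - ?z) + (calc \<alpha> T (w N) ?z - ?z) + (?z - y)"
        by (simp add: L.diff)
      then have "norm (calc \<alpha> T (w N) y - y) \<le>
          norm (calc \<alpha> T (w N) (y - ?z)) + norm (calc \<alpha> T (w N) ?z - ?z) + norm (?z - y)"
        by (metis norm_triangle_ineq norm_triangle_le add_right_mono)
      also have "\<dots> < 2 * \<bar>M\<bar> * norm (y - ?z) + e / 2 + norm (?z - y)"
        using bnd[of N "y - ?z"] N0[OF that] by simp
      also have "\<dots> = C * norm (?z - y) + e / 2"
        by (simp add: C_def algebra_simps norm_minus_commute)
      also have "\<dots> \<le> C * (e / (2 * C)) + e / 2"
        using s C by (intro add_right_mono mult_left_mono) (auto simp: dist_norm)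
      also have "\<dots> = e" using C by simp
      finally show ?thesis .
    qed
    then show "\<exists>N0. \<forall>N\<ge>N0. norm (calc \<alpha> T (w N) y - y) < e" by blast
  qed
qed

text \<open>The partial sum and (F_N/F)(T)y agree after applying I - T: the latter becomes F_N(T)
  (1/F)(T) [(1 - z)F](T)x = F_N(T)(I - T)x. Injectivity removes I - T, with no reference to F(T) as
  a bounded operator.\<close>

lemma partial_sums_tendsto:
  assumes y: "y - T y = calc \<alpha> T \<rho> x"
  shows "(\<lambda>N. calc \<alpha> T (u_trunc N) x) \<longlonglongrightarrow> y"
proof -
  have "calc \<alpha> T (u_trunc N) x = calc \<alpha> T (w N) y" for N
  proof -
    interpret Lw: bounded_linear "calc \<alpha> T (w N)" by (rule bounded_linear_calc[OF weighted_l1_w])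
    interpret Lu: bounded_linear "calc \<alpha> T (u_trunc N)"
      by (rule bounded_linear_calc[OF weighted_l1_u_trunc])
    have "calc \<alpha> T (w N) y - T (calc \<alpha> T (w N) y) = calc \<alpha> T (w N) (calc \<alpha> T \<rho> x)"
      unfolding y[symmetric] Lw.diff calc_commute[OF weighted_l1_w] ..
    also have "\<dots> = calc \<alpha> T (u_trunc N) (calc \<alpha> T v (calc \<alpha> T \<rho> x))"
      unfolding w_def calc_star[OF weighted_l1_u_trunc v] ..
    also have "calc \<alpha> T v (calc \<alpha> T \<rho> x) = x - T x"
      unfolding calc_star[OF v \<rho>, symmetric] star_v_\<rho> calc_mult_one_minus[OF weighted_l1_unit_seq]
        calc_unit_seq ..
    also have "calc \<alpha> T (u_trunc N) (x - T x) = calc \<alpha> T (u_trunc N) x - T (calc \<alpha> T (u_trunc N) x)"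
      unfolding Lu.diff calc_commute[OF weighted_l1_u_trunc] ..
    finally have "(\<lambda>y. y - T y) (calc \<alpha> T (u_trunc N) x) = (\<lambda>y. y - T y) (calc \<alpha> T (w N) y)"
      by (rule sym)
    then show ?thesis by (rule injD[OF inj_one_minus[OF dense]])
  qed
  then show ?thesis using calc_w_tendsto by simp
qed

end

section \<open>Coefficients of admissible functions\<close>

lemma taylor_coeff_sums:
  assumes "F holomorphic_on ball 0 1" "cmod z < 1"
  shows "(\<lambda>n. taylor_coeff F n * z ^ n) sums F z"
  using holomorphic_power_series[OF assms(1), of z] assms(2) by (simp add: fps_expansion_def)

lemma taylor_coeff_unique:
  assumes "F holomorphic_on ball 0 1" "\<And>z. cmod z < 1 \<Longrightarrow> (\<lambda>n. f n * z ^ n) sums F z"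
  shows "taylor_coeff F = f"
  using taylor_coeff_sums[OF assms(1)] assms(2) by (rule power_series_unique)

lemma power_series_of_real:
  assumes "(\<lambda>n. complex_of_real (a n) * of_real r ^ n) sums z"
  shows "(\<lambda>n. a n * r ^ n) sums Re z" "z = of_real (Re z)"
proof -
  show "(\<lambda>n. a n * r ^ n) sums Re z"
    using sums_Re[OF assms] by (simp flip: of_real_power of_real_mult)
  then have "(\<lambda>n. complex_of_real (a n) * of_real r ^ n) sums of_real (Re z)"
    using sums_of_real[of "\<lambda>n. a n * r ^ n" "Re z", where 'a = complex] by simp
  then show "z = of_real (Re z)" using assms sums_unique2 by blast
qed

text \<open>The nonpositive remainder makes each partial sum at r at least the value of the series.
  As r tends to 1 the partial sums of g itself come out nonnegative, so their terms with n \<ge> 1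
  have total size at most g 0.\<close>

lemma summable_abs_of_nonneg_power_series:
  fixes g :: "nat \<Rightarrow> real"
  assumes nonpos: "\<And>n. n \<ge> 1 \<Longrightarrow> g n \<le> 0"
    and nonneg: "\<And>r. 0 \<le> r \<Longrightarrow> r < 1 \<Longrightarrow> \<exists>s\<ge>0. (\<lambda>n. g n * r ^ n) sums s"
  shows "summable (\<lambda>n. \<bar>g n\<bar>)"
proof (rule summableI_nonneg_bounded)
  fix R
  have sum_nonneg: "(\<Sum>n<Suc R. g n) \<ge> 0"
  proof -
    let ?p = "\<lambda>r. \<Sum>n<Suc R. g n * r ^ n"
    have pos: "?p r \<ge> 0" if r: "0 \<le> r" "r < 1" for r
    proof -
      obtain s where s: "s \<ge> 0" "(\<lambda>n. g n * r ^ n) sums s" using nonneg[OF r] by blast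
      have "g (n + Suc R) * r ^ (n + Suc R) \<le> 0" for n
        using nonpos[of "n + Suc R"] r by (intro mult_nonpos_nonneg) auto
      then have "s - ?p r \<le> 0"
        by (rule sums_le[OF _ sums_split_initial_segment[OF s(2)] sums_zero])
      then show ?thesis using s(1) by simp
    qed
    have "(?p \<longlongrightarrow> ?p 1) (at_left 1)"
      by (intro tendsto_intros)
    moreover have "eventually (\<lambda>r. ?p r \<ge> 0) (at_left 1)"
      unfolding eventually_at_left_field by (rule exI[of _ 0]) (use pos in auto)
    ultimately have "?p 1 \<ge> 0"
      by (intro tendsto_lowerbound[of ?p _ "at_left 1"]) auto
    then show ?thesis by simp
  qed
  have "(\<Sum>n<R. \<bar>g n\<bar>) \<le> (\<Sum>n<Suc R. \<bar>g n\<bar>)" by simp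
  also have "\<dots> = (\<Sum>n<Suc R. (if n = 0 then \<bar>g 0\<bar> + g 0 else 0) - g n)"
    using nonpos by (intro sum.cong) (auto simp: abs_of_nonpos)
  also have "\<dots> = \<bar>g 0\<bar> + g 0 - (\<Sum>n<Suc R. g n)"
    unfolding sum_subtractf by (subst sum.delta) auto
  also have "\<dots> \<le> \<bar>g 0\<bar> + g 0" using sum_nonneg by simp
  finally show "(\<Sum>n<R. \<bar>g n\<bar>) \<le> \<bar>g 0\<bar> + g 0" .
qed simp

lemma weyl_rep_unique:
  assumes "\<alpha> > 0" "weyl_rep \<alpha> h a" "weyl_rep \<alpha> h b"
  shows "a = b"
proof
  fix n
  have "summable (\<lambda>n. norm (a n) * cesaro_k (\<alpha> + 1) n)" "frac_series \<alpha> a = h"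
    "summable (\<lambda>n. norm (b n) * cesaro_k (\<alpha> + 1) n)" "frac_series \<alpha> b = h"
    using assms(2,3) by (auto simp: weyl_rep_def frac_sum_eq_frac_series)
  then show "a n = b n"
    using frac_series_inverse[OF assms(1), of a n] frac_series_inverse[OF assms(1), of b n]
      sums_unique2 by metis
qed

lemma weyl_coeff_eqI:
  assumes "\<alpha> > 0" "weyl_rep \<alpha> (taylor_coeff H) a"
  shows "weyl_coeff \<alpha> H = a"
  unfolding weyl_coeff_def using assms weyl_rep_unique by blast

lemma nonneg_Reals_eq: "z \<in> \<real>\<^sub>\<ge>\<^sub>0 \<Longrightarrow> z = of_real (Re z) \<and> Re z \<ge> 0"
  by (auto simp: complex_nonneg_Reals_iff complex_eq_iff)

lemma nonpos_Reals_eq: "z \<in> \<real>\<^sub>\<le>\<^sub>0 \<Longrightarrow> z = of_real (Re z) \<and> Re z \<le> 0"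
  by (auto simp: complex_nonpos_Reals_iff complex_eq_iff)

text \<open>The case \<beta> = 0 of admissibility makes f nonnegative and g nonpositive from index 1
  on. Thus 1/F is nonnegative on [0,1) and g is summable; with this the Weyl difference of g becomes
  a single series, to which \<open>weyl_difference_inverse\<close> applies.\<close>

lemma admissible_imp_pair:
  assumes \<alpha>: "\<alpha> > 0"
    and f_sums: "\<And>z. z \<in> ball 0 1 \<Longrightarrow> (\<lambda>n. f n * z ^ n) sums F z"
    and adm: "admissible \<alpha> F"
    and alg: "(\<lambda>z. (1 - z) * F z) \<in> disc_algebra \<alpha>"
    and lim: "(\<lambda>j. frac_diff \<alpha> f j * complex_of_real (real j powr \<alpha>)) \<longlonglongrightarrow> 0"
  obtains u v \<rho> c where "admissible_pair \<alpha> u v \<rho> c"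
    "\<And>n. frac_diff \<alpha> f n = of_real (u n)"
    "\<And>n. weyl_coeff \<alpha> (\<lambda>z. (1 - z) * F z) n = of_real (\<rho> n)"
proof -
  define G where "G = (\<lambda>z. 1 / F z)"
  define g where "g = taylor_coeff G"
  define H where "H = (\<lambda>z. (1 - z) * F z)"
  define h where "h = taylor_coeff H"
  have holF: "F holomorphic_on ball 0 1" and F0: "\<And>z. cmod z < 1 \<Longrightarrow> F z \<noteq> 0"
    using adm by (auto simp: admissible_def)
  have f_sums': "(\<lambda>n. f n * z ^ n) sums F z" if "cmod z < 1" for z
    using f_sums that by simp
  have tf: "taylor_coeff F = f" by (rule taylor_coeff_unique[OF holF f_sums'])
  have adm_f: "frac_diff_exists \<beta> f" "frac_diff \<beta> f n \<in> \<real>\<^sub>\<ge>\<^sub>0"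
      "frac_sum_exists \<beta> (frac_diff \<beta> f)" "frac_sum \<beta> (frac_diff \<beta> f) = f"
    if "\<beta> \<in> {0, \<alpha>}" for \<beta> n
    using adm that unfolding admissible_def tf Let_def by blast+
  have adm_g: "weyl_diff \<beta> g n \<in> \<real>\<^sub>\<le>\<^sub>0" if "\<beta> \<in> {0, \<alpha>}" "n \<ge> 1" for \<beta> n
    using adm that unfolding admissible_def Let_def g_def G_def by blast
  have adm_g0: "weyl_diff \<beta> g 0 \<in> \<real>\<^sub>\<ge>\<^sub>0" if "\<beta> \<in> {0, \<alpha>}" for \<beta>
    using adm that unfolding admissible_def Let_def g_def G_def by blast

  define fr where "fr n = Re (f n)" for n
  define u where "u n = Re (frac_diff \<alpha> f n)" for n
  have fd0: "frac_diff 0 f = f" by (simp add: frac_diff_eq_frac_series frac_series_0)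
  have fr: "f n = of_real (fr n)" "fr n \<ge> 0" for n
    using nonneg_Reals_eq[OF adm_f(2)[of 0 n]] by (simp_all add: fd0 fr_def)
  have u: "frac_diff \<alpha> f n = of_real (u n)" "u n \<ge> 0" for n
    using nonneg_Reals_eq[OF adm_f(2)[of \<alpha> n]] by (simp_all add: u_def)
  have Fr: "(\<lambda>n. fr n * r ^ n) sums Re (F (of_real r))" "F (of_real r) = of_real (Re (F (of_real r)))"
    if "\<bar>r\<bar> < 1" for r
    using power_series_of_real[of fr r "F (of_real r)"] f_sums'[of "of_real r"] that
    by (auto simp: fr(1))

  have holG: "G holomorphic_on ball 0 1"
    unfolding G_def using F0 by (intro holomorphic_intros holF) auto
  define gr where "gr n = Re (g n)" for n
  have wd0: "weyl_diff 0 g = g" by (simp add: weyl_diff_def)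
  have gr: "g n = of_real (gr n)" for n
    using nonneg_Reals_eq[OF adm_g0[of 0]] nonpos_Reals_eq[OF adm_g[of 0 n]]
    by (cases "n = 0") (auto simp: wd0 gr_def)
  have gr_nonpos: "gr n \<le> 0" if "n \<ge> 1" for n
    using nonpos_Reals_eq[OF adm_g[of 0 n]] that by (simp add: wd0 gr_def)
  have Gr: "(\<lambda>n. gr n * r ^ n) sums (1 / Re (F (of_real r)))" if "\<bar>r\<bar> < 1" for r
  proof -
    have "(\<lambda>n. gr n * r ^ n) sums Re (G (of_real r))"
      using power_series_of_real(1)[of gr r "G (of_real r)"]
        taylor_coeff_sums[OF holG, of "of_real r"] that by (simp add: g_def[symmetric] gr)
    moreover have "G (of_real r) = of_real (1 / Re (F (of_real r)))"
      unfolding G_def by (subst Fr(2)[OF that]) simp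
    ultimately show ?thesis by simp
  qed
  have F_nonneg: "Re (F (of_real r)) \<ge> 0" if "0 \<le> r" "r < 1" for r
  proof (rule sums_le[OF _ sums_zero Fr(1)])
    show "0 \<le> fr n * r ^ n" for n using fr(2)[of n] that by simp
    show "\<bar>r\<bar> < 1" using that by simp
  qed
  have g_summable: "summable (\<lambda>n. \<bar>gr n\<bar>)"
  proof (rule summable_abs_of_nonneg_power_series[OF gr_nonpos])
    fix r :: real assume r: "0 \<le> r" "r < 1"
    have "(\<lambda>n. gr n * r ^ n) sums (1 / Re (F (of_real r)))" using r by (intro Gr) simp
    moreover have "1 / Re (F (of_real r)) \<ge> 0" using F_nonneg[OF r] by simp
    ultimately show "\<exists>s\<ge>0. (\<lambda>n. gr n * r ^ n) sums s" by blast
  qed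
  define v where "v = frac_series (- \<alpha>) gr"
  have wd: "weyl_diff \<alpha> g n = of_real (v n)" for n
  proof -
    have "summable (\<lambda>n. cmod (g n))" using g_summable by (simp add: gr)
    then have "weyl_diff \<alpha> g n = frac_series (- \<alpha>) g n"
      using \<alpha> by (simp add: weyl_diff_eq_frac_series)
    also have "\<dots> = frac_series (- \<alpha>) (\<lambda>n. of_real (gr n)) n"
      by (simp add: gr[abs_def])
    also have "\<dots> = of_real (v n)"
      unfolding v_def
    proof (rule frac_series_of_real)
      have "summable (\<lambda>i. norm (cesaro_k (- \<alpha>) i *\<^sub>R gr (n + i)))"
        by (rule norm_summable_frac_series_l1) (use \<alpha> g_summable in simp_all)
      from summable_norm_cancel[OF this] show "summable (\<lambda>i. cesaro_k (- \<alpha>) i * gr (n + i))"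
        by simp
    qed
    finally show ?thesis .
  qed
  have v_nonpos: "v n \<le> 0" if "n \<ge> 1" for n
    using nonpos_Reals_eq[OF adm_g[of \<alpha> n]] that wd by simp
  have v_l1: "weighted_l1 \<alpha> v" and v_inv: "frac_series \<alpha> v = gr"
    using weyl_difference_inverse[OF g_summable gr_nonpos \<alpha>] v_nonpos unfolding v_def by auto
  have v_calc: "calc \<alpha> ((*) r) v 1 = 1 / Re (F (of_real r))" if "\<bar>r\<bar> < 1" for r
    using calc_scalar_sums[OF \<alpha> v_l1 that] Gr[OF that] unfolding v_inv by (rule sums_unique2)

  have holH: "H holomorphic_on ball 0 1"
    unfolding H_def by (intro holomorphic_intros holF)
  have h: "h n = (case n of 0 \<Rightarrow> f 0 | Suc m \<Rightarrow> f (Suc m) - f m)" for n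
  proof -
    have "(\<lambda>n. (case n of 0 \<Rightarrow> f 0 | Suc m \<Rightarrow> f (Suc m) - f m) * z ^ n) sums H z"
      if z: "cmod z < 1" for z
    proof -
      have "(\<lambda>n. f (Suc n) * z ^ Suc n) sums (F z - f 0)"
        using f_sums'[OF z] by (subst sums_Suc_iff) simp
      moreover have "(\<lambda>n. z * (f n * z ^ n)) sums (z * F z)"
        by (rule sums_mult[OF f_sums'[OF z]])
      ultimately have "(\<lambda>n. f (Suc n) * z ^ Suc n - z * (f n * z ^ n)) sums (F z - f 0 - z * F z)"
        by (rule sums_diff)
      then have "(\<lambda>n. (f (Suc n) - f n) * z ^ Suc n) sums (H z - f 0)"
        by (simp add: H_def algebra_simps)
      from sums_Suc[of "\<lambda>n. (case n of 0 \<Rightarrow> f 0 | Suc m \<Rightarrow> f (Suc m) - f m) * z ^ n", simplified nat.case, OF this]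
      show ?thesis by simp
    qed
    then show ?thesis unfolding h_def by (subst taylor_coeff_unique[OF holH]) auto
  qed
  obtain \<rho>c where \<rho>c: "weyl_rep \<alpha> h \<rho>c"
    using alg unfolding disc_algebra_def h_def H_def by blast
  have \<rho>c_s: "summable (\<lambda>n. norm (\<rho>c n) * cesaro_k (\<alpha> + 1) n)" and \<rho>c_h: "frac_series \<alpha> \<rho>c = h"
    using \<rho>c by (auto simp: weyl_rep_def frac_sum_eq_frac_series)
  have \<rho>c_sums: "(\<lambda>j. cesaro_k (- \<alpha>) j *\<^sub>R h (n + j)) sums \<rho>c n" for n
    using frac_series_inverse[OF \<alpha> \<rho>c_s, of n] by (simp add: \<rho>c_h)
  \<comment> \<open>The inversion formula recovers \<open>\<rho>c\<close> from h with a real kernel,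
    so reality passes from h to \<open>\<rho>c\<close>.\<close>
  have h_real: "Im (h n) = 0" for n
    by (cases n) (simp_all add: h fr(1))
  define \<rho> where "\<rho> n = Re (\<rho>c n)" for n
  have \<rho>: "\<rho>c n = of_real (\<rho> n)" for n
  proof -
    have "(\<lambda>j. 0) sums Im (\<rho>c n)" using sums_Im[OF \<rho>c_sums[of n]] by (simp add: h_real)
    then have "Im (\<rho>c n) = 0" using sums_unique by fastforce
    then show ?thesis by (simp add: \<rho>_def complex_eq_iff)
  qed
  have \<rho>_l1: "weighted_l1 \<alpha> \<rho>" using \<rho>c_s by (simp add: weighted_l1_def \<rho>)
  have \<rho>_frac: "(\<lambda>i. cesaro_k \<alpha> i * \<rho> (n + i)) sums Re (h n)" for n
  proof -
    have "(\<lambda>i. cesaro_k \<alpha> i *\<^sub>R \<rho>c (n + i)) sums h n"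
      using summable_sums[OF summable_norm_cancel[OF norm_summable_frac_series[OF \<alpha> \<rho>c_s]], of n]
        \<rho>c_h by (simp add: frac_series_def fun_eq_iff)
    from sums_Re[OF this] show ?thesis by (simp add: \<rho>_def)
  qed
  have \<rho>_calc: "calc \<alpha> ((*) r) \<rho> 1 = (1 - r) * Re (F (of_real r))" if "\<bar>r\<bar> < 1" for r
  proof -
    have "frac_series \<alpha> \<rho> = (\<lambda>n. Re (h n))"
      using \<rho>_frac by (auto simp: frac_series_def sums_iff)
    then have s1: "(\<lambda>p. Re (h p) * r ^ p) sums calc \<alpha> ((*) r) \<rho> 1"
      using calc_scalar_sums[OF \<alpha> \<rho>_l1 that] by simp
    have hr: "h n = of_real (Re (h n))" for n using h_real[of n] by (simp add: complex_eq_iff)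
    have "(\<lambda>n. of_real (Re (h n)) * of_real r ^ n) sums H (of_real r)"
      using taylor_coeff_sums[OF holH, of "of_real r"] that hr by (simp add: h_def[symmetric])
    from power_series_of_real(1)[OF this] have "calc \<alpha> ((*) r) \<rho> 1 = Re (H (of_real r))"
      using s1 sums_unique2 by blast
    then show ?thesis by (simp add: H_def)
  qed
  \<comment> \<open>Subtracting the convergent series for D^\<alpha> f at n + 1 and n leaves the
    inversion series of h from n + 1 on. Index 0 is excluded because h 0 = f 0 is not a difference;
    it is tied to u by the two series with sum f 0.\<close>
  have \<rho>_Suc: "\<rho> (Suc n) = u (Suc n) - u n" for n
  proof -
    have fs: "(\<lambda>j. cesaro_k (- \<alpha>) j *\<^sub>R f (m + j)) sums frac_diff \<alpha> f m" for m
      using adm_f(1)[of \<alpha>] unfolding frac_diff_exists_def frac_diff_def scaleR_conv_of_real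
      by (simp add: summable_sums)
    have "(\<lambda>j. cesaro_k (- \<alpha>) j *\<^sub>R f (Suc n + j) - cesaro_k (- \<alpha>) j *\<^sub>R f (n + j)) sums
        (frac_diff \<alpha> f (Suc n) - frac_diff \<alpha> f n)"
      by (rule sums_diff[OF fs fs])
    then have "(\<lambda>j. cesaro_k (- \<alpha>) j *\<^sub>R h (Suc n + j)) sums (frac_diff \<alpha> f (Suc n) - frac_diff \<alpha> f n)"
      by (simp add: h scaleR_diff_right)
    then have "\<rho>c (Suc n) = frac_diff \<alpha> f (Suc n) - frac_diff \<alpha> f n"
      using \<rho>c_sums sums_unique2 by blast
    then show ?thesis by (simp add: \<rho>_def u_def)
  qed
  have u_sums: "(\<lambda>n. u n * cesaro_k \<alpha> n) sums fr 0"
  proof -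
    have "(\<lambda>i. complex_of_real (cesaro_k \<alpha> i) * frac_diff \<alpha> f (0 + i)) sums f 0"
    proof -
      have "summable (\<lambda>i. complex_of_real (cesaro_k \<alpha> i) * frac_diff \<alpha> f (0 + i))"
        using adm_f(3)[of \<alpha>] unfolding frac_sum_exists_def by blast
      moreover have "(\<Sum>i. complex_of_real (cesaro_k \<alpha> i) * frac_diff \<alpha> f (0 + i)) = f 0"
        using fun_cong[OF adm_f(4)[of \<alpha>], of 0] unfolding frac_sum_def by blast
      ultimately show ?thesis unfolding sums_iff by (rule conjI)
    qed
    from sums_Re[OF this] show ?thesis by (simp add: u_def fr_def mult.commute)
  qed
  have \<rho>_sums: "(\<lambda>n. \<rho> n * cesaro_k \<alpha> n) sums fr 0"
    using \<rho>_frac[of 0] by (simp add: h fr_def mult.commute)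
  have u_tendsto: "(\<lambda>n. u n * cesaro_k (\<alpha> + 1) n) \<longlonglongrightarrow> 0"
  proof -
    have "(\<lambda>j. u j * real j powr \<alpha>) \<longlonglongrightarrow> 0"
      using tendsto_Re[OF lim] by (simp add: u_def)
    then have l: "(\<lambda>j. (\<alpha> + 1) * (u (Suc j) * real (Suc j) powr \<alpha>)) \<longlonglongrightarrow> 0"
      by (intro tendsto_mult_right_zero LIMSEQ_Suc)
    have "norm (u (Suc n) * cesaro_k (\<alpha> + 1) (Suc n)) \<le> (\<alpha> + 1) * (u (Suc n) * real (Suc n) powr \<alpha>)" for n
      using mult_left_mono[OF cesaro_k_le_powr[OF \<alpha>, of n] u(2)[of "Suc n"]] u(2)[of "Suc n"]
        cesaro_k_nonneg[of "\<alpha> + 1" "Suc n"] \<alpha> by (simp add: abs_mult mult_ac)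
    then have "(\<lambda>n. u (Suc n) * cesaro_k (\<alpha> + 1) (Suc n)) \<longlonglongrightarrow> 0"
      by (rule Lim_null_comparison[OF always_eventually[OF allI] l])
    then show ?thesis by (rule LIMSEQ_imp_Suc)
  qed
  have "admissible_pair \<alpha> u v \<rho> (fr 0)"
  proof
    fix r :: real
    show "0 \<le> calc \<alpha> ((*) r) v 1" if "0 \<le> r" "r < 1"
      using v_calc[of r] F_nonneg[OF that] that by simp
    show "calc \<alpha> ((*) r) \<rho> 1 * calc \<alpha> ((*) r) v 1 = 1 - r" if "\<bar>r\<bar> < 1"
    proof -
      have "F (of_real r) \<noteq> 0" using F0 that by simp
      then have "Re (F (of_real r)) \<noteq> 0" using Fr(2)[OF that] by (metis of_real_0)
      then show ?thesis by (simp add: v_calc[OF that] \<rho>_calc[OF that])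
    qed
  qed (fact \<alpha> u(2) u_tendsto v_l1 v_nonpos \<rho>_l1 \<rho>_Suc u_sums \<rho>_sums)+
  moreover have "weyl_coeff \<alpha> (\<lambda>z. (1 - z) * F z) n = of_real (\<rho> n)" for n
    using weyl_coeff_eqI[OF \<alpha>, of H \<rho>c] \<rho>c \<rho> by (simp add: h_def H_def)
  ultimately show thesis using u(1) that by blast
qed

section \<open>The operator hypotheses and the equivalence\<close>

lemma bounded_linear_funpow:
  fixes T :: "'a::real_normed_vector \<Rightarrow> 'a"
  assumes "bounded_linear T"
  shows "bounded_linear (T ^^ n)"
proof (induction n)
  case 0
  show ?case by (simp add: id_def bounded_linear_ident)
next
  case (Suc n)
  then show ?case using bounded_linear_compose[OF assms, of "T ^^ n"] by (simp add: comp_def)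
qed

lemma cesaro_bounded_imp_operator:
  fixes T :: "'a::complex_banach \<Rightarrow> 'a"
  assumes "\<alpha> > 0" "cesaro_bounded \<alpha> T"
  obtains M where "cesaro_operator \<alpha> T M"
proof -
  have T: "bounded_linear T" using assms(2) by (simp add: cesaro_bounded_def bounded_clinear_def)
  obtain M where M: "\<And>n. onorm (cesaro_sum \<alpha> T n) / cesaro_k (\<alpha> + 1) n \<le> M"
    using assms(2) unfolding cesaro_bounded_def bdd_above_def by auto
  have "cesaro_operator \<alpha> T M"
  proof (rule cesaro_operator.intro[OF assms(1) T])
    fix n x
    have b: "bounded_linear (cesaro_sum \<alpha> T n)"
      unfolding cesaro_sum_def[abs_def]
      by (intro bounded_linear_sum bounded_linear_const_scaleR bounded_linear_funpow T)
    have "onorm (cesaro_sum \<alpha> T n) \<le> M * cesaro_k (\<alpha> + 1) n"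
      using M[of n] cesaro_k_pos[of "\<alpha> + 1" n] assms(1) by (simp add: field_simps)
    then show "norm (cesaro_sum \<alpha> T n x) \<le> M * cesaro_k (\<alpha> + 1) n * norm x"
      using onorm[OF b, of x] mult_right_mono[of _ _ "norm x"] order_trans norm_ge_zero by metis
  qed
  then show thesis by (rule that)
qed

theorem theorem3:
  fixes \<alpha> :: real
    and F :: "complex \<Rightarrow> complex"
    and f :: "nat \<Rightarrow> complex"
    and T :: "'a::complex_banach \<Rightarrow> 'a"
    and x :: 'a
  assumes "\<alpha> > 0"
    and "\<And>z. z \<in> ball 0 1 \<Longrightarrow> (\<lambda>n. f n * z ^ n) sums F z"
    and "admissible \<alpha> F"
    and "(\<lambda>z. (1 - z) * F z) \<in> disc_algebra \<alpha>"
    and "(\<lambda>j. frac_diff \<alpha> f j * complex_of_real (real j powr \<alpha>)) \<longlonglongrightarrow> 0"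
    and "cesaro_bounded \<alpha> T"
    and "closure (range (\<lambda>y. y - T y)) = UNIV"
  shows "(x \<in> reg_calc_dom \<alpha> T F \<longleftrightarrow>
            summable (\<lambda>j. frac_diff \<alpha> f j *\<^sub>C cesaro_sum \<alpha> T j x)) \<and>
         (summable (\<lambda>j. frac_diff \<alpha> f j *\<^sub>C cesaro_sum \<alpha> T j x) \<longleftrightarrow>
            weakly_summable (\<lambda>j. frac_diff \<alpha> f j *\<^sub>C cesaro_sum \<alpha> T j x)) \<and>
         (x \<in> reg_calc_dom \<alpha> T F \<longrightarrow>
            reg_calc \<alpha> T F x = (\<Sum>j. frac_diff \<alpha> f j *\<^sub>C cesaro_sum \<alpha> T j x))"
proof -
  obtain u v \<rho> c where pair: "admissible_pair \<alpha> u v \<rho> c"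
    and fd: "\<And>n. frac_diff \<alpha> f n = of_real (u n)"
    and wc: "\<And>n. weyl_coeff \<alpha> (\<lambda>z. (1 - z) * F z) n = of_real (\<rho> n)"
    using admissible_imp_pair[OF assms(1-5)] by blast
  obtain M where op: "cesaro_operator \<alpha> T M"
    using cesaro_bounded_imp_operator[OF assms(1,6)] by blast
  interpret admissible_pair_operator \<alpha> u v \<rho> c T M
    using pair op assms(7)
    by (simp add: admissible_pair_operator_def admissible_pair_operator_axioms_def)
  let ?s = "\<lambda>j. frac_diff \<alpha> f j *\<^sub>C cesaro_sum \<alpha> T j x"
  let ?S = "\<lambda>N. calc \<alpha> T (u_trunc N) x"
  have s_eq: "?s j = u j *\<^sub>R cesaro_sum \<alpha> T j x" for j
    by (simp add: fd scaleR_scaleC)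
  have S_eq: "?S N = (\<Sum>j\<le>N. ?s j)" for N
    using calc_finite[of N "u_trunc N" \<alpha> T x] by (simp add: u_trunc_def s_eq)
  have fc: "fun_calc \<alpha> T (\<lambda>z. (1 - z) * F z) x = calc \<alpha> T \<rho> x"
    by (simp add: fun_calc_def calc_def wc scaleR_scaleC)
  have dom: "x \<in> reg_calc_dom \<alpha> T F \<longleftrightarrow> (\<exists>y. y - T y = calc \<alpha> T \<rho> x)"
    by (auto simp: reg_calc_dom_def fc image_iff) metis
  have i_ii: "?s sums y \<and> reg_calc \<alpha> T F x = y" if y: "y - T y = calc \<alpha> T \<rho> x" for y
  proof
    show "?s sums y"
      unfolding sums_def_le using partial_sums_tendsto[OF y] by (simp add: S_eq)
    show "reg_calc \<alpha> T F x = y"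
      unfolding reg_calc_def fc y[symmetric]
      using inv_f_f[OF inj_one_minus[OF dense], of y] by simp
  qed
  have ii_iii: "weakly_summable ?s" if "summable ?s"
  proof -
    have "(\<lambda>n. \<phi> (?s n)) sums \<phi> (suminf ?s)" if "bounded_clinear \<phi>" for \<phi> :: "'a \<Rightarrow> complex"
      using that bounded_linear.sums[OF _ summable_sums[OF \<open>summable ?s\<close>]]
      unfolding bounded_clinear_def by blast
    then show ?thesis unfolding weakly_summable_def weakly_sums_def by blast
  qed
  have iii_i: "x \<in> reg_calc_dom \<alpha> T F" if "weakly_summable ?s"
  proof -
    obtain y where y: "\<And>\<phi> :: 'a \<Rightarrow> complex. bounded_clinear \<phi> \<Longrightarrow> (\<lambda>n. \<phi> (?s n)) sums \<phi> y"
      using \<open>weakly_summable ?s\<close> unfolding weakly_summable_def weakly_sums_def by blast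
    have "\<phi> (y - T y - calc \<alpha> T \<rho> x) = 0" if \<phi>: "bounded_clinear \<phi>" for \<phi> :: "'a \<Rightarrow> complex"
    proof -
      interpret \<phi>: bounded_linear \<phi> using \<phi> by (simp add: bounded_clinear_def)
      have Tc: "T (a *\<^sub>C z) = a *\<^sub>C T z" for a z
        using assms(6) by (simp add: cesaro_bounded_def bounded_clinear_def)
      have scale_diff: "a *\<^sub>C z - a *\<^sub>C z' = a *\<^sub>C (z - z')" for a and z z' :: 'a
        by (rule linear_diff[OF bounded_linear.linear[OF scaleC_linear], symmetric])
      \<comment> \<open>Testing weak convergence with \<phi> composed with I - T moves I - T onto
        the partial sums, and their images converge in norm.\<close>
      have "bounded_clinear (\<lambda>z. \<phi> (z - T z))"
        unfolding bounded_clinear_def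
      proof
        show "bounded_linear (\<lambda>z. \<phi> (z - T z))"
          by (intro bounded_linear_compose[OF \<phi>.bounded_linear_axioms] bounded_linear_sub
              bounded_linear_ident T)
        show "\<forall>a z. \<phi> (a *\<^sub>C z - T (a *\<^sub>C z)) = a *\<^sub>C \<phi> (z - T z)"
          using \<phi> by (simp add: Tc scale_diff bounded_clinear_def)
      qed
      from y[OF this] have "(\<lambda>N. \<Sum>j\<le>N. \<phi> (?s j - T (?s j))) \<longlonglongrightarrow> \<phi> (y - T y)"
        by (simp add: sums_def_le)
      moreover have "(\<Sum>j\<le>N. \<phi> (?s j - T (?s j))) = \<phi> (?S N - T (?S N))" for N
        unfolding S_eq T.sum sum_subtractf[symmetric] \<phi>.sum ..
      moreover have "(\<lambda>N. \<phi> (?S N - T (?S N))) \<longlonglongrightarrow> \<phi> (calc \<alpha> T \<rho> x)"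
        by (rule \<phi>.tendsto[OF regularised_partial_sums_tendsto])
      ultimately have "\<phi> (y - T y) = \<phi> (calc \<alpha> T \<rho> x)"
        using LIMSEQ_unique by simp
      then show ?thesis by (simp add: \<phi>.diff)
    qed
    then have "y - T y - calc \<alpha> T \<rho> x = 0"
      using exists_bounded_clinear_nonzero by blast
    then show ?thesis unfolding dom by auto
  qed
  have "summable ?s \<and> reg_calc \<alpha> T F x = suminf ?s" if "x \<in> reg_calc_dom \<alpha> T F"
    using that i_ii unfolding dom by (metis sums_iff)
  then show ?thesis using ii_iii iii_i by blast
qed

end
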